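(* Let $(n_j)_j,(m_j)_j$ be strictly increasing sequences of positive integers with $\sum_j 1/m_j\le0.1$, $n_j^a/m_j\to\infty$ for every $a>0$, and $n_j/n_{j+1}<1/m_j$ for all $j$. Let $X$ be the completion of $c_{00}(\mathbb{N})$ under the norm implicitly defined by $\|x\|=\max\{\|x\|_\infty,(\sum_{j=1}^\infty\|x\|_j^2)^{1/2}\}$, where $\|x\|_j=\sup\{\frac1{m_j}\sum_{q=1}^{n_j}\|E_q(x)\|:E_1<\dots<E_{n_j}\}$, the supremum over finite subsets $E_1<\dots<E_{n_j}$ of $\mathbb{N}$ and $E(x)$ denoting the restriction of $x$ to $E$. Then for every $k\in\mathbb{N}$ and every $(e_n)_n\in\mathcal{SM}_k(X)$, the Banach space generated by $(e_n)_n$ contains no isomorphic copy of $\ell^p$ ($1\le p<\infty$) nor of $c_0$.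
   Context: $E_1<E_2$ means $\max E_1<\min E_2$. $[M]^k$: $k$-subsets of $M\subseteq\mathbb{N}$ (increasing enumerations, $M(l)$ the $l$-th element). Plegma family: $(s_j)_{j=1}^l$ in $[M]^k$ with $s_1(i)<\dots<s_l(i)$ ($i\le k$), $s_l(i)<s_1(i+1)$ ($i<k$). A $k$-sequence $(x_s)_{s\in[\mathbb{N}]^k}$ in $X$ generates the Hamel basis $(e_n)$ of a seminormed space $(E,\|\cdot\|_* )$ as a $k$-spreading model via infinite $M$ if for a null sequence $\delta_l>0$: $|\|\sum_{j=1}^m a_jx_{s_j}\|-\|\sum_{j=1}^m a_je_j\|_*|\le\delta_l$ for all $m\le l$, plegma $(s_j)_{j=1}^m$ in $[M]^k$ with $s_1(1)\ge M(l)$, $a_j\in[-1,1]$; $\mathcal{SM}_k(X)$ is the set of all such $(e_n)$. The Banach space generated by $(e_n)$ is the completion of its span modulo null vectors (for trivial $(e_n)$, i.e. $\|e_1-e_2\|_*=0$, this is at most one-dimensional). *)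

theory Defs
  imports "HOL-Analysis.Analysis" "HOL-Library.Infinite_Set"
begin

definition c00 :: "(nat \<Rightarrow> real) set" where
  "c00 = {a. finite {i. a i \<noteq> 0}}"

definition linear_on_c00 :: "((nat \<Rightarrow> real) \<Rightarrow> 'b::real_vector) \<Rightarrow> bool" where
  "linear_on_c00 T \<longleftrightarrow>
     (\<forall>a\<in>c00. \<forall>b\<in>c00. T (\<lambda>i. a i + b i) = T a + T b) \<and>
     (\<forall>a\<in>c00. \<forall>r::real. T (\<lambda>i. r * a i) = r *\<^sub>R T a)"

definition restr :: "nat set \<Rightarrow> (nat \<Rightarrow> real) \<Rightarrow> nat \<Rightarrow> real" where
  "restr E x = (\<lambda>i. if i \<in> E then x i else 0)"

text \<open>E < F means max E < min F (vacuous if one of them is empty).\<close>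
definition set_less :: "nat set \<Rightarrow> nat set \<Rightarrow> bool" where
  "set_less E F \<longleftrightarrow> (\<forall>a\<in>E. \<forall>b\<in>F. a < b)"

definition block_seq :: "nat \<Rightarrow> (nat \<Rightarrow> nat set) \<Rightarrow> bool" where
  "block_seq r E \<longleftrightarrow> (\<forall>q<r. finite (E q)) \<and> (\<forall>q q'. q < q' \<and> q' < r \<longrightarrow> set_less (E q) (E q'))"

definition sup_norm :: "(nat \<Rightarrow> real) \<Rightarrow> real" where
  "sup_norm x = Sup (range (\<lambda>i. \<bar>x i\<bar>))"

definition jnorm :: "((nat \<Rightarrow> real) \<Rightarrow> real) \<Rightarrow> (nat \<Rightarrow> nat) \<Rightarrow> (nat \<Rightarrow> nat) \<Rightarrow> nat
    \<Rightarrow> (nat \<Rightarrow> real) \<Rightarrow> real" where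
  "jnorm N n m j x =
     Sup {(1 / real (m j)) * (\<Sum>q<n j. N (restr (E q) x)) | E. block_seq (n j) E}"

definition implicit_norm :: "(nat \<Rightarrow> nat) \<Rightarrow> (nat \<Rightarrow> nat) \<Rightarrow> ((nat \<Rightarrow> real) \<Rightarrow> real) \<Rightarrow> bool" where
  "implicit_norm n m N \<longleftrightarrow>
     (\<forall>x\<in>c00. summable (\<lambda>j. (jnorm N n m j x)\<^sup>2) \<and>
        N x = max (sup_norm x) (sqrt (\<Sum>j. (jnorm N n m j x)\<^sup>2)))"

definition completion_map :: "((nat \<Rightarrow> real) \<Rightarrow> real) \<Rightarrow> ((nat \<Rightarrow> real) \<Rightarrow> 'a::banach) \<Rightarrow> bool" where
  "completion_map N J \<longleftrightarrow> linear_on_c00 J \<and> (\<forall>x\<in>c00. norm (J x) = N x) \<and>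
     closure (J ` c00) = UNIV"

text \<open>s(i) (1-based in the paper) is sorted_list_of_set s ! (i-1); sequences are 0-based here.\<close>
definition elt :: "nat set \<Rightarrow> nat \<Rightarrow> nat" where
  "elt s i = sorted_list_of_set s ! i"

definition k_subset :: "nat \<Rightarrow> nat set \<Rightarrow> nat set \<Rightarrow> bool" where
  "k_subset k M s \<longleftrightarrow> s \<subseteq> M \<and> finite s \<and> card s = k"

definition plegma :: "nat \<Rightarrow> nat set \<Rightarrow> nat \<Rightarrow> (nat \<Rightarrow> nat set) \<Rightarrow> bool" where
  "plegma k M l s \<longleftrightarrow> (\<forall>j<l. k_subset k M (s j)) \<and>
     (\<forall>i<k. \<forall>j. Suc j < l \<longrightarrow> elt (s j) i < elt (s (Suc j)) i) \<and>
     (\<forall>i. Suc i < k \<longrightarrow> elt (s (l - 1)) i < elt (s 0) (Suc i))"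

definition seminorm_c00 :: "((nat \<Rightarrow> real) \<Rightarrow> real) \<Rightarrow> bool" where
  "seminorm_c00 nu \<longleftrightarrow>
     (\<forall>a\<in>c00. \<forall>b\<in>c00. nu (\<lambda>i. a i + b i) \<le> nu a + nu b) \<and>
     (\<forall>a\<in>c00. \<forall>r::real. nu (\<lambda>i. r * a i) = \<bar>r\<bar> * nu a)"

text \<open>A sequence (e_j) (j = 0,1,...) forming a Hamel basis of a seminormed space is encoded by
  the seminorm nu a = ||sum_j a_j e_j||_* on finitely supported coefficient sequences a.
  The k-sequence x generates it as a k-spreading model via the infinite set M.
  The l-th element M(l) (1-based) is enumerate M (l-1).\<close>
definition generates_sm :: "nat \<Rightarrow> (nat set \<Rightarrow> 'a::real_normed_vector) \<Rightarrow> nat set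
    \<Rightarrow> ((nat \<Rightarrow> real) \<Rightarrow> real) \<Rightarrow> bool" where
  "generates_sm k x M nu \<longleftrightarrow> infinite M \<and>
     (\<exists>\<delta>::nat \<Rightarrow> real. (\<forall>l. \<delta> l > 0) \<and> \<delta> \<longlonglongrightarrow> 0 \<and>
       (\<forall>l\<ge>1. \<forall>r. 1 \<le> r \<and> r \<le> l \<longrightarrow>
         (\<forall>s. plegma k M r s \<and> elt (s 0) 0 \<ge> enumerate M (l - 1) \<longrightarrow>
           (\<forall>a::nat \<Rightarrow> real. (\<forall>j<r. \<bar>a j\<bar> \<le> 1) \<longrightarrow>
              \<bar>norm (\<Sum>j<r. a j *\<^sub>R x (s j)) - nu (\<lambda>j. if j < r then a j else 0)\<bar> \<le> \<delta> l))))"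

definition spreading_model :: "nat \<Rightarrow> (nat set \<Rightarrow> 'a::real_normed_vector)
    \<Rightarrow> ((nat \<Rightarrow> real) \<Rightarrow> real) \<Rightarrow> bool" where
  "spreading_model k x nu \<longleftrightarrow> seminorm_c00 nu \<and> (\<exists>M. generates_sm k x M nu)"

text \<open>T identifies the Banach space 'b with the space generated by (e_n): the completion
  of (span (e_n), ||.||_*) modulo null vectors.\<close>
definition generated_banach :: "((nat \<Rightarrow> real) \<Rightarrow> real) \<Rightarrow> ((nat \<Rightarrow> real) \<Rightarrow> 'b::banach) \<Rightarrow> bool" where
  "generated_banach nu T \<longleftrightarrow> linear_on_c00 T \<and> (\<forall>a\<in>c00. norm (T a) = nu a) \<and>
     closure (T ` c00) = UNIV"

definition lp_space :: "real \<Rightarrow> (nat \<Rightarrow> real) set" where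
  "lp_space p = {a. summable (\<lambda>i. \<bar>a i\<bar> powr p)}"

definition lp_norm :: "real \<Rightarrow> (nat \<Rightarrow> real) \<Rightarrow> real" where
  "lp_norm p a = (\<Sum>i. \<bar>a i\<bar> powr p) powr (1 / p)"

definition c0_space :: "(nat \<Rightarrow> real) set" where
  "c0_space = {a. a \<longlonglongrightarrow> 0}"

definition c0_norm :: "(nat \<Rightarrow> real) \<Rightarrow> real" where
  "c0_norm a = Sup (range (\<lambda>i. \<bar>a i\<bar>))"

definition embeds_iso :: "(nat \<Rightarrow> real) set \<Rightarrow> ((nat \<Rightarrow> real) \<Rightarrow> real) \<Rightarrow> 'b::real_normed_vector set \<Rightarrow> bool" where
  "embeds_iso S nrm Y \<longleftrightarrow> (\<exists>T c C. c > 0 \<and> C > 0 \<and> (\<forall>a\<in>S. T a \<in> Y) \<and>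
     (\<forall>a\<in>S. \<forall>b\<in>S. T (\<lambda>i. a i + b i) = T a + T b) \<and>
     (\<forall>a\<in>S. \<forall>r::real. T (\<lambda>i. r * a i) = r *\<^sub>R T a) \<and>
     (\<forall>a\<in>S. c * nrm a \<le> norm (T a) \<and> norm (T a) \<le> C * nrm a))"

end

theory Submission
  imports Defs
begin

text \<open>
  Write \<open>x\<^sub>s\<close> as a telescoping sum of \<open>k\<close> levels by taking iterated coordinatewise limits in the
  last elements of \<open>s\<close>; the limits stay in the space because its basis is boundedly complete. For
  a plegma family the level pieces are, up to small errors, successive blocks (level after level),
  plus a common vector that disappears for coefficient sequences with sum zero.

  A copy of \<open>\<ell>\<^sub>p\<close> or \<open>c\<^sub>0\<close> yields, by counting dimensions, successive zero-sum blocks of the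
  \<open>e\<^sub>n\<close> equivalent to the unit vector basis. If \<open>p > 1\<close> (or for \<open>c\<^sub>0\<close>), the pieces of one level
  show that the sum of \<open>n\<^sub>q\<close> blocks has norm at least a constant times \<open>n\<^sub>q / m\<^sub>q\<close>, which beats
  \<open>n\<^sub>q\<close> to the power \<open>1 / p\<close>.

  For \<open>p = 1\<close>, attach to a combination \<open>b\<close> the sequence \<open>\<lambda>(b)\<close> in \<open>\<ell>\<^sub>2\<close> of the limits of the
  \<open>j\<close>-norms of its level piece. The squared limit norm of \<open>b + b'\<close>, for successive \<open>b\<close> and \<open>b'\<close>,
  is controlled by the squares of the summands and \<open>2\<langle>\<lambda>(b), \<lambda>(b')\<rangle>\<close>, since iterated weak limits
  decouple the two. A long average \<open>b'\<close> has \<open>\<lambda>\<^sub>q(b')\<close> at most about \<open>1 / m\<^sub>q\<close>, so the inner product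
  is small and \<open>(b + b') / 2\<close> has level norm at most \<open>4/5\<close> of the original bound. Iterating over all
  levels produces convex combinations of arbitrarily small norm.
\<close>

section \<open>Ultrafilters and iterated limits\<close>

text \<open>The obstacle is the interleaving in a plegma family: all first elements precede all
  second elements, so a block of the \<open>e_n\<close> is not realised on one interval. Only its
  pieces of a fixed level are successive to those of other blocks. Estimates are therefore made
  level by level, at the cost of a factor \<open>k\<close> or by treating the levels in turn; the
  latter works because a convex combination that shrinks one level does not enlarge the bounds of
  the others. For \<open>p = 1\<close> the lower bound \<open>n\<^sub>q / m\<^sub>q\<close> is no
  contradiction, so an upper bound is needed. The triangle inequality gives \<open>2 * C\<close> for
  the sum of two vectors of level seminorm at most \<open>C\<close>; any factor below 2 would do,
  and exact orthogonality in \<open>\<ell>\<^sub>2\<close> would give \<open>sqrt 2\<close>. On the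
  coordinates that matter the inner product is at most about \<open>C\<^sup>2\<close> times the sum
  of the \<open>1 / m\<^sub>j\<close>, so the bound \<open>0.1\<close> on that sum leaves room for
  the factor \<open>8 / 5\<close>.\<close>

definition is_ultra :: "'a filter \<Rightarrow> bool" where
  "is_ultra F \<longleftrightarrow> F \<noteq> bot \<and> (\<forall>P. eventually P F \<or> eventually (\<lambda>x. \<not> P x) F)"

text \<open>Zorn's lemma for the reversed order: a chain of proper filters is a base of its infimum,
  which is therefore proper. A minimal filter decides every \<open>P\<close>, because meeting it
  with the principal filter of \<open>P\<close> gives either \<open>bot\<close> or the filter
  itself.\<close>

lemma ultrafilter_exists:
  assumes "F0 \<noteq> bot"
  shows "\<exists>F\<le>F0. is_ultra F"
proof -
  let ?A = "{F. F \<noteq> bot \<and> F \<le> F0}"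
  have "\<exists>m\<in>?A. \<forall>a\<in>?A. a \<le> m \<longrightarrow> a = m"
  proof (rule predicate_Zorn[where P = "\<lambda>x y. y \<le> x"])
    show "partial_order_on ?A (relation_of (\<lambda>x y. y \<le> x) ?A)"
      by (auto simp: partial_order_on_def preorder_on_def refl_on_def trans_def antisym_def
          relation_of_def)
  next
    fix C assume C: "C \<in> Chains (relation_of (\<lambda>x y. y \<le> x) ?A)"
    then have sub: "C \<subseteq> ?A" and lin: "\<And>x y. x \<in> C \<Longrightarrow> y \<in> C \<Longrightarrow> x \<le> y \<or> y \<le> x"
      by (auto simp: Chains_def relation_of_def)
    show "\<exists>u\<in>?A. \<forall>a\<in>C. u \<le> a"
    proof (cases "C = {}")
      case True then show ?thesis using assms by auto
    next
      case False
      have "\<exists>x\<in>C. x \<le> inf F G" if "F \<in> C" "G \<in> C" for F G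
        using lin[OF that] that by (auto simp: inf_absorb1 inf_absorb2)
      then have "eventually P (Inf C) \<longleftrightarrow> (\<exists>b\<in>C. eventually P b)" for P
        by (rule eventually_Inf_base[OF False])
      then have "Inf C \<noteq> bot"
        using sub unfolding trivial_limit_def by blast
      moreover have "Inf C \<le> F0"
      proof -
        obtain c where "c \<in> C" using False by blast
        then show ?thesis using sub Inf_lower[of c C] by (blast intro: order_trans)
      qed
      ultimately show ?thesis by (auto intro: Inf_lower)
    qed
  qed
  then obtain F where F: "F \<noteq> bot" "F \<le> F0"
    and min: "\<And>G. G \<noteq> bot \<Longrightarrow> G \<le> F0 \<Longrightarrow> G \<le> F \<Longrightarrow> G = F" by blast
  have "eventually P F \<or> eventually (\<lambda>x. \<not> P x) F" for P
  proof (cases "inf F (principal {x. P x}) = bot")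
    case True
    then have "eventually (\<lambda>x. False) (inf F (principal {x. P x}))" by simp
    then show ?thesis by (simp add: eventually_inf_principal)
  next
    case False
    then have "inf F (principal {x. P x}) = F"
      using min[of "inf F (principal {x. P x})"] F(2) by (simp add: le_infI1)
    then have "eventually P F \<longleftrightarrow> eventually P (inf F (principal {x. P x}))" by simp
    then show ?thesis by (simp add: eventually_inf_principal)
  qed
  then show ?thesis using F unfolding is_ultra_def by blast
qed

text \<open>The limit is the supremum of the eventual lower bounds. A number above it is not an
  eventual lower bound, so the ultrafilter puts \<open>f\<close> eventually below it.\<close>

lemma is_ultra_bounded_convergent:
  fixes f :: "'a \<Rightarrow> real"
  assumes "is_ultra F" and bd: "\<And>x. \<bar>f x\<bar> \<le> K"
  shows "\<exists>l. (f \<longlongrightarrow> l) F"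
proof -
  let ?S = "{y. \<forall>\<^sub>F x in F. y \<le> f x}"
  have ne: "-K \<in> ?S"
  proof -
    have "-K \<le> f x" for x using bd[of x] by linarith
    then show ?thesis by simp
  qed
  have ub: "y \<le> K" if "y \<in> ?S" for y
  proof -
    have "\<exists>x. y \<le> f x"
      using that assms(1) eventually_happens' unfolding is_ultra_def by blast
    then obtain x where "y \<le> f x" by blast
    then show ?thesis using bd[of x] by linarith
  qed
  have bdd: "bdd_above ?S" using ub by (rule bdd_aboveI)
  have "(f \<longlongrightarrow> Sup ?S) F"
  proof (rule order_tendstoI)
    fix a assume "a < Sup ?S"
    then obtain y where "y \<in> ?S" "a < y" using less_cSup_iff[OF _ bdd] ne by blast
    then show "\<forall>\<^sub>F x in F. a < f x" by (auto elim: eventually_mono)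
  next
    fix a assume a: "Sup ?S < a"
    have "a \<notin> ?S" using cSup_upper[OF _ bdd, of a] a by linarith
    then show "\<forall>\<^sub>F x in F. f x < a"
      using assms(1) unfolding is_ultra_def by (simp add: not_le[symmetric]) blast
  qed
  then show ?thesis by blast
qed

lemma is_ultra_tendsto_Lim:
  fixes f :: "'a \<Rightarrow> real"
  assumes "is_ultra F" "\<And>x. \<bar>f x\<bar> \<le> K"
  shows "(f \<longlongrightarrow> Lim F f) F"
proof -
  obtain l where "(f \<longlongrightarrow> l) F" using is_ultra_bounded_convergent[of F f K] assms by blast
  moreover have "Lim F f = l" using assms(1) calculation unfolding is_ultra_def by (intro tendsto_Lim) auto
  ultimately show ?thesis by simp
qed

lemma tendsto_abs_le:
  fixes f :: "'a \<Rightarrow> real"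
  assumes "F \<noteq> bot" "(f \<longlongrightarrow> l) F" "\<forall>\<^sub>F x in F. \<bar>f x\<bar> \<le> K"
  shows "\<bar>l\<bar> \<le> K"
  using tendsto_upperbound[OF tendsto_rabs[OF assms(2)] assms(3)] assms(1) by simp

text \<open>An environment assigns to \<open>(a, j)\<close> the \<open>a\<close>-th element of the \<open>j\<close>-th member of a plegma family.
  Letting the variables tend to infinity one after the other along a fixed ultrafilter replaces
  all Ramsey type stabilisations.\<close>

type_synonym env = "nat \<times> nat \<Rightarrow> nat"

text \<open>The head of the list is the outermost quantifier: its variable is fixed first, and each
  later one may be taken large depending on all earlier ones.\<close>

primrec iter_ev :: "nat filter \<Rightarrow> (nat \<times> nat) list \<Rightarrow> (env \<Rightarrow> bool) \<Rightarrow> env \<Rightarrow> bool" where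
  "iter_ev U [] P e = P e"
| "iter_ev U (p # ps) P e = (\<forall>\<^sub>F v in U. iter_ev U ps P (e(p := v)))"

text \<open>The iterated Fubini product of copies of \<open>U\<close>, one for each listed
  variable.\<close>

definition iter_filter :: "nat filter \<Rightarrow> (nat \<times> nat) list \<Rightarrow> env \<Rightarrow> env filter" where
  "iter_filter U ps e = Abs_filter (\<lambda>P. iter_ev U ps P e)"

primrec iter_lim :: "nat filter \<Rightarrow> (nat \<times> nat) list \<Rightarrow> (env \<Rightarrow> real) \<Rightarrow> env \<Rightarrow> real" where
  "iter_lim U [] F e = F e"
| "iter_lim U (p # ps) F e = Lim U (\<lambda>v. iter_lim U ps F (e(p := v)))"

definition var_inv :: "(env \<Rightarrow> 'b) \<Rightarrow> nat \<times> nat \<Rightarrow> bool" where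
  "var_inv F p \<longleftrightarrow> (\<forall>e v. F (e(p := v)) = F e)"

lemma var_invD: "var_inv F p \<Longrightarrow> F (e(p := v)) = F e"
  unfolding var_inv_def by blast

lemma iter_ev_True: "iter_ev U ps (\<lambda>_. True) e"
  by (induction ps arbitrary: e) auto

lemma iter_ev_conj:
  "iter_ev U ps P e \<Longrightarrow> iter_ev U ps Q e \<Longrightarrow> iter_ev U ps (\<lambda>x. P x \<and> Q x) e"
proof (induction ps arbitrary: e)
  case (Cons p ps)
  have "\<forall>\<^sub>F v in U. iter_ev U ps P (e(p := v))" "\<forall>\<^sub>F v in U. iter_ev U ps Q (e(p := v))"
    using Cons.prems by (simp_all only: iter_ev.simps)
  then show ?case unfolding iter_ev.simps by (rule eventually_elim2) (rule Cons.IH)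
qed simp

lemma iter_ev_mono:
  "iter_ev U ps P e \<Longrightarrow> (\<And>x. P x \<Longrightarrow> Q x) \<Longrightarrow> iter_ev U ps Q e"
proof (induction ps arbitrary: e)
  case (Cons p ps)
  then have "\<forall>\<^sub>F v in U. iter_ev U ps P (e(p := v))" by (simp only: iter_ev.simps)
  then show ?case unfolding iter_ev.simps
    by (rule eventually_mono) (rule Cons.IH, assumption, rule Cons.prems)
qed simp

lemma is_filter_iter_ev: "is_filter (\<lambda>P. iter_ev U ps P e)"
proof
  show "iter_ev U ps (\<lambda>x. True) e" by (rule iter_ev_True)
next
  fix P Q assume "iter_ev U ps P e" "iter_ev U ps Q e"
  then show "iter_ev U ps (\<lambda>x. P x \<and> Q x) e" by (rule iter_ev_conj)
next
  fix P Q :: "env \<Rightarrow> bool" assume "\<forall>x. P x \<longrightarrow> Q x" "iter_ev U ps P e"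
  then show "iter_ev U ps Q e" using iter_ev_mono[of U ps P e Q] by blast
qed

lemma eventually_iter_filter: "eventually P (iter_filter U ps e) \<longleftrightarrow> iter_ev U ps P e"
  unfolding iter_filter_def by (rule eventually_Abs_filter[OF is_filter_iter_ev])

lemma iter_filter_ultra:
  assumes "is_ultra U" shows "is_ultra (iter_filter U ps e)"
proof -
  have 1: "iter_ev U ps P e \<or> iter_ev U ps (\<lambda>x. \<not> P x) e" for P
  proof (induction ps arbitrary: e)
    case (Cons p ps)
    have "(\<forall>\<^sub>F v in U. iter_ev U ps P (e(p := v))) \<or> (\<forall>\<^sub>F v in U. \<not> iter_ev U ps P (e(p := v)))"
      using assms unfolding is_ultra_def by blast
    moreover have "iter_ev U ps (\<lambda>x. \<not> P x) (e(p := v))" if "\<not> iter_ev U ps P (e(p := v))" for v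
      using that Cons.IH by blast
    ultimately show ?case by (simp only: iter_ev.simps) (blast intro: eventually_mono)
  qed simp
  have 2: "\<not> iter_ev U ps (\<lambda>_. False) e"
  proof (induction ps arbitrary: e)
    case (Cons p ps)
    then show ?case using assms by (simp add: is_ultra_def eventually_False)
  qed simp
  show ?thesis unfolding is_ultra_def trivial_limit_def eventually_iter_filter using 1 2 by blast
qed

lemma iter_lim_bound:
  assumes U: "is_ultra U" and bd: "\<And>e. \<bar>F e\<bar> \<le> K"
  shows "\<bar>iter_lim U ps F e\<bar> \<le> K"
proof (induction ps arbitrary: e)
  case (Cons p ps)
  have "((\<lambda>v. iter_lim U ps F (e(p := v))) \<longlongrightarrow> iter_lim U (p # ps) F e) U"
    unfolding iter_lim.simps by (rule is_ultra_tendsto_Lim[OF U Cons.IH])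
  moreover have "\<forall>\<^sub>F v in U. \<bar>iter_lim U ps F (e(p := v))\<bar> \<le> K"
    using Cons.IH by (rule always_eventually[OF allI])
  moreover have "U \<noteq> bot" using U unfolding is_ultra_def by blast
  ultimately show ?case by (blast intro: tendsto_abs_le)
qed (simp add: bd)

lemma iter_lim_Cons_tendsto:
  assumes U: "is_ultra U" and bd: "\<And>e. \<bar>F e\<bar> \<le> K"
  shows "((\<lambda>v. iter_lim U ps F (e(p := v))) \<longlongrightarrow> iter_lim U (p # ps) F e) U"
  unfolding iter_lim.simps by (rule is_ultra_tendsto_Lim[OF U]) (rule iter_lim_bound[of U F K, OF U bd])

text \<open>Merges two nested limits into one limit along the product filter; needed both for single
  functionals and for the inner products of \<open>iter_lim_inner\<close>.\<close>

lemma tendsto_iter_filter_Cons: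
  fixes F :: "env \<Rightarrow> real"
  assumes F: "\<And>v. (F \<longlongrightarrow> h v) (iter_filter U ps (e(p := v)))" and h: "(h \<longlongrightarrow> l) U"
  shows "(F \<longlongrightarrow> l) (iter_filter U (p # ps) e)"
proof (rule tendstoI)
  fix r :: real assume r: "r > 0"
  have "\<forall>\<^sub>F v in U. dist (h v) l < r / 2" using h r by (intro tendstoD) auto
  moreover have "\<forall>\<^sub>F e' in iter_filter U ps (e(p := v)). dist (F e') (h v) < r / 2" for v
    using F r by (intro tendstoD) auto
  moreover have "dist (F e') l < r" if "dist (h v) l < r / 2" "dist (F e') (h v) < r / 2" for v e'
    using dist_triangle[of "F e'" l "h v"] that by linarith
  ultimately have "\<forall>\<^sub>F v in U. iter_ev U ps (\<lambda>e'. dist (F e') l < r) (e(p := v))"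
    unfolding eventually_iter_filter
    by (elim eventually_mono) (blast intro: iter_ev_mono)
  then show "\<forall>\<^sub>F e' in iter_filter U (p # ps) e. dist (F e') l < r"
    by (simp add: eventually_iter_filter)
qed

lemma iter_lim_tendsto:
  assumes U: "is_ultra U" and bd: "\<And>e. \<bar>F e\<bar> \<le> K"
  shows "(F \<longlongrightarrow> iter_lim U ps F e) (iter_filter U ps e)"
proof (induction ps arbitrary: e)
  case Nil
  show ?case by (rule tendstoI) (simp add: eventually_iter_filter)
next
  case (Cons p ps)
  show ?case
    by (rule tendsto_iter_filter_Cons[OF Cons.IH iter_lim_Cons_tendsto[of U F K, OF assms]])
qed

lemma iter_ev_var_inv:
  assumes "var_inv P p" shows "iter_ev U ps P (e(p := v)) = iter_ev U ps P e"
proof (induction ps arbitrary: e)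
  case Nil show ?case using var_invD[OF assms] by (simp only: iter_ev.simps)
next
  case (Cons q ps)
  have "(e(p := v))(q := w) = (if p = q then e(q := w) else (e(q := w))(p := v))" for w
    by (auto simp: fun_eq_iff)
  then show ?case using Cons.IH by (cases "p = q") (simp_all only: iter_ev.simps if_True if_False refl)
qed

lemma iter_lim_var_inv:
  assumes "var_inv F p" shows "iter_lim U ps F (e(p := v)) = iter_lim U ps F e"
proof (induction ps arbitrary: e)
  case Nil show ?case using var_invD[OF assms] by (simp only: iter_lim.simps)
next
  case (Cons q ps)
  have "(e(p := v))(q := w) = (if p = q then e(q := w) else (e(q := w))(p := v))" for w
    by (auto simp: fun_eq_iff)
  then show ?case using Cons.IH by (cases "p = q") (simp_all only: iter_lim.simps if_True if_False refl)
qed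

text \<open>A quantifier over a variable that \<open>P\<close> does not see ranges over a constant,
  hence disappears for a proper filter.\<close>

lemma iter_ev_drop:
  assumes "U \<noteq> bot" "\<And>p. p \<in> set ps \<Longrightarrow> \<not> A p \<Longrightarrow> var_inv P p"
  shows "iter_ev U ps P e = iter_ev U (filter A ps) P e"
  using assms(2)
proof (induction ps arbitrary: e)
  case (Cons p ps)
  show ?case
  proof (cases "A p")
    case True then show ?thesis using Cons by simp
  next
    case False
    then have "iter_ev U (p # ps) P e = (\<forall>\<^sub>F v in U. iter_ev U ps P e)"
      using iter_ev_var_inv[OF Cons.prems[OF _ False]] by (simp only: iter_ev.simps list.set_intros)
    moreover have "iter_ev U ps P e = iter_ev U (filter A ps) P e"
      by (rule Cons.IH) (rule Cons.prems, auto)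
    ultimately show ?thesis using False
      by (simp only: eventually_const[OF assms(1)] filter.simps if_False)
  qed
qed simp

text \<open>Diagonal choice: \<open>C i\<close> is secured at the moment the \<open>i\<close>-th
  variable is chosen, whatever the earlier values were, and no later choice can disturb it.\<close>

lemma iter_ev_all:
  assumes "\<And>i e. i < length ps \<Longrightarrow> \<forall>\<^sub>F v in U. C i (e(ps ! i := v))"
    and "\<And>i i'. i < i' \<Longrightarrow> i' < length ps \<Longrightarrow> var_inv (C i) (ps ! i')"
  shows "iter_ev U ps (\<lambda>e. \<forall>i<length ps. C i e) e"
  using assms
proof (induction ps arbitrary: C e)
  case Nil
  show ?case by simp
next
  case (Cons p ps C e)
  have ih: "iter_ev U ps (\<lambda>e. \<forall>i<length ps. C (Suc i) e) e" for e
  proof (rule Cons.IH)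
    fix i e assume "i < length ps"
    then show "\<forall>\<^sub>F v in U. C (Suc i) (e(ps ! i := v))"
      using Cons.prems(1)[of "Suc i" e] by (simp only: nth_Cons_Suc length_Cons Suc_less_eq)
  next
    fix i i' assume "i < i'" "i' < length ps"
    then show "var_inv (C (Suc i)) (ps ! i')"
      using Cons.prems(2)[of "Suc i" "Suc i'"] by (simp only: nth_Cons_Suc length_Cons Suc_less_eq)
  qed
  have inv: "var_inv (C 0) q" if "q \<in> set ps" for q
  proof -
    obtain i where "i < length ps" "q = ps ! i" using \<open>q \<in> set ps\<close> by (auto simp: in_set_conv_nth)
    then show ?thesis
      using Cons.prems(2)[of 0 "Suc i"] by (simp only: nth_Cons_Suc length_Cons Suc_less_eq zero_less_Suc)
  qed
  have const: "iter_ev U ps (C 0) e" if "C 0 e" for e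
    using that inv
  proof (induction ps arbitrary: e)
    case (Cons q ps)
    have "C 0 (e(q := v))" for v
      using Cons.prems(1) var_invD[OF Cons.prems(2)[of q], of e v] by (simp only: list.set_intros)
    then have "iter_ev U ps (C 0) (e(q := v))" for v
      by (rule Cons.IH) (rule Cons.prems(2), simp)
    then show ?case by (simp only: iter_ev.simps eventually_True)
  qed simp
  have "\<forall>\<^sub>F v in U. C 0 (e(p := v))" using Cons.prems(1)[of 0 e] by (simp only: nth_Cons_0 length_Cons zero_less_Suc)
  then have "\<forall>\<^sub>F v in U. iter_ev U ps (\<lambda>e. C 0 e \<and> (\<forall>i<length ps. C (Suc i) e)) (e(p := v))"
    by (rule eventually_mono) (rule iter_ev_conj[OF const ih])
  moreover have "(\<forall>i<length (p # ps). C i e) \<longleftrightarrow> C 0 e \<and> (\<forall>i<length ps. C (Suc i) e)" for e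
    by (auto simp: less_Suc_eq_0_disj)
  ultimately show ?case by (simp only: iter_ev.simps)
qed

section \<open>The implicitly defined norm\<close>

definition unit_vec :: "nat \<Rightarrow> nat \<Rightarrow> real" where
  "unit_vec c = (\<lambda>i. if i = c then 1 else 0)"

lemma c00_zero: "(\<lambda>_. 0) \<in> c00"
  by (simp add: c00_def)

lemma c00_unit: "unit_vec c \<in> c00"
  by (simp add: c00_def unit_vec_def)

lemma c00_add: "a \<in> c00 \<Longrightarrow> b \<in> c00 \<Longrightarrow> (\<lambda>i. a i + b i) \<in> c00"
  unfolding c00_def mem_Collect_eq
  by (rule finite_subset[of _ "{i. a i \<noteq> 0} \<union> {i. b i \<noteq> 0}"]) auto

lemma c00_scale: "a \<in> c00 \<Longrightarrow> (\<lambda>i. r * a i) \<in> c00"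
  unfolding c00_def mem_Collect_eq by (rule finite_subset[of _ "{i. a i \<noteq> 0}"]) auto

lemma c00_diff: "a \<in> c00 \<Longrightarrow> b \<in> c00 \<Longrightarrow> (\<lambda>i. a i - b i) \<in> c00"
  using c00_add[of a "\<lambda>i. (-1) * b i"] c00_scale[of b "-1"] by simp

lemma c00_sum:
  "finite I \<Longrightarrow> (\<And>i. i \<in> I \<Longrightarrow> f i \<in> c00) \<Longrightarrow> (\<lambda>c. \<Sum>i\<in>I. f i c) \<in> c00"
proof (induction I rule: finite_induct)
  case empty then show ?case by (simp add: c00_zero)
next
  case (insert i I)
  then show ?case using c00_add[of "f i" "\<lambda>c. \<Sum>i\<in>I. f i c"] by simp
qed

lemma c00_restr: "a \<in> c00 \<Longrightarrow> restr E a \<in> c00"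
  unfolding c00_def restr_def mem_Collect_eq by (rule finite_subset[of _ "{i. a i \<noteq> 0}"]) auto

lemma c00_restr_finite: "finite E \<Longrightarrow> restr E a \<in> c00"
  unfolding c00_def restr_def mem_Collect_eq by (rule finite_subset[of _ E]) auto

lemma c00_bound: assumes "a \<in> c00" obtains D where "\<And>i. D \<le> i \<Longrightarrow> a i = 0"
proof -
  have "finite {i. a i \<noteq> 0}" using assms by (simp add: c00_def)
  then obtain D where "\<forall>i\<in>{i. a i \<noteq> 0}. i < D" using finite_nat_set_iff_bounded by blast
  then have "a i = 0" if "D \<le> i" for i using that by (metis linorder_not_le mem_Collect_eq)
  then show ?thesis using that by blast
qed

lemma c00I: "(\<And>i. D \<le> i \<Longrightarrow> a i = 0) \<Longrightarrow> a \<in> c00"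
  unfolding c00_def mem_Collect_eq
  by (rule finite_subset[of _ "{..<D}"]) (auto simp: not_le[symmetric])

lemma c00_abs_bdd_above: "x \<in> c00 \<Longrightarrow> bdd_above (range (\<lambda>i. \<bar>x i\<bar>))"
proof -
  assume "x \<in> c00"
  then have "finite ((\<lambda>i. \<bar>x i\<bar>) ` {i. x i \<noteq> 0})" by (simp add: c00_def)
  moreover have "range (\<lambda>i. \<bar>x i\<bar>) \<subseteq> insert 0 ((\<lambda>i. \<bar>x i\<bar>) ` {i. x i \<noteq> 0})" by auto
  ultimately show ?thesis by (meson bdd_above_finite bdd_above_mono finite_insert)
qed

lemma restr_restr: "restr E (restr F x) = restr (E \<inter> F) x"
  by (auto simp: restr_def)

lemma restr_add: "restr E (\<lambda>i. a i + b i) = (\<lambda>i. restr E a i + restr E b i)"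
  by (auto simp: restr_def)

lemma restr_scale: "restr E (\<lambda>i. r * a i) = (\<lambda>i. r * restr E a i)"
  by (auto simp: restr_def)

lemma restr_sum: "restr E (\<lambda>c. \<Sum>i\<in>I. f i c) = (\<lambda>c. \<Sum>i\<in>I. restr E (f i) c)"
  by (auto simp: restr_def)

text \<open>The seminorm laws \<open>N_add\<close> and \<open>N_scale\<close> are not read off the
  implicit equation; they come from the linear isometry into the completion. The assumption
  \<open>growth\<close> is the growth condition for the exponent 1.\<close>

locale implicit_space =
  fixes n m :: "nat \<Rightarrow> nat" and N :: "(nat \<Rightarrow> real) \<Rightarrow> real"
  assumes n_pos: "n j > 0" and m_pos: "m j > 0"
    and m_summable: "summable (\<lambda>j. 1 / real (m j))" and m_sum: "(\<Sum>j. 1 / real (m j)) \<le> 1 / 10"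
    and growth: "filterlim (\<lambda>j. real (n j) / real (m j)) at_top sequentially"
    and impl: "implicit_norm n m N"
    and N_add: "a \<in> c00 \<Longrightarrow> b \<in> c00 \<Longrightarrow> N (\<lambda>i. a i + b i) \<le> N a + N b"
    and N_scale: "a \<in> c00 \<Longrightarrow> N (\<lambda>i. r * a i) = \<bar>r\<bar> * N a"
begin

abbreviation jn :: "nat \<Rightarrow> (nat \<Rightarrow> real) \<Rightarrow> real" where
  "jn q x \<equiv> jnorm N n m q x"

lemma N_zero: "N (\<lambda>_. 0) = 0"
  using N_scale[OF c00_zero, of 0] by simp

lemma N_nonneg: "a \<in> c00 \<Longrightarrow> 0 \<le> N a"
  using N_add[of a "\<lambda>i. (-1) * a i"] N_scale[of a "-1"] c00_scale[of a "-1"] N_zero by simp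

lemma N_sum:
  assumes "finite I" "\<And>i. i \<in> I \<Longrightarrow> f i \<in> c00"
  shows "N (\<lambda>c. \<Sum>i\<in>I. f i c) \<le> (\<Sum>i\<in>I. N (f i))"
  using assms
proof (induction I rule: finite_induct)
  case empty then show ?case by (simp add: N_zero)
next
  case (insert i I)
  have "N (\<lambda>c. f i c + (\<Sum>i\<in>I. f i c)) \<le> N (f i) + N (\<lambda>c. \<Sum>i\<in>I. f i c)"
    using insert by (intro N_add c00_sum) auto
  then show ?case using insert by simp
qed

lemma N_lin_comb:
  assumes "finite I" "\<And>i. i \<in> I \<Longrightarrow> f i \<in> c00"
  shows "N (\<lambda>c. \<Sum>i\<in>I. r i * f i c) \<le> (\<Sum>i\<in>I. \<bar>r i\<bar> * N (f i))"
  using N_sum[of I "\<lambda>i c. r i * f i c"] assms by (simp add: c00_scale N_scale)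

lemma N_diff_le: "a \<in> c00 \<Longrightarrow> b \<in> c00 \<Longrightarrow> N a \<le> N b + N (\<lambda>i. a i - b i)"
  using N_add[of b "\<lambda>i. a i - b i"] c00_diff by simp

lemma N_diff_sym: "a \<in> c00 \<Longrightarrow> b \<in> c00 \<Longrightarrow> N (\<lambda>i. a i - b i) = N (\<lambda>i. b i - a i)"
  using N_scale[of "\<lambda>i. a i - b i" "-1"] c00_diff by simp

lemma N_diff_abs: "a \<in> c00 \<Longrightarrow> b \<in> c00 \<Longrightarrow> \<bar>N a - N b\<bar> \<le> N (\<lambda>i. a i - b i)"
  using N_diff_le[of a b] N_diff_le[of b a] N_diff_sym[of a b] by linarith

text \<open>Crude, but it turns coordinatewise convergence on a finite set into convergence in
  norm.\<close>

lemma N_restr_coord: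
  assumes "finite E" shows "N (restr E x) \<le> (\<Sum>c\<in>E. \<bar>x c\<bar> * N (unit_vec c))"
proof -
  have "restr E x = (\<lambda>i. \<Sum>c\<in>E. x c * unit_vec c i)"
    using assms by (auto simp: restr_def unit_vec_def fun_eq_iff if_distrib[of "(*) _"] cong: if_cong)
  then show ?thesis using N_lin_comb[of E unit_vec x] assms by (simp add: c00_unit)
qed

lemma N_implicit:
  assumes "x \<in> c00"
  shows "summable (\<lambda>j. (jn j x)\<^sup>2)" "N x = max (sup_norm x) (sqrt (\<Sum>j. (jn j x)\<^sup>2))"
  using impl assms unfolding implicit_norm_def by auto

lemma abs_le_N: "x \<in> c00 \<Longrightarrow> \<bar>x c\<bar> \<le> N x"
proof -
  assume x: "x \<in> c00"
  have "\<bar>x c\<bar> \<le> sup_norm x" unfolding sup_norm_def by (rule cSup_upper) (auto intro: c00_abs_bdd_above x)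
  then show ?thesis using N_implicit(2)[OF x] by linarith
qed

lemma sup_norm_least: "(\<And>c. \<bar>x c\<bar> \<le> K) \<Longrightarrow> sup_norm x \<le> K"
  unfolding sup_norm_def by (rule cSup_least) auto

lemma jn_bdd:
  assumes "x \<in> c00"
  shows "bdd_above {(1 / real (m q)) * (\<Sum>i<n q. N (restr (E i) x)) | E. block_seq (n q) E}"
proof -
  let ?S = "{i. x i \<noteq> 0}"
  let ?K = "\<Sum>c\<in>?S. \<bar>x c\<bar> * N (unit_vec c)"
  have fin: "finite ?S" using assms by (simp add: c00_def)
  have "N (restr E x) \<le> ?K" for E
  proof -
    have "restr E x = restr (E \<inter> ?S) x" by (auto simp: restr_def)
    then have "N (restr E x) \<le> (\<Sum>c\<in>E \<inter> ?S. \<bar>x c\<bar> * N (unit_vec c))"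
      using N_restr_coord[of "E \<inter> ?S" x] fin by simp
    also have "\<dots> \<le> ?K" using fin N_nonneg[OF c00_unit] by (intro sum_mono2) auto
    finally show ?thesis .
  qed
  then have "(\<Sum>i<n q. N (restr (E i) x)) \<le> (\<Sum>i<n q. ?K)" for E by (intro sum_mono) auto
  then have "(1 / real (m q)) * (\<Sum>i<n q. N (restr (E i) x)) \<le> (1 / real (m q)) * (\<Sum>i<n q. ?K)" for E
    by (intro mult_left_mono) auto
  then show ?thesis by (intro bdd_aboveI) blast
qed

lemma jn_upper:
  assumes "x \<in> c00" "block_seq (n q) E"
  shows "(1 / real (m q)) * (\<Sum>i<n q. N (restr (E i) x)) \<le> jn q x"
  unfolding jnorm_def by (rule cSup_upper[OF _ jn_bdd[OF assms(1)]]) (use assms(2) in blast)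

lemma jn_least:
  assumes "\<And>E. block_seq (n q) E \<Longrightarrow> (1 / real (m q)) * (\<Sum>i<n q. N (restr (E i) x)) \<le> K"
  shows "jn q x \<le> K"
  unfolding jnorm_def
proof (rule cSup_least)
  have "block_seq (n q) (\<lambda>_. {})" by (simp add: block_seq_def set_less_def)
  then show "{(1 / real (m q)) * (\<Sum>i<n q. N (restr (E i) x)) | E. block_seq (n q) E} \<noteq> {}" by blast
qed (use assms in blast)

lemma jn_nonneg: "x \<in> c00 \<Longrightarrow> 0 \<le> jn q x"
proof -
  assume x: "x \<in> c00"
  have "block_seq (n q) (\<lambda>_. {})" by (simp add: block_seq_def set_less_def)
  from jn_upper[OF x this] show ?thesis by (simp add: restr_def N_zero)
qed

lemma jn_le_N: "x \<in> c00 \<Longrightarrow> jn q x \<le> N x"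
proof -
  assume x: "x \<in> c00"
  have "(\<Sum>j\<in>{q}. (jn j x)\<^sup>2) \<le> (\<Sum>j. (jn j x)\<^sup>2)"
    by (rule sum_le_suminf[OF N_implicit(1)[OF x]]) auto
  then have "sqrt ((jn q x)\<^sup>2) \<le> sqrt (\<Sum>j. (jn j x)\<^sup>2)" by (intro real_sqrt_le_mono) simp
  then show ?thesis using N_implicit(2)[OF x] by simp
qed

lemma jn_square_sum_le: "x \<in> c00 \<Longrightarrow> (\<Sum>j. (jn j x)\<^sup>2) \<le> (N x)\<^sup>2"
proof -
  assume x: "x \<in> c00"
  have "sqrt (\<Sum>j. (jn j x)\<^sup>2) \<le> N x" using N_implicit(2)[OF x] by simp
  then show ?thesis by (rule sqrt_le_D)
qed

lemma jn_square_partial_sum_le: "x \<in> c00 \<Longrightarrow> (\<Sum>j<Q. (jn j x)\<^sup>2) \<le> (N x)\<^sup>2"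
  using sum_le_suminf[OF N_implicit(1), of x "{..<Q}"] jn_square_sum_le[of x] by simp

lemma jn_add:
  assumes "x \<in> c00" "y \<in> c00" shows "jn q (\<lambda>i. x i + y i) \<le> jn q x + jn q y"
proof (rule jn_least)
  fix E assume E: "block_seq (n q) E"
  have "(\<Sum>i<n q. N (restr (E i) (\<lambda>i. x i + y i))) \<le> (\<Sum>i<n q. N (restr (E i) x) + N (restr (E i) y))"
    unfolding restr_add using assms by (intro sum_mono N_add c00_restr)
  then have "(1 / real (m q)) * (\<Sum>i<n q. N (restr (E i) (\<lambda>i. x i + y i)))
      \<le> (1 / real (m q)) * (\<Sum>i<n q. N (restr (E i) x) + N (restr (E i) y))"
    by (intro mult_left_mono) auto
  also have "\<dots> \<le> jn q x + jn q y"
    using jn_upper[OF assms(1) E] jn_upper[OF assms(2) E]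
    by (simp add: sum.distrib distrib_left del: times_divide_eq_left)
  finally show "(1 / real (m q)) * (\<Sum>i<n q. N (restr (E i) (\<lambda>i. x i + y i))) \<le> jn q x + jn q y" .
qed

lemma jn_scale_le:
  assumes "x \<in> c00" shows "jn q (\<lambda>i. r * x i) \<le> \<bar>r\<bar> * jn q x"
proof (rule jn_least)
  fix E assume E: "block_seq (n q) E"
  have "(1 / real (m q)) * (\<Sum>i<n q. N (restr (E i) (\<lambda>i. r * x i)))
     = \<bar>r\<bar> * ((1 / real (m q)) * (\<Sum>i<n q. N (restr (E i) x)))"
    unfolding restr_scale using assms by (simp add: N_scale c00_restr sum_distrib_left[symmetric])
  also have "\<dots> \<le> \<bar>r\<bar> * jn q x" by (intro mult_left_mono jn_upper[OF assms E]) auto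
  finally show "(1 / real (m q)) * (\<Sum>i<n q. N (restr (E i) (\<lambda>i. r * x i))) \<le> \<bar>r\<bar> * jn q x" .
qed

lemma jn_diff_abs:
  assumes "x \<in> c00" "y \<in> c00" shows "\<bar>jn q x - jn q y\<bar> \<le> N (\<lambda>i. x i - y i)"
  using jn_add[of y "\<lambda>i. x i - y i" q] jn_add[of x "\<lambda>i. y i - x i" q]
    jn_le_N[of "\<lambda>i. x i - y i" q] jn_le_N[of "\<lambda>i. y i - x i" q] N_diff_sym[OF assms]
    c00_diff[OF assms] c00_diff[OF assms(2,1)] assms by simp

text \<open>Intersecting the sets of an admissible family with \<open>F\<close> keeps it admissible,
  so every \<open>jn q\<close> shrinks under restriction; the implicit equation passes this on to
  \<open>N\<close> without an induction.\<close>

lemma N_restr: assumes "x \<in> c00" shows "N (restr F x) \<le> N x"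
proof -
  have rx: "restr F x \<in> c00" using assms by (rule c00_restr)
  have "jn q (restr F x) \<le> jn q x" for q
  proof (rule jn_least)
    fix E assume E: "block_seq (n q) E"
    have "block_seq (n q) (\<lambda>i. E i \<inter> F)"
      using E unfolding block_seq_def set_less_def by (meson IntD1 finite_Int)
    then show "(1 / real (m q)) * (\<Sum>i<n q. N (restr (E i) (restr F x))) \<le> jn q x"
      unfolding restr_restr by (rule jn_upper[OF assms])
  qed
  then have "(jn q (restr F x))\<^sup>2 \<le> (jn q x)\<^sup>2" for q
    by (intro power_mono jn_nonneg[OF rx])
  then have "(\<Sum>q. (jn q (restr F x))\<^sup>2) \<le> (\<Sum>q. (jn q x)\<^sup>2)"
    by (intro suminf_le N_implicit(1) rx assms)
  then have "sqrt (\<Sum>q. (jn q (restr F x))\<^sup>2) \<le> sqrt (\<Sum>q. (jn q x)\<^sup>2)"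
    by (rule real_sqrt_le_mono)
  also have "\<dots> \<le> N x" using N_implicit(2)[OF assms] by linarith
  finally have "sqrt (\<Sum>q. (jn q (restr F x))\<^sup>2) \<le> N x" .
  moreover have "sup_norm (restr F x) \<le> N x"
    by (rule sup_norm_least) (use abs_le_N[OF assms] N_nonneg[OF assms] in \<open>auto simp: restr_def\<close>)
  ultimately show ?thesis using N_implicit(2)[OF rx] by simp
qed

text \<open>One term of the square function and one admissible family. The estimates of order
  \<open>n q / m q\<close> from below rest on this.\<close>

lemma N_blocks_ge:
  assumes "x \<in> c00" "block_seq (n q) E"
  shows "(\<Sum>i<n q. N (restr (E i) x)) \<le> real (m q) * N x"
  using order_trans[OF jn_upper[OF assms] jn_le_N[OF assms(1)]] m_pos[of q]
  by (simp add: field_simps)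

text \<open>The basis is boundedly complete: otherwise \<open>n q\<close> successive pieces of norm \<open>\<epsilon>\<close> would
  have norm at least \<open>\<epsilon> n q / m q\<close>.\<close>

lemma tails_vanish:
  assumes bd: "\<And>E. finite E \<Longrightarrow> N (restr E y) \<le> B" and "\<epsilon> > 0"
  shows "\<exists>D. \<forall>E. finite E \<longrightarrow> E \<subseteq> {D..} \<longrightarrow> N (restr E y) \<le> \<epsilon>"
proof (rule ccontr)
  assume "\<not> ?thesis"
  then have "\<forall>D. \<exists>E. finite E \<and> E \<subseteq> {D..} \<and> \<epsilon> < N (restr E y)" by (meson not_le)
  then obtain G where G: "\<And>D. finite (G D)" "\<And>D. G D \<subseteq> {D..}" "\<And>D. \<epsilon> < N (restr (G D) y)" by metis
  \<comment> \<open>Each cut point leaps over the set chosen at the previous one, so the sets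
    \<open>G (d i)\<close> are successive.\<close>
  define d where "d = rec_nat 0 (\<lambda>_ D. Suc (Max (insert D (G D))))"
  have d_Suc: "d (Suc i) = Suc (Max (insert (d i) (G (d i))))" for i by (simp add: d_def)
  have up: "c < d (Suc i)" if "c \<in> G (d i)" for c i
    using that G(1) by (auto simp: d_Suc less_Suc_eq_le)
  have "d i < d (Suc i)" for i using G(1) by (auto simp: d_Suc less_Suc_eq_le)
  then have mono: "i \<le> j \<Longrightarrow> d i \<le> d j" for i j
    by (meson less_imp_le lift_Suc_mono_le)
  define E where "E i = G (d i)" for i
  have blk: "block_seq r E" for r
    unfolding block_seq_def set_less_def E_def
  proof (intro conjI allI impI ballI)
    fix q q' a b assume q: "q < q' \<and> q' < r" "a \<in> G (d q)" "b \<in> G (d q')"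
    have "a < d (Suc q)" using up q(2) .
    also have "\<dots> \<le> d q'" using q(1) by (intro mono) auto
    also have "\<dots> \<le> b" using G(2) q(3) by auto
    finally show "a < b" .
  qed (simp add: G)
  obtain q where q: "B / \<epsilon> < real (n q) / real (m q)"
    using growth unfolding filterlim_at_top_dense by (meson eventually_sequentially order_refl)
  let ?F = "\<Union>i<n q. E i"
  have finF: "finite ?F" using G(1) by (auto simp: E_def)
  have "real (n q) * \<epsilon> = (\<Sum>i<n q. \<epsilon>)" by simp
  also have "\<dots> \<le> (\<Sum>i<n q. N (restr (E i) (restr ?F y)))"
  proof (rule sum_mono)
    fix i assume "i \<in> {..<n q}"
    then have "restr (E i) (restr ?F y) = restr (E i) y" by (auto simp: restr_def fun_eq_iff)
    then show "\<epsilon> \<le> N (restr (E i) (restr ?F y))" using G(3)[of "d i"] by (simp add: E_def)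
  qed
  also have "\<dots> \<le> real (m q) * N (restr ?F y)"
    by (rule N_blocks_ge[OF c00_restr_finite[OF finF] blk])
  also have "\<dots> \<le> real (m q) * B" using bd[OF finF] by (intro mult_left_mono) auto
  finally show False using q \<open>\<epsilon> > 0\<close> m_pos[of q] by (simp add: field_simps)
qed

end

section \<open>Iterated weak limits in the Hilbert sequence space\<close>

lemma summable_product_of_squares:
  fixes f g :: "nat \<Rightarrow> real"
  assumes "summable (\<lambda>q. (f q)\<^sup>2)" "summable (\<lambda>q. (g q)\<^sup>2)"
  shows "summable (\<lambda>q. f q * g q)"
proof (rule summable_comparison_test[OF _ summable_add[OF assms]])
  have "norm (f q * g q) \<le> (f q)\<^sup>2 + (g q)\<^sup>2" for q
    using sum_squares_bound[of "\<bar>f q\<bar>" "\<bar>g q\<bar>"] zero_le_power2[of "f q"] zero_le_power2[of "g q"]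
      abs_mult[of "f q" "g q"] abs_ge_zero[of "f q * g q"]
    unfolding real_norm_def by (simp only: power2_abs mult.assoc)
  then show "\<exists>M. \<forall>q\<ge>M. norm (f q * g q) \<le> (f q)\<^sup>2 + (g q)\<^sup>2" by blast
qed

lemma summable_square_bounded:
  fixes f :: "nat \<Rightarrow> real"
  assumes "\<And>Q. (\<Sum>q<Q. (f q)\<^sup>2) \<le> K"
  shows "summable (\<lambda>q. (f q)\<^sup>2)" "(\<Sum>q. (f q)\<^sup>2) \<le> K"
proof -
  show "summable (\<lambda>q. (f q)\<^sup>2)"
    using assms by (intro summableI_nonneg_bounded) auto
  then show "(\<Sum>q. (f q)\<^sup>2) \<le> K" by (intro suminf_le_const assms)
qed

text \<open>Termwise \<open>\<bar>f g\<bar> \<le> t f\<^sup>2 + g\<^sup>2 / t\<close> with a free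
  weight: only the total mass of \<open>f\<close> is controlled, so \<open>t\<close> is taken small
  first and the tail of \<open>g\<close> is then made small against \<open>t\<close>.\<close>

lemma ell2_tail_inner:
  fixes f g :: "nat \<Rightarrow> real"
  assumes f: "\<And>Q. (\<Sum>q<Q. (f q)\<^sup>2) \<le> K" and g: "summable (\<lambda>q. (g q)\<^sup>2)" and t: "t > 0"
  shows "\<bar>\<Sum>q. f (q + Q) * g (q + Q)\<bar> \<le> t * K + (\<Sum>q. (g (q + Q))\<^sup>2) / t"
proof -
  note sf = summable_square_bounded[of f K, OF f]
  have sfQ: "summable (\<lambda>q. (f (q + Q))\<^sup>2)" using sf(1) by (subst summable_iff_shift)
  have sgQ: "summable (\<lambda>q. (g (q + Q))\<^sup>2)" using g by (subst summable_iff_shift)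
  have pt: "norm (f (q + Q) * g (q + Q)) \<le> t * (f (q + Q))\<^sup>2 + (g (q + Q))\<^sup>2 / t" for q
  proof -
    have "0 \<le> (t * \<bar>f (q + Q)\<bar> - \<bar>g (q + Q)\<bar>)\<^sup>2" by simp
    then have "2 * (\<bar>f (q + Q)\<bar> * \<bar>g (q + Q)\<bar>) * t \<le> t * t * (f (q + Q))\<^sup>2 + (g (q + Q))\<^sup>2"
      by (simp add: power2_diff power_mult_distrib algebra_simps power2_eq_square)
    then have "2 * (\<bar>f (q + Q)\<bar> * \<bar>g (q + Q)\<bar>) \<le> t * (f (q + Q))\<^sup>2 + (g (q + Q))\<^sup>2 / t"
      using t by (simp add: field_simps)
    moreover have "0 \<le> \<bar>f (q + Q)\<bar> * \<bar>g (q + Q)\<bar>" by simp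
    ultimately show ?thesis unfolding real_norm_def abs_mult by linarith
  qed
  have s: "summable (\<lambda>q. t * (f (q + Q))\<^sup>2 + (g (q + Q))\<^sup>2 / t)"
    by (intro summable_add summable_mult summable_divide sfQ sgQ)
  have "\<bar>\<Sum>q. f (q + Q) * g (q + Q)\<bar> \<le> (\<Sum>q. t * (f (q + Q))\<^sup>2 + (g (q + Q))\<^sup>2 / t)"
    using norm_suminf_le[of "\<lambda>q. f (q + Q) * g (q + Q)", OF pt s] by simp
  also have "\<dots> = t * (\<Sum>q. (f (q + Q))\<^sup>2) + (\<Sum>q. (g (q + Q))\<^sup>2) / t"
    using suminf_add[OF summable_mult[OF sfQ, of t] summable_divide[OF sgQ, of t]]
      suminf_mult[OF sfQ, of t] suminf_divide[OF sgQ, of t] by simp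
  finally have le: "\<bar>\<Sum>q. f (q + Q) * g (q + Q)\<bar> \<le> t * (\<Sum>q. (f (q + Q))\<^sup>2) + (\<Sum>q. (g (q + Q))\<^sup>2) / t" .
  have "(\<Sum>q. (f (q + Q))\<^sup>2) \<le> (\<Sum>q. (f q)\<^sup>2)"
    unfolding suminf_minus_initial_segment[OF sf(1)] by (simp add: sum_nonneg)
  then have "t * (\<Sum>q. (f (q + Q))\<^sup>2) \<le> t * K" using sf(2) t by (intro mult_left_mono) auto
  then show ?thesis using le by linarith
qed

text \<open>Bounded and coordinatewise convergent means weakly convergent: the fixed
  \<open>g\<close> makes the tails small uniformly in \<open>v\<close>, and finitely many
  coordinates remain.\<close>

lemma ell2_weak_tendsto:
  fixes f :: "'v \<Rightarrow> nat \<Rightarrow> real" and g :: "nat \<Rightarrow> real"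
  assumes F: "F \<noteq> bot" and f: "\<And>v Q. (\<Sum>q<Q. (f v q)\<^sup>2) \<le> K" and g: "\<And>Q. (\<Sum>q<Q. (g q)\<^sup>2) \<le> K"
    and lim: "\<And>q. ((\<lambda>v. f v q) \<longlongrightarrow> h q) F"
  shows "((\<lambda>v. \<Sum>q. f v q * g q) \<longlongrightarrow> (\<Sum>q. h q * g q)) F"
proof (rule tendstoI)
  fix r :: real assume r: "r > 0"
  have h: "(\<Sum>q<Q. (h q)\<^sup>2) \<le> K" for Q
  proof (rule tendsto_upperbound)
    show "((\<lambda>v. \<Sum>q<Q. (f v q)\<^sup>2) \<longlongrightarrow> (\<Sum>q<Q. (h q)\<^sup>2)) F"
      by (intro tendsto_sum tendsto_power lim)
  qed (use f F in auto)
  have K: "K \<ge> 0" using g[of 0] by simp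
  have sg: "summable (\<lambda>q. (g q)\<^sup>2)" using g by (rule summable_square_bounded)
  \<comment> \<open>With this \<open>t\<close> and a tail of \<open>g\<close> below
    \<open>t * (r / 8)\<close>, each of the two tails of inner products is below
    \<open>r / 4\<close>, which leaves \<open>r / 2\<close> for the head.\<close>
  define t where "t = r / (8 * (K + 1))"
  have t: "t > 0" "t * K \<le> r / 8" using r K by (auto simp: t_def field_simps)
  have "(\<lambda>Q. \<Sum>q. (g (q + Q))\<^sup>2) \<longlonglongrightarrow> 0"
    using suminf_exist_split2[OF sg] .
  then have "\<forall>\<^sub>F Q in sequentially. (\<Sum>q. (g (q + Q))\<^sup>2) < t * (r / 8)"
    using r t by (intro order_tendstoD) auto
  then obtain Q where Q: "(\<Sum>q. (g (q + Q))\<^sup>2) < t * (r / 8)"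
    by (meson eventually_sequentially order_refl)
  have tail: "\<bar>\<Sum>q. w (q + Q) * g (q + Q)\<bar> < r / 4" if w: "\<And>Q. (\<Sum>q<Q. (w q)\<^sup>2) \<le> K" for w
  proof -
    have "(\<Sum>q. (g (q + Q))\<^sup>2) / t < r / 8" using Q t(1) by (simp add: field_simps)
    then show ?thesis using ell2_tail_inner[of w K g t Q, OF w sg t(1)] t(2) by linarith
  qed
  have split: "(\<Sum>q. w q * g q) = (\<Sum>q. w (q + Q) * g (q + Q)) + (\<Sum>q<Q. w q * g q)"
    if w: "\<And>Q. (\<Sum>q<Q. (w q)\<^sup>2) \<le> K" for w
    by (rule suminf_split_initial_segment)
      (rule summable_product_of_squares[OF summable_square_bounded(1)[of w K, OF w] sg])
  have "((\<lambda>v. \<Sum>q<Q. f v q * g q) \<longlongrightarrow> (\<Sum>q<Q. h q * g q)) F"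
    by (intro tendsto_sum tendsto_mult lim tendsto_const)
  then have "\<forall>\<^sub>F v in F. dist (\<Sum>q<Q. f v q * g q) (\<Sum>q<Q. h q * g q) < r / 2"
    using r by (intro tendstoD) auto
  then show "\<forall>\<^sub>F v in F. dist (\<Sum>q. f v q * g q) (\<Sum>q. h q * g q) < r"
  proof (rule eventually_mono)
    fix v assume "dist (\<Sum>q<Q. f v q * g q) (\<Sum>q<Q. h q * g q) < r / 2"
    then show "dist (\<Sum>q. f v q * g q) (\<Sum>q. h q * g q) < r"
      using tail[of "f v", OF f] tail[of h, OF h] split[of "f v", OF f] split[of h, OF h]
      unfolding dist_real_def by linarith
  qed
qed

text \<open>In each step of the iterated limit only one of the two vectors moves, and it converges weakly.\<close>

lemma iter_lim_inner:
  fixes f g :: "env \<Rightarrow> nat \<Rightarrow> real"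
  assumes U: "is_ultra U"
    and f: "\<And>e Q. (\<Sum>q<Q. (f e q)\<^sup>2) \<le> K" and g: "\<And>e Q. (\<Sum>q<Q. (g e q)\<^sup>2) \<le> K"
    and inv: "\<And>p. p \<in> set ps \<Longrightarrow> var_inv f p \<or> var_inv g p"
  shows "((\<lambda>e. \<Sum>q. f e q * g e q) \<longlongrightarrow>
    (\<Sum>q. iter_lim U ps (\<lambda>e. f e q) e * iter_lim U ps (\<lambda>e. g e q) e)) (iter_filter U ps e)"
  using inv
proof (induction ps arbitrary: e)
  case Nil
  show ?case by (rule tendstoI) (simp add: eventually_iter_filter)
next
  case (Cons p ps)
  let ?l = "\<lambda>w q. iter_lim U ps (\<lambda>e. w e q)" and ?L = "\<lambda>w q. iter_lim U (p # ps) (\<lambda>e. w e q) e"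
  have K: "K \<ge> 0" using g[of e 0] by simp
  have Ub: "U \<noteq> bot" using U by (simp add: is_ultra_def)
  have bound: "\<bar>w e q\<bar> \<le> sqrt K" if w: "\<And>e Q. (\<Sum>q<Q. (w e q)\<^sup>2) \<le> K" for w :: "env \<Rightarrow> nat \<Rightarrow> real" and e q
  proof -
    have "(w e q)\<^sup>2 \<le> (\<Sum>q<Suc q. (w e q)\<^sup>2)" by (simp add: sum_nonneg)
    also have "\<dots> \<le> K" by (rule w)
    finally show ?thesis using real_le_rsqrt[of "\<bar>w e q\<bar>" K] by simp
  qed
  have limsq: "(\<Sum>q<Q. (?l w q e)\<^sup>2) \<le> K"
    if w: "\<And>e Q. (\<Sum>q<Q. (w e q)\<^sup>2) \<le> K" for w :: "env \<Rightarrow> nat \<Rightarrow> real" and e and Q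
  proof (rule tendsto_upperbound)
    show "((\<lambda>e. \<Sum>q<Q. (w e q)\<^sup>2) \<longlongrightarrow> (\<Sum>q<Q. (?l w q e)\<^sup>2)) (iter_filter U ps e)"
      by (intro tendsto_sum tendsto_power) (rule iter_lim_tendsto[OF U], rule bound[of w, OF w])
    show "\<forall>\<^sub>F x in iter_filter U ps e. (\<Sum>q<Q. (w x q)\<^sup>2) \<le> K" using w by simp
    show "iter_filter U ps e \<noteq> bot" using iter_filter_ultra[OF U] unfolding is_ultra_def by blast
  qed
  have step: "((\<lambda>v. ?l w q (e(p := v))) \<longlongrightarrow> ?L w q) U"
    if w: "\<And>e Q. (\<Sum>q<Q. (w e q)\<^sup>2) \<le> K" for w :: "env \<Rightarrow> nat \<Rightarrow> real" and q
    by (rule iter_lim_Cons_tendsto[OF U]) (rule bound[of w, OF w])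
  \<comment> \<open>A vector that ignores \<open>p\<close> is not changed by the limit over
    \<open>p\<close>; it is the one held fixed in the weak convergence below.\<close>
  have const: "?l w q (e(p := v)) = ?L w q"
    if "var_inv w p" and w: "\<And>e Q. (\<Sum>q<Q. (w e q)\<^sup>2) \<le> K" for w :: "env \<Rightarrow> nat \<Rightarrow> real" and q v
  proof -
    have "var_inv (\<lambda>e. w e q) p" using that(1) unfolding var_inv_def by metis
    then have c: "?l w q (e(p := v)) = ?l w q e" for v
      by (rule iter_lim_var_inv)
    then have "((\<lambda>v. ?l w q e) \<longlongrightarrow> ?L w q) U"
      using step[of w q, OF w] by (simp only:)
    then show ?thesis unfolding tendsto_const_iff[OF Ub] c .
  qed
  let ?h = "\<lambda>v. \<Sum>q. ?l f q (e(p := v)) * ?l g q (e(p := v))"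
  have "(?h \<longlongrightarrow> (\<Sum>q. ?L f q * ?L g q)) U"
  proof -
    consider "var_inv f p" | "var_inv g p" using Cons.prems by (meson list.set_intros(1))
    then show ?thesis
    proof cases
      case 1
      have "((\<lambda>v. \<Sum>q. ?l g q (e(p := v)) * ?L f q)
        \<longlongrightarrow> (\<Sum>q. ?L g q * ?L f q)) U"
      proof (rule ell2_weak_tendsto[OF Ub])
        show "(\<Sum>q<Q. (?L f q)\<^sup>2) \<le> K" for Q
          using limsq[of f, OF f] const[OF 1 f] by (metis (no_types, lifting) sum.cong)
      qed (rule limsq[of g, OF g], rule step[of g, OF g])
      then show ?thesis by (simp only: const[OF 1 f] mult.commute)
    next
      case 2
      have "((\<lambda>v. \<Sum>q. ?l f q (e(p := v)) * ?L g q)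
        \<longlongrightarrow> (\<Sum>q. ?L f q * ?L g q)) U"
      proof (rule ell2_weak_tendsto[OF Ub])
        show "(\<Sum>q<Q. (?L g q)\<^sup>2) \<le> K" for Q
          using limsq[of g, OF g] const[OF 2 g] by (metis (no_types, lifting) sum.cong)
      qed (rule limsq[of f, OF f], rule step[of f, OF f])
      then show ?thesis by (simp only: const[OF 2 g])
    qed
  qed
  then show ?case
    by (rule tendsto_iter_filter_Cons[rotated]) (rule Cons.IH, rule Cons.prems, simp)
qed

section \<open>The filter of plegma families\<close>

text \<open>All first elements of the \<open>R\<close> members come before all second elements, and
  so on: the order in which the elements of a plegma family increase. Position \<open>i\<close>
  holds the pair \<open>(i div R, i mod R)\<close>.\<close>

definition lex_vars :: "nat \<Rightarrow> nat \<Rightarrow> (nat \<times> nat) list" where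
  "lex_vars k R = List.product [0..<k] [0..<R]"

abbreviation lex_ev :: "nat filter \<Rightarrow> nat \<Rightarrow> nat \<Rightarrow> (env \<Rightarrow> bool) \<Rightarrow> bool" where
  "lex_ev U k R P \<equiv> iter_ev U (lex_vars k R) P (\<lambda>_. 0)"

text \<open>The number \<open>R\<close> of columns is irrelevant for events that depend on finitely many columns.\<close>

definition plegma_filter :: "nat filter \<Rightarrow> nat \<Rightarrow> env filter" where
  "plegma_filter U k = Abs_filter (\<lambda>P. \<exists>R0. \<forall>R\<ge>R0. lex_ev U k R P)"

lemma filter_lex_vars:
  assumes "R0 \<le> R" shows "filter (\<lambda>p. snd p < R0) (lex_vars k R) = lex_vars k R0"
proof -
  have "filter (\<lambda>j. j < R0) [0..<R] = [0..<R0]"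
    using assms by (induction R) (auto simp: le_Suc_eq)
  then have "filter (\<lambda>p. snd p < R0) (List.product xs [0..<R]) = List.product xs [0..<R0]" for xs :: "nat list"
    by (induction xs) (auto simp: filter_map o_def)
  then show ?thesis by (simp add: lex_vars_def)
qed

lemma length_lex_vars: "length (lex_vars k R) = k * R"
  by (simp add: lex_vars_def)

lemma nth_lex_vars: "i < k * R \<Longrightarrow> lex_vars k R ! i = (i div R, i mod R)"
proof -
  assume i: "i < k * R"
  then have "0 < R" by (cases R) auto
  then have "i mod R < R" "i div R < k" using i by (auto simp: less_mult_imp_div_less)
  then show ?thesis unfolding lex_vars_def using i by (subst product_nth) auto
qed

lemma eventually_plegma_filter_iff:
  "eventually P (plegma_filter U k) \<longleftrightarrow> (\<exists>R0. \<forall>R\<ge>R0. lex_ev U k R P)"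
  unfolding plegma_filter_def
proof (rule eventually_Abs_filter, rule is_filter.intro)
  show "\<exists>R0. \<forall>R\<ge>R0. lex_ev U k R (\<lambda>x. True)" by (simp add: iter_ev_True)
next
  fix P Q
  assume "\<exists>R0. \<forall>R\<ge>R0. lex_ev U k R P" "\<exists>R0. \<forall>R\<ge>R0. lex_ev U k R Q"
  then obtain R1 R2 where "\<forall>R\<ge>R1. lex_ev U k R P" "\<forall>R\<ge>R2. lex_ev U k R Q"
    by blast
  then have "\<forall>R\<ge>max R1 R2. lex_ev U k R (\<lambda>x. P x \<and> Q x)"
    by (intro allI impI iter_ev_conj) auto
  then show "\<exists>R0. \<forall>R\<ge>R0. lex_ev U k R (\<lambda>x. P x \<and> Q x)" by blast
next
  fix P Q :: "env \<Rightarrow> bool"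
  assume PQ: "\<forall>x. P x \<longrightarrow> Q x" and "\<exists>R0. \<forall>R\<ge>R0. lex_ev U k R P"
  then obtain R1 where "\<forall>R\<ge>R1. lex_ev U k R P" by blast
  then have "\<forall>R\<ge>R1. lex_ev U k R Q"
    using iter_ev_mono[of U _ P _ Q] PQ by blast
  then show "\<exists>R0. \<forall>R\<ge>R0. lex_ev U k R Q" by blast
qed

definition col_inv :: "nat \<Rightarrow> (env \<Rightarrow> 'b) \<Rightarrow> bool" where
  "col_inv R F \<longleftrightarrow> (\<forall>a j. R \<le> j \<longrightarrow> var_inv F (a, j))"

lemma col_inv_comp: "col_inv R F \<Longrightarrow> col_inv R (\<lambda>e. G (F e))"
  unfolding col_inv_def var_inv_def by metis

lemma eventually_plegma_filter:
  assumes U: "is_ultra U" and inv: "col_inv R P"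
  shows "eventually P (plegma_filter U k) \<longleftrightarrow> lex_ev U k R P"
proof -
  have eq: "lex_ev U k R' P = lex_ev U k R P" if "R \<le> R'" for R'
  proof -
    have "lex_ev U k R' P
      = iter_ev U (filter (\<lambda>p. snd p < R) (lex_vars k R')) P (\<lambda>_. 0)"
    proof (rule iter_ev_drop)
      show "U \<noteq> bot" using U by (simp add: is_ultra_def)
      fix p :: "nat \<times> nat" assume "\<not> snd p < R"
      then have "var_inv P (fst p, snd p)" using inv unfolding col_inv_def by (metis not_less)
      then show "var_inv P p" by simp
    qed
    then show ?thesis by (simp only: filter_lex_vars[OF that])
  qed
  show ?thesis unfolding eventually_plegma_filter_iff
  proof
    assume "\<exists>R0. \<forall>R\<ge>R0. lex_ev U k R P"
    then obtain R0 where "\<forall>R\<ge>R0. lex_ev U k R P" by blast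
    then have "lex_ev U k (max R R0) P" by simp
    then show "lex_ev U k R P" using eq[of "max R R0"] by simp
  next
    assume "lex_ev U k R P"
    then show "\<exists>R0. \<forall>R\<ge>R0. lex_ev U k R P" using eq by blast
  qed
qed

lemma plegma_filter_nonbot:
  assumes "is_ultra U" shows "plegma_filter U k \<noteq> bot"
proof
  assume "plegma_filter U k = bot"
  then have "eventually (\<lambda>_. False) (plegma_filter U k)" by simp
  then have "lex_ev U k 0 (\<lambda>_. False)"
    by (subst (asm) eventually_plegma_filter[OF assms, of 0]) (auto simp: col_inv_def var_inv_def)
  then have "eventually (\<lambda>_. False) (iter_filter U (lex_vars k 0) (\<lambda>_. 0))" by (simp only: eventually_iter_filter)
  then show False using iter_filter_ultra[OF assms, of "lex_vars k 0" "\<lambda>_. 0"]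
    unfolding is_ultra_def by (simp add: eventually_False)
qed

lemma tendsto_plegma_filter_iff:
  fixes F :: "env \<Rightarrow> real"
  assumes U: "is_ultra U" and inv: "col_inv R F"
  shows "(F \<longlongrightarrow> l) (plegma_filter U k) \<longleftrightarrow> (F \<longlongrightarrow> l) (iter_filter U (lex_vars k R) (\<lambda>_. 0))"
  unfolding tendsto_iff eventually_iter_filter
  by (subst eventually_plegma_filter[OF U, of R]) (auto intro: col_inv_comp[OF inv])

lemma tendsto_plegma_filter:
  fixes F :: "env \<Rightarrow> real"
  assumes U: "is_ultra U" and bd: "\<And>e. \<bar>F e\<bar> \<le> K" and inv: "col_inv R F"
  shows "(F \<longlongrightarrow> iter_lim U (lex_vars k R) F (\<lambda>_. 0)) (plegma_filter U k)"
  unfolding tendsto_plegma_filter_iff[OF U inv] by (rule iter_lim_tendsto[OF U bd])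

text \<open>Each variable is chosen in \<open>M\<close> and beyond all previous ones, which is
  possible because \<open>U\<close> refines the filter of tails of \<open>M\<close>.\<close>

lemma plegma_filter_increasing:
  assumes U: "is_ultra U" and UM: "U \<le> inf sequentially (principal M)"
  shows "\<forall>\<^sub>F e in plegma_filter U k. \<forall>i<k*R. e (i div R, i mod R) \<in> M \<and> L \<le> e (i div R, i mod R)
    \<and> (\<forall>i'<i. e (i' div R, i' mod R) < e (i div R, i mod R))"
proof -
  let ?p = "\<lambda>i. (i div R, i mod R)"
  let ?C = "\<lambda>i e. e (?p i) \<in> M \<and> L \<le> e (?p i) \<and> (\<forall>i'<i. e (?p i') < e (?p i))"
  have inj: "?p i \<noteq> ?p i'" if "i < i'" for i i'
    using that by (metis Pair_inject div_mult_mod_eq less_irrefl)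
  have U': "\<forall>\<^sub>F v in U. v \<in> M \<and> K \<le> v" for K
    by (rule filter_leD[OF UM])
      (auto simp: eventually_inf_principal intro: eventually_mono[OF eventually_ge_at_top[of K]])
  have "lex_ev U k R (\<lambda>e. \<forall>i<length (lex_vars k R). ?C i e)"
  proof (rule iter_ev_all)
    fix i and e :: env assume i: "i < length (lex_vars k R)"
    then have p: "lex_vars k R ! i = ?p i" by (simp add: length_lex_vars nth_lex_vars)
    \<comment> \<open>The sum dominates every earlier value at once, and \<open>L\<close> is
      included.\<close>
    have "\<forall>\<^sub>F v in U. v \<in> M \<and> Suc (L + (\<Sum>i'<i. e (?p i'))) \<le> v" by (rule U')
    then show "\<forall>\<^sub>F v in U. ?C i (e(lex_vars k R ! i := v))"
    proof (rule eventually_mono)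
      fix v assume v: "v \<in> M \<and> Suc (L + (\<Sum>i'<i. e (?p i'))) \<le> v"
      have "e (?p i') < v" if "i' < i" for i'
        using member_le_sum[of i' "{..<i}" "\<lambda>i'. e (?p i')"] that v by simp
      moreover have "(e(?p i := v)) (?p i') = e (?p i')" if "i' < i" for i'
        using inj[OF that] by (simp only: fun_upd_other not_False_eq_True)
      ultimately show "?C i (e(lex_vars k R ! i := v))"
        using v unfolding p by (simp del: fun_upd_apply add: fun_upd_same)
    qed
  next
    fix i i' assume i: "i < i'" "i' < length (lex_vars k R)"
    then have p: "lex_vars k R ! i' = ?p i'" by (simp add: length_lex_vars nth_lex_vars)
    have "(e(?p i' := v)) (?p i0) = e (?p i0)" if "i0 \<le> i" for i0 v and e :: env
      using inj[of i0 i'] that i by (simp only: fun_upd_other not_False_eq_True le_less_trans)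
    then show "var_inv (?C i) (lex_vars k R ! i')"
      unfolding p var_inv_def by (metis less_imp_le order_refl)
  qed
  then have "lex_ev U k R (\<lambda>e. \<forall>i<k*R. ?C i e)" by (simp only: length_lex_vars)
  moreover have "col_inv R (\<lambda>e. \<forall>i<k*R. ?C i e)"
    unfolding col_inv_def var_inv_def
  proof (intro allI impI)
    fix a j and e :: env and v assume "R \<le> j"
    define g where "g = e((a, j) := v)"
    have g: "g (?p i) = e (?p i)" if "i < k * R" for i
    proof -
      have "R > 0" using that by (cases R) auto
      then have "i mod R \<noteq> j" using \<open>R \<le> j\<close> mod_less_divisor[of R i] by linarith
      then show ?thesis by (simp add: g_def)
    qed
    have "?C i g = ?C i e" if "i < k * R" for i
      using g that by (simp cong: conj_cong)
    then show "(\<forall>i<k*R. ?C i (e((a, j) := v))) = (\<forall>i<k*R. ?C i e)"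
      unfolding g_def[symmetric] by blast
  qed
  ultimately show ?thesis by (simp only: eventually_plegma_filter[OF U])
qed

section \<open>Arrays vanishing coordinatewise and their level seminorms\<close>

text \<open>\<open>Z (a, j)\<close> stands for the level \<open>a\<close> piece of the
  \<open>j\<close>-th member. By \<open>Z_inv\<close> it sees only the first \<open>a + 1\<close>
  elements of that member, and by \<open>Z_lim\<close> it vanishes coordinatewise as the last of
  these tends to infinity.\<close>

locale vanishing_array = implicit_space +
  fixes U :: "nat filter" and k :: nat and Z :: "nat \<times> nat \<Rightarrow> env \<Rightarrow> nat \<Rightarrow> real" and B :: real
  assumes ultra: "is_ultra U"
    and Z_c00: "Z p e \<in> c00" and Z_bound: "N (Z p e) \<le> B"
    and Z_inv: "j' \<noteq> j \<or> a < a' \<Longrightarrow> var_inv (Z (a, j)) (a', j')"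
    and Z_lim: "((\<lambda>v. Z (a, j) (e((a, j) := v)) c) \<longlongrightarrow> 0) U"
begin

abbreviation W :: "env filter" where "W \<equiv> plegma_filter U k"

lemma W_nonbot: "W \<noteq> bot" by (rule plegma_filter_nonbot[OF ultra])

text \<open>A sliding hump in lexicographic order: when a piece is chosen, the supports of all
  earlier pieces are already known, and on that finite range the new piece is small. The index
  \<open>a*R+j\<close> puts complete levels one after the other.\<close>

lemma eventually_blocks:
  assumes eps: "\<epsilon> > 0"
  shows "\<forall>\<^sub>F e in W. \<exists>D::nat \<Rightarrow> nat. mono D \<and> (\<forall>a<k. \<forall>j<R.
    N (\<lambda>c. Z (a, j) e c - restr {D (a*R+j)..<D (Suc (a*R+j))} (Z (a, j) e) c) \<le> \<epsilon>)"
    (is "\<forall>\<^sub>F e in W. ?P e")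
proof -
  let ?p = "\<lambda>i. (i div R, i mod R)"
  define sb :: "(nat \<Rightarrow> real) \<Rightarrow> nat" where "sb x = (SOME D. \<forall>i\<ge>D. x i = 0)" for x
  have sb: "x i = 0" if "x \<in> c00" "sb x \<le> i" for x i
  proof -
    have "\<exists>D. \<forall>i\<ge>D. x i = 0" using c00_bound[OF that(1)] by metis
    then have "\<forall>i\<ge>sb x. x i = 0" unfolding sb_def by (rule someI_ex)
    then show ?thesis using that(2) by blast
  qed
  \<comment> \<open>\<open>D e i\<close> lies beyond the supports of all pieces before position
    \<open>i\<close>, hence depends only on earlier variables.\<close>
  define D where "D e = rec_nat 0 (\<lambda>i d. max d (sb (Z (?p i) e)))" for e
  have D_Suc: "D e (Suc i) = max (D e i) (sb (Z (?p i) e))" for e i by (simp add: D_def)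
  have D_0: "D e 0 = 0" for e by (simp add: D_def)
  let ?C = "\<lambda>i e. N (restr {..<D e i} (Z (?p i) e)) \<le> \<epsilon>"
  have Zinv: "var_inv (Z (?p i)) (?p i')" if "i < i'" for i i'
  proof (rule Z_inv)
    show "i' mod R \<noteq> i mod R \<or> i div R < i' div R"
      using that by (metis div_le_mono div_mult_mod_eq less_imp_le less_irrefl order_le_less)
  qed
  have Dinv: "D (e(?p i' := v)) i = D e i" if "i \<le> i'" for i i' e v
    using that
  proof (induction i)
    case (Suc i)
    then show ?case using var_invD[OF Zinv[of i i'], of e v] by (simp only: D_Suc)
  qed (simp add: D_0)
  have "lex_ev U k R (\<lambda>e. \<forall>i<length (lex_vars k R). ?C i e)"
  proof (rule iter_ev_all)
    fix i and e :: env assume i: "i < length (lex_vars k R)"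
    then have p: "lex_vars k R ! i = ?p i" by (simp add: length_lex_vars nth_lex_vars)
    have "((\<lambda>v. \<Sum>c<D e i. \<bar>Z (?p i) (e(?p i := v)) c\<bar> * N (unit_vec c)) \<longlongrightarrow> (\<Sum>c<D e i. \<bar>0\<bar> * N (unit_vec c))) U"
      by (intro tendsto_sum tendsto_mult tendsto_rabs Z_lim tendsto_const)
    then have "\<forall>\<^sub>F v in U. (\<Sum>c<D e i. \<bar>Z (?p i) (e(?p i := v)) c\<bar> * N (unit_vec c)) < \<epsilon>"
      by (rule order_tendstoD) (simp add: eps)
    then show "\<forall>\<^sub>F v in U. ?C i (e(lex_vars k R ! i := v))"
    proof (rule eventually_mono)
      fix v assume "(\<Sum>c<D e i. \<bar>Z (?p i) (e(?p i := v)) c\<bar> * N (unit_vec c)) < \<epsilon>"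
      then show "?C i (e(lex_vars k R ! i := v))"
        unfolding p Dinv[OF order_refl]
        using N_restr_coord[of "{..<D e i}" "Z (?p i) (e(?p i := v))"] by simp
    qed
  next
    fix i i' assume i: "i < i'" "i' < length (lex_vars k R)"
    then have p: "lex_vars k R ! i' = ?p i'" by (simp add: length_lex_vars nth_lex_vars)
    show "var_inv (?C i) (lex_vars k R ! i')"
      unfolding p var_inv_def using Dinv[of i i'] var_invD[OF Zinv[OF i(1)]] i(1) by simp
  qed
  then have "lex_ev U k R (\<lambda>e. \<forall>i<k*R. ?C i e)" by (simp only: length_lex_vars)
  moreover have "?P e" if e: "\<forall>i<k*R. ?C i e" for e
  proof (intro exI[of _ "D e"] conjI allI impI)
    show "mono (D e)" unfolding mono_iff_le_Suc by (simp add: D_Suc)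
    fix a j assume aj: "a < k" "j < R"
    let ?i = "a * R + j"
    have "?i < Suc a * R" using aj by simp
    also have "\<dots> \<le> k * R" using aj by (intro mult_le_mono) auto
    finally have "?C ?i e" using e by blast
    moreover have pi: "?p ?i = (a, j)" using aj by simp
    \<comment> \<open>Nothing is lost on the right, since \<open>D e (Suc ?i)\<close> lies beyond
      the support of the piece.\<close>
    moreover have "(\<lambda>c. Z (a, j) e c - restr {D e ?i..<D e (Suc ?i)} (Z (a, j) e) c)
       = restr {..<D e ?i} (Z (a, j) e)"
    proof
      fix c
      have "Z (a, j) e c = 0" if "D e (Suc ?i) \<le> c"
        using sb[OF Z_c00[of "(a, j)" e], of c] that unfolding D_Suc pi by simp
      then show "Z (a, j) e c - restr {D e ?i..<D e (Suc ?i)} (Z (a, j) e) c = restr {..<D e ?i} (Z (a, j) e) c"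
        by (auto simp: restr_def)
    qed
    ultimately show "N (\<lambda>c. Z (a, j) e c - restr {D e ?i..<D e (Suc ?i)} (Z (a, j) e) c) \<le> \<epsilon>"
      by simp
  qed
  ultimately have "lex_ev U k R ?P"
    using iter_ev_mono[of U "lex_vars k R" "\<lambda>e. \<forall>i<k*R. ?C i e" "\<lambda>_. 0" ?P] by blast
  moreover have "col_inv R ?P"
    unfolding col_inv_def var_inv_def
  proof (intro allI impI)
    fix a' j' v and e :: env assume "R \<le> j'"
    then have "Z (a, j) (e((a', j') := v)) = Z (a, j) e" if "j < R" for a j
      using that by (intro var_invD Z_inv) auto
    then show "?P (e((a', j') := v)) = ?P e" by simp
  qed
  ultimately show ?thesis by (simp only: eventually_plegma_filter[OF ultra])
qed

text \<open>Summing over the support of \<open>b\<close> avoids fixing the number of columns in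
  advance.\<close>

definition lev :: "nat \<Rightarrow> (nat \<Rightarrow> real) \<Rightarrow> env \<Rightarrow> nat \<Rightarrow> real" where
  "lev a b e = (\<lambda>c. \<Sum>j | b j \<noteq> 0. b j * Z (a, j) e c)"

lemma lev_eq:
  assumes "finite S" "\<And>j. j \<notin> S \<Longrightarrow> b j = 0"
  shows "lev a b e = (\<lambda>c. \<Sum>j\<in>S. b j * Z (a, j) e c)"
proof
  fix c
  show "lev a b e c = (\<Sum>j\<in>S. b j * Z (a, j) e c)"
    unfolding lev_def using assms by (intro sum.mono_neutral_left) auto
qed

lemma lev_c00: "b \<in> c00 \<Longrightarrow> lev a b e \<in> c00"
  unfolding lev_def by (rule c00_sum, simp add: c00_def) (rule c00_scale[OF Z_c00])

lemma lev_add: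
  assumes "b \<in> c00" "b' \<in> c00"
  shows "lev a (\<lambda>j. b j + b' j) e = (\<lambda>c. lev a b e c + lev a b' e c)"
proof -
  let ?S = "{j. b j \<noteq> 0} \<union> {j. b' j \<noteq> 0}"
  have fin: "finite ?S" using assms by (simp add: c00_def)
  show ?thesis
    using lev_eq[OF fin, of b a e] lev_eq[OF fin, of b' a e] lev_eq[OF fin, of "\<lambda>j. b j + b' j" a e]
    by (simp add: distrib_right sum.distrib)
qed

lemma lev_scale:
  assumes "b \<in> c00" shows "lev a (\<lambda>j. r * b j) e = (\<lambda>c. r * lev a b e c)"
proof -
  let ?S = "{j. b j \<noteq> 0}"
  have fin: "finite ?S" using assms by (simp add: c00_def)
  show ?thesis
    using lev_eq[OF fin, of b a e] lev_eq[OF fin, of "\<lambda>j. r * b j" a e]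
    by (simp add: sum_distrib_left mult.assoc)
qed

lemma lev_sum:
  assumes "finite I" "\<And>i. i \<in> I \<Longrightarrow> b i \<in> c00"
  shows "lev a (\<lambda>j. \<Sum>i\<in>I. b i j) e = (\<lambda>c. \<Sum>i\<in>I. lev a (b i) e c)"
  using assms
proof (induction I rule: finite_induct)
  case empty show ?case by (simp add: lev_def)
next
  case (insert i I)
  then show ?case using lev_add[of "b i" "\<lambda>j. \<Sum>i\<in>I. b i j" a e] c00_sum[of I b] by simp
qed

lemma lev_bound:
  assumes "b \<in> c00" shows "N (lev a b e) \<le> (\<Sum>j | b j \<noteq> 0. \<bar>b j\<bar>) * B"
proof -
  have "N (lev a b e) \<le> (\<Sum>j | b j \<noteq> 0. \<bar>b j\<bar> * N (Z (a, j) e))"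
    unfolding lev_def using assms by (intro N_lin_comb Z_c00) (auto simp: c00_def)
  also have "\<dots> \<le> (\<Sum>j | b j \<noteq> 0. \<bar>b j\<bar> * B)" by (intro sum_mono mult_left_mono Z_bound) auto
  finally show ?thesis by (simp add: sum_distrib_right)
qed

lemma lev_inv: "b j' = 0 \<Longrightarrow> var_inv (lev a b) (a', j')"
  unfolding var_inv_def
proof (intro allI)
  fix e :: env and v assume "b j' = 0"
  then have "Z (a, j) (e((a', j') := v)) = Z (a, j) e" if "b j \<noteq> 0" for j
    using that by (intro var_invD Z_inv) auto
  then show "lev a b (e((a', j') := v)) = lev a b e"
    unfolding lev_def by (intro ext sum.cong) auto
qed

lemma lev_col_inv: "(\<And>j. R \<le> j \<Longrightarrow> b j = 0) \<Longrightarrow> col_inv R (lev a b)"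
  unfolding col_inv_def by (auto intro: lev_inv)

definition rho :: "nat \<Rightarrow> (nat \<Rightarrow> real) \<Rightarrow> real" where
  "rho a b = Lim W (\<lambda>e. N (lev a b e))"

text \<open>For fixed level \<open>a\<close>, the sequence \<open>\<lambda>(b)\<close> of the
  overview, indexed by \<open>q\<close>.\<close>

definition lam :: "nat \<Rightarrow> nat \<Rightarrow> (nat \<Rightarrow> real) \<Rightarrow> real" where
  "lam a q b = Lim W (\<lambda>e. jn q (lev a b e))"

lemma lev_functional_tendsto:
  assumes b: "b \<in> c00" and G: "\<And>x. x \<in> c00 \<Longrightarrow> 0 \<le> G x" "\<And>x. x \<in> c00 \<Longrightarrow> G x \<le> N x"
    and R: "\<And>j. R \<le> j \<Longrightarrow> b j = 0"
  shows "((\<lambda>e. G (lev a b e)) \<longlongrightarrow> iter_lim U (lex_vars k R) (\<lambda>e. G (lev a b e)) (\<lambda>_. 0)) W"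
proof (rule tendsto_plegma_filter[OF ultra])
  show "\<bar>G (lev a b e)\<bar> \<le> (\<Sum>j | b j \<noteq> 0. \<bar>b j\<bar>) * B" for e
    using G[OF lev_c00[OF b, of a e]] lev_bound[OF b, of a e] by linarith
  show "col_inv R (\<lambda>e. G (lev a b e))" by (rule col_inv_comp[OF lev_col_inv[OF R]])
qed

lemma rho_tendsto: assumes "b \<in> c00" shows "((\<lambda>e. N (lev a b e)) \<longlongrightarrow> rho a b) W"
proof -
  obtain R where "\<And>j. R \<le> j \<Longrightarrow> b j = 0" using c00_bound[OF assms] by blast
  note lim = lev_functional_tendsto[of b N R a, OF assms N_nonneg order_refl this]
  show ?thesis unfolding rho_def using lim tendsto_Lim[OF W_nonbot lim] by simp
qed

lemma lam_iter:
  assumes "b \<in> c00" "\<And>j. R \<le> j \<Longrightarrow> b j = 0"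
  shows "lam a q b = iter_lim U (lex_vars k R) (\<lambda>e. jn q (lev a b e)) (\<lambda>_. 0)"
  unfolding lam_def
  by (rule tendsto_Lim[OF W_nonbot lev_functional_tendsto[of b "jn q" R a, OF assms(1) jn_nonneg jn_le_N assms(2)]])

lemma lam_tendsto: assumes "b \<in> c00" shows "((\<lambda>e. jn q (lev a b e)) \<longlongrightarrow> lam a q b) W"
proof -
  obtain R where R: "\<And>j. R \<le> j \<Longrightarrow> b j = 0" using c00_bound[OF assms] by blast
  have "lam a q b = iter_lim U (lex_vars k R) (\<lambda>e. jn q (lev a b e)) (\<lambda>_. 0)"
    using R by (rule lam_iter[OF assms])
  then show ?thesis
    using lev_functional_tendsto[of b "jn q" R a, OF assms jn_nonneg jn_le_N R] by simp
qed

lemma rho_nonneg: "b \<in> c00 \<Longrightarrow> 0 \<le> rho a b"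
  by (rule tendsto_lowerbound[OF rho_tendsto _ W_nonbot]) (auto intro!: always_eventually N_nonneg lev_c00)

lemma lam_nonneg: "b \<in> c00 \<Longrightarrow> 0 \<le> lam a q b"
  by (rule tendsto_lowerbound[OF lam_tendsto _ W_nonbot]) (auto intro!: always_eventually jn_nonneg lev_c00)

lemma lam_le_rho: "b \<in> c00 \<Longrightarrow> lam a q b \<le> rho a b"
  by (rule tendsto_le[OF W_nonbot rho_tendsto lam_tendsto]) (auto intro!: always_eventually jn_le_N lev_c00)

text \<open>Fatou on finite partial sums. Only an inequality results, as part of the square sum may
  drift to large \<open>q\<close> in the limit.\<close>

lemma lam_square_sum:
  assumes b: "b \<in> c00" shows "(\<Sum>q<Q. (lam a q b)\<^sup>2) \<le> (rho a b)\<^sup>2"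
proof (rule tendsto_le[OF W_nonbot])
  show "((\<lambda>e. (N (lev a b e))\<^sup>2) \<longlongrightarrow> (rho a b)\<^sup>2) W" by (intro tendsto_power rho_tendsto b)
  show "((\<lambda>e. \<Sum>q<Q. (jn q (lev a b e))\<^sup>2) \<longlongrightarrow> (\<Sum>q<Q. (lam a q b)\<^sup>2)) W"
    by (intro tendsto_sum tendsto_power lam_tendsto b)
  have "(\<Sum>q<Q. (jn q (lev a b e))\<^sup>2) \<le> (N (lev a b e))\<^sup>2" for e
    by (rule jn_square_partial_sum_le[OF lev_c00[OF b]])
  then show "\<forall>\<^sub>F e in W. (\<Sum>q<Q. (jn q (lev a b e))\<^sup>2) \<le> (N (lev a b e))\<^sup>2" by simp
qed

lemma rho_add:
  assumes "b \<in> c00" "b' \<in> c00" shows "rho a (\<lambda>j. b j + b' j) \<le> rho a b + rho a b'"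
proof (rule tendsto_le[OF W_nonbot])
  show "((\<lambda>e. N (lev a b e) + N (lev a b' e)) \<longlongrightarrow> rho a b + rho a b') W"
    by (intro tendsto_add rho_tendsto assms)
  show "((\<lambda>e. N (lev a (\<lambda>j. b j + b' j) e)) \<longlongrightarrow> rho a (\<lambda>j. b j + b' j)) W"
    by (intro rho_tendsto c00_add assms)
  show "\<forall>\<^sub>F e in W. N (lev a (\<lambda>j. b j + b' j) e) \<le> N (lev a b e) + N (lev a b' e)"
    using assms by (simp add: lev_add N_add lev_c00)
qed

lemma rho_scale:
  assumes "b \<in> c00" shows "rho a (\<lambda>j. r * b j) = \<bar>r\<bar> * rho a b"
proof (rule tendsto_unique[OF W_nonbot])
  show "((\<lambda>e. N (lev a (\<lambda>j. r * b j) e)) \<longlongrightarrow> rho a (\<lambda>j. r * b j)) W"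
    by (intro rho_tendsto c00_scale assms)
  show "((\<lambda>e. N (lev a (\<lambda>j. r * b j) e)) \<longlongrightarrow> \<bar>r\<bar> * rho a b) W"
    unfolding lev_scale[OF assms] N_scale[OF lev_c00[OF assms]]
    by (intro tendsto_mult tendsto_const rho_tendsto assms)
qed

lemma rho_sum:
  assumes "finite I" "\<And>i. i \<in> I \<Longrightarrow> b i \<in> c00"
  shows "rho a (\<lambda>j. \<Sum>i\<in>I. b i j) \<le> (\<Sum>i\<in>I. rho a (b i))"
  using assms
proof (induction I rule: finite_induct)
  case empty
  show ?case using rho_scale[OF c00_zero, of a 0] by simp
next
  case (insert i I)
  then show ?case using rho_add[of "b i" "\<lambda>j. \<Sum>i\<in>I. b i j" a] c00_sum[of I b] by simp
qed

end

text \<open>\<open>K\<close> is any constant independent of \<open>\<epsilon>\<close>, so error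
  terms can be collected without normalising them beforehand.\<close>

lemma le_of_le_add_eps:
  fixes x y K :: real
  assumes "\<And>\<epsilon>. \<epsilon> > 0 \<Longrightarrow> x \<le> y + \<epsilon> * K" shows "x \<le> y"
proof (rule field_le_epsilon)
  fix r :: real assume r: "r > 0"
  have "r / (\<bar>K\<bar> + 1) * K \<le> r / (\<bar>K\<bar> + 1) * (\<bar>K\<bar> + 1)" using r by (intro mult_left_mono) auto
  also have "\<dots> = r" by simp
  finally show "x \<le> y + r" using assms[of "r / (\<bar>K\<bar> + 1)"] r by (simp add: add_pos_nonneg)
qed

text \<open>The boundaries \<open>l\<close> are carried along explicitly because positions in the
  lexicographic order are computed from them. Zero blocks are allowed, which permits padding of
  finite families.\<close>

definition block_supp :: "(nat \<Rightarrow> nat) \<Rightarrow> (nat \<Rightarrow> nat \<Rightarrow> real) \<Rightarrow> bool" where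
  "block_supp l b \<longleftrightarrow> mono l \<and> (\<forall>i j. b i j \<noteq> 0 \<longrightarrow> l i \<le> j \<and> j < l (Suc i))"

lemma block_supp_c00: "block_supp l b \<Longrightarrow> b i \<in> c00"
  by (rule c00I[of "l (Suc i)"]) (auto simp: block_supp_def not_less[symmetric])

lemma block_supp_disjoint:
  assumes "block_supp l b" "t < t'" shows "b t j = 0 \<or> b t' j = 0"
proof (rule ccontr)
  assume "\<not> ?thesis"
  then have "j < l (Suc t)" "l t' \<le> j" using assms(1) unfolding block_supp_def by blast+
  moreover have "l (Suc t) \<le> l t'" using assms unfolding block_supp_def mono_def by auto
  ultimately show False by linarith
qed

lemma block_supp_zero_beyond:
  assumes "block_supp l b" "t < K" "l K \<le> j" shows "b t j = 0"
proof (rule ccontr)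
  assume "b t j \<noteq> 0"
  then have "j < l (Suc t)" using assms(1) unfolding block_supp_def by blast
  moreover have "l (Suc t) \<le> l K" using assms(1,2) unfolding block_supp_def mono_def by auto
  ultimately show False using assms(3) by linarith
qed

lemma block_supp_total:
  assumes "block_supp l b" "i < K" shows "(\<Sum>j | b i j \<noteq> 0. b i j) = (\<Sum>j<l K. b i j)"
proof (rule sum.mono_neutral_left)
  show "{j. b i j \<noteq> 0} \<subseteq> {..<l K}"
    using block_supp_zero_beyond[OF assms] by (auto simp: not_less[symmetric])
qed auto

context implicit_space begin

text \<open>An admissible family of \<open>n q\<close> sets and \<open>r\<close> successive
  intervals meet in at most \<open>n q + r\<close> pairs, each contributing at most
  \<open>C\<close>. Divided by \<open>r\<close>, this makes long averages almost as small as
  \<open>C / m q\<close>.\<close>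

lemma jn_sum_blocks_le:
  assumes w: "\<And>i. i < r \<Longrightarrow> w i \<in> c00" and D: "mono D"
    and supp: "\<And>i c. i < r \<Longrightarrow> w i c \<noteq> 0 \<Longrightarrow> D i \<le> c \<and> c < D (Suc i)"
    and C: "\<And>i. i < r \<Longrightarrow> N (w i) \<le> C" "C \<ge> 0"
  shows "jn q (\<lambda>c. \<Sum>i<r. w i c) \<le> (1 / real (m q)) * ((real r + real (n q)) * C)"
proof (rule jn_least)
  fix E assume E: "block_seq (n q) E"
  define A where "A = {(p, i). p < n q \<and> i < r \<and> E p \<inter> {D i..<D (Suc i)} \<noteq> {}}"
  \<comment> \<open>The pairs in \<open>A\<close> form a chain in the product order, so \<open>p + i\<close> determines the pair.\<close>
  have less: False if A: "(p, i) \<in> A" "(p', i') \<in> A" and "p < p'" "p + i = p' + i'" for p i p' i'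
  proof -
    obtain x y where x: "x \<in> E p" "D i \<le> x" and y: "y \<in> E p'" "y < D (Suc i')"
      using A unfolding A_def by auto
    have "p' < n q" using A(2) unfolding A_def by simp
    then have "set_less (E p) (E p')" using E \<open>p < p'\<close> unfolding block_seq_def by blast
    then have "x < y" using x(1) y(1) unfolding set_less_def by blast
    \<comment> \<open>Equal sums with \<open>p < p'\<close> force \<open>i' < i\<close>: the sets
      would move to the right while the intervals move to the left.\<close>
    moreover have "D (Suc i') \<le> D i" using that(3,4) by (intro monoD[OF D]) auto
    ultimately show False using x(2) y(2) by linarith
  qed
  have inj: "inj_on (\<lambda>(p, i). p + i) A"
  proof (rule inj_onI, clarify)
    fix p i p' i' assume A: "(p, i) \<in> A" "(p', i') \<in> A" "p + i = p' + i'"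
    then have "p = p'" using less[OF A(1,2)] less[OF A(2,1)] by (metis linorder_neqE_nat)
    then show "p = p' \<and> i = i'" using A(3) by simp
  qed
  have "card A = card ((\<lambda>(p, i). p + i) ` A)" using card_image[OF inj] by simp
  also have "\<dots> \<le> card {..<n q + r}" by (intro card_mono) (auto simp: A_def)
  finally have cardA: "card A \<le> n q + r" by simp
  have "(\<Sum>p<n q. N (restr (E p) (\<lambda>c. \<Sum>i<r. w i c))) \<le> (\<Sum>p<n q. \<Sum>i<r. N (restr (E p) (w i)))"
    unfolding restr_sum by (intro sum_mono N_sum) (auto intro: c00_restr w)
  also have "\<dots> = (\<Sum>(p, i)\<in>{..<n q} \<times> {..<r}. N (restr (E p) (w i)))"
    by (simp add: sum.cartesian_product)
  also have "\<dots> = (\<Sum>(p, i)\<in>A. N (restr (E p) (w i)))"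
  proof (rule sum.mono_neutral_right)
    show "\<forall>x\<in>{..<n q} \<times> {..<r} - A. (case x of (p, i) \<Rightarrow> N (restr (E p) (w i))) = 0"
    proof
      fix x assume x: "x \<in> {..<n q} \<times> {..<r} - A"
      obtain p i where xpi: "x = (p, i)" by (cases x)
      have pi: "p \<in> {..<n q}" "i \<in> {..<r}" "(p, i) \<notin> A" using x xpi by auto
      have "w i c = 0" if "c \<in> E p" for c
        using supp[of i c] pi that unfolding A_def by auto
      then have "restr (E p) (w i) = (\<lambda>_. 0)" by (auto simp: restr_def)
      then show "(case x of (p, i) \<Rightarrow> N (restr (E p) (w i))) = 0" by (simp add: N_zero xpi)
    qed
  qed (auto simp: A_def)
  also have "\<dots> \<le> (\<Sum>x\<in>A. C)"
  proof (rule sum_mono)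
    fix x assume x: "x \<in> A"
    obtain p i where xpi: "x = (p, i)" by (cases x)
    have i: "i < r" using x xpi by (simp add: A_def)
    show "(case x of (p, i) \<Rightarrow> N (restr (E p) (w i))) \<le> C"
      using N_restr[OF w[OF i], of "E p"] C(1)[OF i] by (simp add: xpi)
  qed
  also have "\<dots> = real (card A) * C" by simp
  also have "\<dots> \<le> (real r + real (n q)) * C" using cardA C(2) by (intro mult_right_mono) auto
  finally show "(1 / real (m q)) * (\<Sum>p<n q. N (restr (E p) (\<lambda>c. \<Sum>i<r. w i c)))
      \<le> (1 / real (m q)) * ((real r + real (n q)) * C)" by (intro mult_left_mono) auto
qed

end

context vanishing_array begin

text \<open>With \<open>l r\<close> columns in use, block \<open>i\<close> at level \<open>a\<close>
  occupies the lexicographic positions from \<open>a * l r + l i\<close> up to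
  \<open>a * l r + l (Suc i)\<close>, so the column pieces inside a block merge into one
  interval.\<close>

lemma eventually_group_blocks:
  assumes b: "block_supp l b" and eps: "\<epsilon> > 0"
  shows "\<forall>\<^sub>F e in W. \<exists>D w. mono D \<and> (\<forall>a<k. \<forall>i<r. w a i \<in> c00 \<and>
     (\<forall>c. w a i c \<noteq> 0 \<longrightarrow> D (a * l r + l i) \<le> c \<and> c < D (a * l r + l (Suc i))) \<and>
     N (\<lambda>c. lev a (b i) e c - w a i c) \<le> \<epsilon>)" (is "\<forall>\<^sub>F e in W. ?P e")
proof -
  \<comment> \<open>The total coefficient mass; truncating each column piece to within
    \<open>\<epsilon> / (S + 1)\<close> keeps every weighted sum of errors below
    \<open>\<epsilon>\<close>.\<close>
  define S where "S = (\<Sum>i<r. \<Sum>j\<in>{l i..<l (Suc i)}. \<bar>b i j\<bar>)"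
  have S0: "S \<ge> 0" unfolding S_def by (intro sum_nonneg) auto
  have lm: "mono l" using b by (simp add: block_supp_def)
  let ?d = "\<epsilon> / (S + 1)"
  have d: "?d > 0" "S * ?d \<le> \<epsilon>" using eps S0 by (auto simp: field_simps)
  show ?thesis
  proof (rule eventually_mono[OF eventually_blocks[OF d(1), of "l r"]])
    fix e assume "\<exists>D. mono D \<and> (\<forall>a<k. \<forall>j<l r.
      N (\<lambda>c. Z (a, j) e c - restr {D (a * l r + j)..<D (Suc (a * l r + j))} (Z (a, j) e) c) \<le> ?d)"
    then obtain D where D: "mono D" and Dd: "\<And>a j. a < k \<Longrightarrow> j < l r \<Longrightarrow>
      N (\<lambda>c. Z (a, j) e c - restr {D (a * l r + j)..<D (Suc (a * l r + j))} (Z (a, j) e) c) \<le> ?d" by blast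
    define z where "z a j = restr {D (a * l r + j)..<D (Suc (a * l r + j))} (Z (a, j) e)" for a j
    have z: "z a j \<in> c00" for a j unfolding z_def by (rule c00_restr[OF Z_c00])
    define w where "w a i = (\<lambda>c. \<Sum>j\<in>{l i..<l (Suc i)}. b i j * z a j c)" for a i
    have 1: "w a i \<in> c00" for a i unfolding w_def by (intro c00_sum c00_scale z) auto
    have 2: "D (a * l r + l i) \<le> c \<and> c < D (a * l r + l (Suc i))" if nz: "w a i c \<noteq> 0" for a i c
    proof -
      obtain j where j: "j \<in> {l i..<l (Suc i)}" "b i j * z a j c \<noteq> 0"
        using nz unfolding w_def by (meson sum.not_neutral_contains_not_neutral)
      then have "D (a * l r + j) \<le> c \<and> c < D (Suc (a * l r + j))"
        by (auto simp: z_def restr_def split: if_splits)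
      moreover have "D (a * l r + l i) \<le> D (a * l r + j)" "D (Suc (a * l r + j)) \<le> D (a * l r + l (Suc i))"
        using j by (auto intro!: monoD[OF D])
      ultimately show ?thesis by linarith
    qed
    have 3: "N (\<lambda>c. lev a (b i) e c - w a i c) \<le> \<epsilon>" if "a < k" "i < r" for a i
    proof -
      have "lev a (b i) e = (\<lambda>c. \<Sum>j\<in>{l i..<l (Suc i)}. b i j * Z (a, j) e c)"
        using b by (intro lev_eq) (auto simp: block_supp_def)
      then have "(\<lambda>c. lev a (b i) e c - w a i c) = (\<lambda>c. \<Sum>j\<in>{l i..<l (Suc i)}. b i j * (Z (a, j) e c - z a j c))"
        by (simp add: w_def right_diff_distrib sum_subtractf)
      then have "N (\<lambda>c. lev a (b i) e c - w a i c)
          \<le> (\<Sum>j\<in>{l i..<l (Suc i)}. \<bar>b i j\<bar> * N (\<lambda>c. Z (a, j) e c - z a j c))"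
        using N_lin_comb[of "{l i..<l (Suc i)}" "\<lambda>j c. Z (a, j) e c - z a j c" "b i"]
        by (simp add: c00_diff Z_c00 z)
      also have "\<dots> \<le> (\<Sum>j\<in>{l i..<l (Suc i)}. \<bar>b i j\<bar> * ?d)"
      proof (intro sum_mono mult_left_mono)
        fix j assume "j \<in> {l i..<l (Suc i)}"
        moreover have "l (Suc i) \<le> l r" using that(2) by (intro monoD[OF lm]) auto
        ultimately show "N (\<lambda>c. Z (a, j) e c - z a j c) \<le> ?d"
          unfolding z_def using that(1) by (intro Dd) auto
      qed auto
      also have "\<dots> = (\<Sum>j\<in>{l i..<l (Suc i)}. \<bar>b i j\<bar>) * ?d" by (rule sum_distrib_right[symmetric])
      also have "\<dots> \<le> S * ?d"
      proof (rule mult_right_mono)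
        show "(\<Sum>j\<in>{l i..<l (Suc i)}. \<bar>b i j\<bar>) \<le> S"
          unfolding S_def using that(2) by (intro member_le_sum[of i "{..<r}"]) (auto intro: sum_nonneg)
      qed (use d in simp)
      finally show ?thesis using d(2) by linarith
    qed
    show "?P e"
      using D 1 2 3 by blast
  qed
qed

text \<open>The pair count of \<open>jn_sum_blocks_le\<close>, applied to near-blocks of norm about
  \<open>C\<close>, divided by \<open>r\<close> and passed to the limit.\<close>

lemma lam_average_le:
  assumes b: "block_supp l b" and a: "a < k" and C: "\<And>i. i < r \<Longrightarrow> rho a (b i) \<le> C" "C \<ge> 0" and r: "r > 0"
  shows "lam a q (\<lambda>j. (1 / real r) * (\<Sum>i<r. b i j)) \<le> (1 / real (m q)) * (1 + real (n q) / real r) * C"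
proof -
  have bc: "b i \<in> c00" for i by (rule block_supp_c00[OF b])
  have lm: "mono l" using b by (simp add: block_supp_def)
  let ?s = "\<lambda>j. \<Sum>i<r. b i j"
  have sc: "?s \<in> c00" by (intro c00_sum bc) auto
  let ?M = "(1 / real (m q)) * (real r + real (n q))"
  have "lam a q ?s \<le> ?M * C"
  proof (rule le_of_le_add_eps)
    fix \<epsilon> :: real assume eps: "\<epsilon> > 0"
    have "\<forall>\<^sub>F e in W. \<forall>i<r. N (lev a (b i) e) < C + \<epsilon>"
    proof -
      have "\<forall>\<^sub>F e in W. N (lev a (b i) e) < C + \<epsilon>" if "i < r" for i
        using rho_tendsto[OF bc] C(1)[OF that] eps by (intro order_tendstoD) auto
      then have "\<forall>\<^sub>F e in W. \<forall>i\<in>{..<r}. N (lev a (b i) e) < C + \<epsilon>"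
        by (intro eventually_ball_finite) auto
      then show ?thesis by (rule eventually_mono) (simp only: Ball_def lessThan_iff)
    qed
    with eventually_group_blocks[OF b eps, of r]
    have "\<forall>\<^sub>F e in W. jn q (lev a ?s e) \<le> ?M * C + \<epsilon> * (2 * ?M + real r)"
    proof eventually_elim
      case (elim e)
      then obtain D w where D: "mono D" and w: "\<And>i. i < r \<Longrightarrow> w a i \<in> c00"
        and supp: "\<And>i c. i < r \<Longrightarrow> w a i c \<noteq> 0 \<Longrightarrow> D (a * l r + l i) \<le> c \<and> c < D (a * l r + l (Suc i))"
        and diff: "\<And>i. i < r \<Longrightarrow> N (\<lambda>c. lev a (b i) e c - w a i c) \<le> \<epsilon>"
        using a by blast
      \<comment> \<open>One \<open>\<epsilon>\<close> for the distance to the limit seminorm, one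
        for the truncation.\<close>
      have Nw: "N (w a i) \<le> C + 2 * \<epsilon>" if i: "i < r" for i
      proof -
        have "N (w a i) \<le> N (lev a (b i) e) + N (\<lambda>c. lev a (b i) e c - w a i c)"
          using N_diff_abs[OF w[OF i] lev_c00[OF bc, of a i e]] N_diff_sym[OF w[OF i] lev_c00[OF bc, of a i e]]
          by linarith
        moreover have "N (lev a (b i) e) < C + \<epsilon>" using elim(2) i by blast
        ultimately show ?thesis using diff[OF i] by linarith
      qed
      have ws: "(\<lambda>c. \<Sum>i<r. w a i c) \<in> c00" by (intro c00_sum w) auto
      have ls: "lev a ?s e = (\<lambda>c. \<Sum>i<r. lev a (b i) e c)" by (rule lev_sum) (auto intro: bc)
      have lsc: "lev a ?s e \<in> c00" by (rule lev_c00[OF sc])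
      have j1: "jn q (\<lambda>c. \<Sum>i<r. w a i c) \<le> (1 / real (m q)) * ((real r + real (n q)) * (C + 2 * \<epsilon>))"
      proof (rule jn_sum_blocks_le[where D = "\<lambda>i. D (a * l r + l i)"])
        show "mono (\<lambda>i. D (a * l r + l i))"
          by (intro monoI monoD[OF D] add_left_mono monoD[OF lm])
      qed (use w supp Nw C eps in auto)
      have "N (\<lambda>c. lev a ?s e c - (\<Sum>i<r. w a i c)) \<le> (\<Sum>i<r. N (\<lambda>c. lev a (b i) e c - w a i c))"
        unfolding ls sum_subtractf[symmetric] by (intro N_sum) (auto intro!: c00_diff lev_c00 bc w)
      also have "\<dots> \<le> (\<Sum>i<r. \<epsilon>)" by (intro sum_mono diff) auto
      finally have "N (\<lambda>c. lev a ?s e c - (\<Sum>i<r. w a i c)) \<le> real r * \<epsilon>" by simp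
      then have "jn q (lev a ?s e) \<le> (1 / real (m q)) * ((real r + real (n q)) * (C + 2 * \<epsilon>)) + real r * \<epsilon>"
        using jn_diff_abs[OF lsc ws, of q] j1 by linarith
      also have "\<dots> = ?M * C + \<epsilon> * (2 * ?M + real r)" by (simp add: algebra_simps add_divide_distrib)
      finally show ?case .
    qed
    then show "lam a q ?s \<le> ?M * C + \<epsilon> * (2 * ?M + real r)"
      by (intro tendsto_upperbound[OF lam_tendsto[OF sc] _ W_nonbot])
  qed
  moreover have "lam a q (\<lambda>j. (1 / real r) * ?s j) \<le> (1 / real r) * lam a q ?s"
  proof (rule tendsto_le[OF W_nonbot])
    show "((\<lambda>e. (1 / real r) * jn q (lev a ?s e)) \<longlongrightarrow> (1 / real r) * lam a q ?s) W"
      by (intro tendsto_mult tendsto_const lam_tendsto sc)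
    show "((\<lambda>e. jn q (lev a (\<lambda>j. (1 / real r) * ?s j) e)) \<longlongrightarrow> lam a q (\<lambda>j. (1 / real r) * ?s j)) W"
      by (intro lam_tendsto c00_scale sc)
    show "\<forall>\<^sub>F e in W. jn q (lev a (\<lambda>j. (1 / real r) * ?s j) e) \<le> (1 / real r) * jn q (lev a ?s e)"
    proof (rule always_eventually, rule allI)
      fix e
      show "jn q (lev a (\<lambda>j. (1 / real r) * ?s j) e) \<le> (1 / real r) * jn q (lev a ?s e)"
        using jn_scale_le[OF lev_c00[OF sc, of a e], of q "1 / real r"]
        unfolding lev_scale[OF sc] by simp
    qed
  qed
  ultimately have "lam a q (\<lambda>j. (1 / real r) * ?s j) \<le> (1 / real r) * (?M * C)"
    using r by (smt (verit, best) mult_left_mono divide_nonneg_nonneg of_nat_0_le_iff)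
  also have "\<dots> = (1 / real (m q)) * (1 + real (n q) / real r) * C" using r by (simp add: field_simps)
  finally show ?thesis .
qed

text \<open>With disjoint columns no variable moves both vectors, as \<open>iter_lim_inner\<close>
  requires. If both moved at once, weak convergence alone would say nothing about their inner
  product.\<close>

lemma inner_tendsto:
  assumes b: "b \<in> c00" "b' \<in> c00" and disj: "\<And>j. b j = 0 \<or> b' j = 0"
  shows "((\<lambda>e. \<Sum>q. jn q (lev a b e) * jn q (lev a b' e)) \<longlongrightarrow> (\<Sum>q. lam a q b * lam a q b')) W"
proof -
  obtain R1 R2 where "\<And>j. R1 \<le> j \<Longrightarrow> b j = 0" "\<And>j. R2 \<le> j \<Longrightarrow> b' j = 0"
    using c00_bound b by metis
  define R where "R = max R1 R2"
  have R: "R \<le> j \<Longrightarrow> b j = 0" "R \<le> j \<Longrightarrow> b' j = 0" for j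
    using \<open>\<And>j. R1 \<le> j \<Longrightarrow> b j = 0\<close> \<open>\<And>j. R2 \<le> j \<Longrightarrow> b' j = 0\<close> by (auto simp: R_def)
  define K where "K = ((\<Sum>j | b j \<noteq> 0. \<bar>b j\<bar>) * B)\<^sup>2 + ((\<Sum>j | b' j \<noteq> 0. \<bar>b' j\<bar>) * B)\<^sup>2"
  have bd: "(\<Sum>q<Q. (jn q (lev a d e))\<^sup>2) \<le> K" if "d = b \<or> d = b'" for d e Q
  proof -
    have d: "d \<in> c00" using that b by auto
    have "(\<Sum>q<Q. (jn q (lev a d e))\<^sup>2) \<le> (N (lev a d e))\<^sup>2"
      by (rule jn_square_partial_sum_le[OF lev_c00[OF d]])
    also have "\<dots> \<le> ((\<Sum>j | d j \<noteq> 0. \<bar>d j\<bar>) * B)\<^sup>2"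
      by (intro power_mono lev_bound d N_nonneg lev_c00)
    also have "\<dots> \<le> K" using that unfolding K_def by auto
    finally show ?thesis .
  qed
  have inv: "var_inv (\<lambda>e q. jn q (lev a d e)) (a', j')" if "d j' = 0" for d a' j'
    using lev_inv[of d j' a a', OF that] unfolding var_inv_def by simp
  have col: "col_inv R (\<lambda>e. \<Sum>q. jn q (lev a b e) * jn q (lev a b' e))"
    unfolding col_inv_def
  proof (intro allI impI)
    fix a' j' assume "R \<le> j'"
    then show "var_inv (\<lambda>e. \<Sum>q. jn q (lev a b e) * jn q (lev a b' e)) (a', j')"
      using lev_inv[of b j' a a'] lev_inv[of b' j' a a'] R[of j'] unfolding var_inv_def by simp
  qed
  have "((\<lambda>e. \<Sum>q. jn q (lev a b e) * jn q (lev a b' e)) \<longlongrightarrow>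
     (\<Sum>q. iter_lim U (lex_vars k R) (\<lambda>e. jn q (lev a b e)) (\<lambda>_. 0)
         * iter_lim U (lex_vars k R) (\<lambda>e. jn q (lev a b' e)) (\<lambda>_. 0))) (iter_filter U (lex_vars k R) (\<lambda>_. 0))"
  proof (rule iter_lim_inner[OF ultra])
    show "(\<Sum>q<Q. (jn q (lev a b e))\<^sup>2) \<le> K" "(\<Sum>q<Q. (jn q (lev a b' e))\<^sup>2) \<le> K" for e Q
      using bd by auto
    fix p :: "nat \<times> nat"
    show "var_inv (\<lambda>e q. jn q (lev a b e)) p \<or> var_inv (\<lambda>e q. jn q (lev a b' e)) p"
      using disj[of "snd p"] inv[of b "snd p" "fst p"] inv[of b' "snd p" "fst p"] by auto
  qed
  then show ?thesis
    using lam_iter[of b R a, OF b(1) R(1)] lam_iter[of b' R a, OF b(2) R(2)]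
    by (simp only: tendsto_plegma_filter_iff[OF ultra col])
qed

end

section \<open>Averaging contracts the level seminorms\<close>

context vanishing_array begin

text \<open>The two halves of the implicit norm are treated separately: nearly disjoint pieces keep
  the sup norm at \<open>C\<close>, while expanding the square function leaves a mixed term whose
  limit is known by \<open>inner_tendsto\<close>.\<close>

lemma rho_add_blocks_le:
  assumes b: "b \<in> c00" "b' \<in> c00" and L: "\<And>j. b j \<noteq> 0 \<Longrightarrow> j < L" "\<And>j. b' j \<noteq> 0 \<Longrightarrow> L \<le> j"
    and a: "a < k" and C: "rho a b \<le> C" "rho a b' \<le> C"
  shows "rho a (\<lambda>j. b j + b' j) \<le> max C (sqrt (2 * C\<^sup>2 + 2 * (\<Sum>q. lam a q b * lam a q b')))"
proof -
  let ?I = "\<Sum>q. lam a q b * lam a q b'"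
  let ?ip = "\<lambda>e. \<Sum>q. jn q (lev a b e) * jn q (lev a b' e)"
  obtain R' where R': "\<And>j. R' \<le> j \<Longrightarrow> b' j = 0" using c00_bound[OF b(2)] by blast
  \<comment> \<open>The two vectors are padded by zero blocks to an infinite block sequence.\<close>
  define l where "l i = (if i = 0 then 0 else if i = 1 then L else max L R')" for i :: nat
  define bb where "bb i = (if i = 0 then b else if i = 1 then b' else (\<lambda>_. 0))" for i :: nat
  have bs: "block_supp l bb"
    unfolding block_supp_def
  proof (intro conjI allI impI)
    show "mono l" by (auto simp: mono_def l_def)
    fix i j assume "bb i j \<noteq> 0"
    then have "i = 0 \<and> b j \<noteq> 0 \<or> i = 1 \<and> b' j \<noteq> 0" by (auto simp: bb_def split: if_splits)
    moreover have "j < R'" if "b' j \<noteq> 0" using R'[of j] that by (meson not_le)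
    ultimately show "l i \<le> j" "j < l (Suc i)"
      using L[of j] by (auto simp: l_def)
  qed
  have sup_part: "\<forall>\<^sub>F e in W. \<forall>c. \<bar>lev a b e c + lev a b' e c\<bar> \<le> C + 4 * \<epsilon>" if eps: "\<epsilon> > 0" for \<epsilon>
  proof -
    have "\<forall>\<^sub>F e in W. N (lev a b e) < C + \<epsilon>" "\<forall>\<^sub>F e in W. N (lev a b' e) < C + \<epsilon>"
      using rho_tendsto[OF b(1), of a] rho_tendsto[OF b(2), of a] C eps by (auto intro!: order_tendstoD(2))
    with eventually_group_blocks[OF bs eps, of 2]
    show ?thesis
    proof eventually_elim
      case (elim e)
      then obtain D w where D: "mono D" and w: "\<And>i. i < 2 \<Longrightarrow> w a i \<in> c00"
        and supp: "\<And>i c. i < 2 \<Longrightarrow> w a i c \<noteq> 0 \<Longrightarrow> D (a * l 2 + l i) \<le> c \<and> c < D (a * l 2 + l (Suc i))"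
        and diff: "\<And>i. i < 2 \<Longrightarrow> N (\<lambda>c. lev a (bb i) e c - w a i c) \<le> \<epsilon>"
        using a by blast
      have d0: "N (\<lambda>c. lev a b e c - w a 0 c) \<le> \<epsilon>" and d1: "N (\<lambda>c. lev a b' e c - w a 1 c) \<le> \<epsilon>"
        using diff[of 0] diff[of 1] by (simp_all add: bb_def)
      have w0: "w a 0 \<in> c00" "w a 1 \<in> c00" using w by auto
      have l0: "lev a b e \<in> c00" "lev a b' e \<in> c00" by (intro lev_c00 b)+
      show ?case
      proof
        fix c
        \<comment> \<open>At every coordinate one of the two summands is just its truncation
          error.\<close>
        have "w a 0 c = 0 \<or> w a 1 c = 0" using supp[of 0 c] supp[of 1 c] by fastforce
        moreover have "\<bar>lev a b e c - w a 0 c\<bar> \<le> \<epsilon>"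
          using abs_le_N[OF c00_diff[OF l0(1) w0(1)], of c] d0 by simp
        moreover have "\<bar>lev a b' e c - w a 1 c\<bar> \<le> \<epsilon>"
          using abs_le_N[OF c00_diff[OF l0(2) w0(2)], of c] d1 by simp
        moreover have "\<bar>lev a b e c\<bar> \<le> C + \<epsilon>" "\<bar>lev a b' e c\<bar> \<le> C + \<epsilon>"
          using abs_le_N[OF l0(1), of c] abs_le_N[OF l0(2), of c] elim by linarith+
        ultimately show "\<bar>lev a b e c + lev a b' e c\<bar> \<le> C + 4 * \<epsilon>" using eps by linarith
      qed
    qed
  qed
  have sum_part: "sqrt (\<Sum>q. (jn q (\<lambda>c. lev a b e c + lev a b' e c))\<^sup>2)
      \<le> sqrt ((N (lev a b e))\<^sup>2 + (N (lev a b' e))\<^sup>2 + 2 * ?ip e)" for e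
  proof (rule real_sqrt_le_mono)
    let ?f = "\<lambda>q. jn q (lev a b e)" and ?g = "\<lambda>q. jn q (lev a b' e)"
    have l0: "lev a b e \<in> c00" "lev a b' e \<in> c00" by (intro lev_c00 b)+
    have s: "summable (\<lambda>q. (?f q)\<^sup>2)" "summable (\<lambda>q. (?g q)\<^sup>2)" using N_implicit(1) l0 by auto
    have sp: "summable (\<lambda>q. ?f q * ?g q)" by (rule summable_product_of_squares[OF s])
    have "(\<Sum>q. (jn q (\<lambda>c. lev a b e c + lev a b' e c))\<^sup>2) \<le> (\<Sum>q. ((?f q)\<^sup>2 + (?g q)\<^sup>2) + 2 * (?f q * ?g q))"
    proof (rule suminf_le)
      fix q
      have "(jn q (\<lambda>c. lev a b e c + lev a b' e c))\<^sup>2 \<le> (?f q + ?g q)\<^sup>2"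
        by (intro power_mono jn_add l0 jn_nonneg c00_add)
      then show "(jn q (\<lambda>c. lev a b e c + lev a b' e c))\<^sup>2 \<le> ((?f q)\<^sup>2 + (?g q)\<^sup>2) + 2 * (?f q * ?g q)"
        by (simp add: power2_sum)
    qed (intro N_implicit(1) c00_add l0 summable_add summable_mult s sp)+
    also have "\<dots> = (\<Sum>q. (?f q)\<^sup>2) + (\<Sum>q. (?g q)\<^sup>2) + 2 * ?ip e"
      using suminf_add[OF summable_add[OF s] summable_mult[OF sp, of 2]] suminf_add[OF s] suminf_mult[OF sp, of 2]
      by simp
    also have "\<dots> \<le> (N (lev a b e))\<^sup>2 + (N (lev a b' e))\<^sup>2 + 2 * ?ip e"
      using jn_square_sum_le[OF l0(1)] jn_square_sum_le[OF l0(2)] by linarith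
    finally show "(\<Sum>q. (jn q (\<lambda>c. lev a b e c + lev a b' e c))\<^sup>2)
      \<le> (N (lev a b e))\<^sup>2 + (N (lev a b' e))\<^sup>2 + 2 * ?ip e" .
  qed
  have disj: "b j = 0 \<or> b' j = 0" for j using L[of j] by force
  have bound: "rho a (\<lambda>j. b j + b' j) \<le> max (C + 4 * \<epsilon>) (sqrt (2 * C\<^sup>2 + 2 * ?I))" if eps: "\<epsilon> > 0" for \<epsilon>
  proof -
    have "rho a (\<lambda>j. b j + b' j) \<le> max (C + 4 * \<epsilon>) (sqrt ((rho a b)\<^sup>2 + (rho a b')\<^sup>2 + 2 * ?I))"
    proof (rule tendsto_le[OF W_nonbot])
      show "((\<lambda>e. max (C + 4 * \<epsilon>) (sqrt ((N (lev a b e))\<^sup>2 + (N (lev a b' e))\<^sup>2 + 2 * ?ip e))) \<longlongrightarrow>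
        max (C + 4 * \<epsilon>) (sqrt ((rho a b)\<^sup>2 + (rho a b')\<^sup>2 + 2 * ?I))) W"
        by (intro tendsto_max tendsto_const tendsto_real_sqrt tendsto_add tendsto_power rho_tendsto
            tendsto_mult inner_tendsto b disj)
      show "((\<lambda>e. N (lev a (\<lambda>j. b j + b' j) e)) \<longlongrightarrow> rho a (\<lambda>j. b j + b' j)) W"
        by (intro rho_tendsto c00_add b)
      show "\<forall>\<^sub>F e in W. N (lev a (\<lambda>j. b j + b' j) e)
        \<le> max (C + 4 * \<epsilon>) (sqrt ((N (lev a b e))\<^sup>2 + (N (lev a b' e))\<^sup>2 + 2 * ?ip e))"
        using sup_part[OF eps]
      proof eventually_elim
        case (elim e)
        have lc: "(\<lambda>c. lev a b e c + lev a b' e c) \<in> c00" by (intro c00_add lev_c00 b)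
        have "sup_norm (\<lambda>c. lev a b e c + lev a b' e c) \<le> C + 4 * \<epsilon>"
          by (rule sup_norm_least) (use elim in blast)
        then show ?case
          unfolding lev_add[OF b] N_implicit(2)[OF lc] using sum_part[of e]
          by (intro max.mono)
      qed
    qed
    also have "\<dots> \<le> max (C + 4 * \<epsilon>) (sqrt (2 * C\<^sup>2 + 2 * ?I))"
    proof -
      have "(rho a b)\<^sup>2 \<le> C\<^sup>2" "(rho a b')\<^sup>2 \<le> C\<^sup>2"
        using C rho_nonneg b by (auto intro!: power_mono)
      then show ?thesis by (intro max.mono real_sqrt_le_mono) auto
    qed
    finally show ?thesis .
  qed
  show ?thesis
  proof (rule le_of_le_add_eps)
    fix \<epsilon> :: real assume "\<epsilon> > 0"
    then show "rho a (\<lambda>j. b j + b' j) \<le> max C (sqrt (2 * C\<^sup>2 + 2 * ?I)) + \<epsilon> * 4"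
      using bound[of \<epsilon>] by (auto simp: max_def split: if_splits)
  qed
qed

text \<open>The inner product of \<open>b 0\<close> with a long average is at most
  \<open>0.11 * C\<^sup>2\<close> on the coordinates below \<open>Q\<close> (from \<open>1.1\<close>
  times the sum \<open>0.1\<close>) plus \<open>0.1 * C\<^sup>2\<close> on the tail, hence at most
  \<open>C\<^sup>2 / 4\<close>. Then \<open>2 + 1/2 \<le> (8/5)\<^sup>2\<close>, and halving gives
  \<open>4/5\<close>.\<close>

lemma rho_contraction:
  assumes b: "block_supp l b" and a: "a < k" and C: "\<And>i. rho a (b i) \<le> C" "C > 0"
  shows "\<exists>r>0. rho a (\<lambda>j. (1/2) * (b 0 j + (1 / real r) * (\<Sum>i<r. b (Suc i) j))) \<le> (4/5) * C"
proof -
  have bc: "b i \<in> c00" for i by (rule block_supp_c00[OF b])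
  have lm: "mono l" using b by (simp add: block_supp_def)
  let ?g = "\<lambda>q. lam a q (b 0)"
  have gsq: "(\<Sum>q<Q. (?g q)\<^sup>2) \<le> C\<^sup>2" for Q
    using lam_square_sum[OF bc, where i1 = 0] power_mono[OF C(1)[of 0] rho_nonneg[OF bc], of 2] order_trans by blast
  have sg: "summable (\<lambda>q. (?g q)\<^sup>2)" by (rule summable_square_bounded[OF gsq])
  have "(\<lambda>Q. \<Sum>q. (?g (q + Q))\<^sup>2) \<longlonglongrightarrow> 0" using suminf_exist_split2[OF sg] .
  then have "\<forall>\<^sub>F Q in sequentially. (\<Sum>q. (?g (q + Q))\<^sup>2) < C\<^sup>2 / 400"
    using C(2) by (intro order_tendstoD) auto
  then obtain Q where Q: "(\<Sum>q. (?g (q + Q))\<^sup>2) < C\<^sup>2 / 400"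
    by (meson eventually_sequentially order_refl)
  \<comment> \<open>\<open>b 0\<close> lives essentially on the coordinates \<open>q < Q\<close>, where a long average is at most
    about \<open>C / m q\<close>; hence the two are almost orthogonal.\<close>
  define r where "r = 10 * (\<Sum>q<Q. n q) + 1"
  have r: "r > 0" by (simp add: r_def)
  have nr: "real (n q) / real r \<le> 1/10" if "q < Q" for q
  proof -
    have "10 * n q \<le> r" using member_le_sum[of q "{..<Q}" n] that by (simp add: r_def)
    then have "10 * real (n q) \<le> real r" by (metis of_nat_le_iff of_nat_mult of_nat_numeral)
    then show ?thesis using r by (simp add: field_simps)
  qed
  let ?b' = "\<lambda>j. (1 / real r) * (\<Sum>i<r. b (Suc i) j)"
  have bs: "block_supp (\<lambda>i. l (Suc i)) (\<lambda>i. b (Suc i))"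
    using b unfolding block_supp_def mono_def by auto
  have sc: "(\<lambda>j. \<Sum>i<r. b (Suc i) j) \<in> c00" by (intro c00_sum bc) auto
  have b'c: "?b' \<in> c00" by (intro c00_scale sc)
  have rb': "rho a ?b' \<le> C"
  proof -
    have "rho a ?b' = (1 / real r) * rho a (\<lambda>j. \<Sum>i<r. b (Suc i) j)"
      using rho_scale[OF sc, of a "1 / real r"] by simp
    also have "\<dots> \<le> (1 / real r) * (\<Sum>i<r. rho a (b (Suc i)))"
      by (intro mult_left_mono rho_sum bc) auto
    also have "\<dots> \<le> (1 / real r) * (\<Sum>i<r. C)" by (intro mult_left_mono sum_mono C(1)) auto
    also have "\<dots> = C" using r by simp
    finally show ?thesis .
  qed
  have lamb': "lam a q ?b' \<le> (1 / real (m q)) * (11/10) * C" if "q < Q" for q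
  proof -
    have "lam a q ?b' \<le> (1 / real (m q)) * (1 + real (n q) / real r) * C"
      by (rule lam_average_le[OF bs a C(1) less_imp_le[OF C(2)] r])
    also have "\<dots> \<le> (1 / real (m q)) * (11/10) * C"
      using nr[OF that] C(2) by (intro mult_right_mono mult_left_mono) auto
    finally show ?thesis .
  qed
  let ?f = "\<lambda>q. lam a q ?b'"
  have fsq: "(\<Sum>q<Q. (?f q)\<^sup>2) \<le> C\<^sup>2" for Q
    using lam_square_sum[OF b'c] power_mono[OF rb' rho_nonneg[OF b'c], of 2] order_trans by blast
  have sf: "summable (\<lambda>q. (?f q)\<^sup>2)" by (rule summable_square_bounded[OF fsq])
  have "(\<Sum>q. ?f q * ?g q) = (\<Sum>q. ?f (q + Q) * ?g (q + Q)) + (\<Sum>q<Q. ?f q * ?g q)"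
    by (rule suminf_split_initial_segment[OF summable_product_of_squares[OF sf sg]])
  \<comment> \<open>With \<open>t = 1/20\<close> both terms of the tail estimate are at most
    \<open>C\<^sup>2 / 20\<close>; this is why \<open>Q\<close> was chosen for the bound
    \<open>C\<^sup>2 / 400\<close>.\<close>
  moreover have "(\<Sum>q. ?f (q + Q) * ?g (q + Q)) \<le> C\<^sup>2 / 10"
    using ell2_tail_inner[of ?f "C\<^sup>2" ?g "1/20" Q, OF fsq sg] Q by (simp add: abs_le_iff)
  moreover have "(\<Sum>q<Q. ?f q * ?g q) \<le> (11/100) * C\<^sup>2"
  proof -
    have "(\<Sum>q<Q. ?f q * ?g q) \<le> (\<Sum>q<Q. ((1 / real (m q)) * (11/10) * C) * C)"
    proof (intro sum_mono mult_mono)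
      fix q
      show "?g q \<le> C" using lam_le_rho[OF bc, of a q 0] C(1)[of 0] by linarith
    qed (use lamb' lam_nonneg[OF bc] C(2) in auto)
    also have "\<dots> = (11/10) * C\<^sup>2 * (\<Sum>q<Q. 1 / real (m q))"
      by (simp add: sum_distrib_left power2_eq_square field_simps)
    also have "\<dots> \<le> (11/10) * C\<^sup>2 * (1/10)"
    proof (intro mult_left_mono)
      show "(\<Sum>q<Q. 1 / real (m q)) \<le> 1/10"
        using sum_le_suminf[OF m_summable, of "{..<Q}"] m_sum by auto
    qed auto
    finally show ?thesis by simp
  qed
  ultimately have "(\<Sum>q. ?f q * ?g q) \<le> C\<^sup>2 / 4" using zero_le_power2[of C] by linarith
  then have ip: "(\<Sum>q. ?g q * ?f q) \<le> C\<^sup>2 / 4" by (simp only: mult.commute)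
  have "rho a (\<lambda>j. b 0 j + ?b' j) \<le> max C (sqrt (2 * C\<^sup>2 + 2 * (\<Sum>q. ?g q * ?f q)))"
  proof (rule rho_add_blocks_le[OF bc b'c _ _ a C(1) rb', of _ "l (Suc 0)"])
    fix j
    show "j < l (Suc 0)" if "b 0 j \<noteq> 0" using b that unfolding block_supp_def by blast
    assume nz: "?b' j \<noteq> 0"
    then have "(\<Sum>i<r. b (Suc i) j) \<noteq> 0" by auto
    then obtain i where "b (Suc i) j \<noteq> 0" by (meson sum.not_neutral_contains_not_neutral)
    then have "l (Suc i) \<le> j" using b unfolding block_supp_def by blast
    moreover have "l (Suc 0) \<le> l (Suc i)" by (intro monoD[OF lm]) auto
    ultimately show "l (Suc 0) \<le> j" by linarith
  qed
  also have "\<dots> \<le> (8/5) * C"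
  proof (rule max.boundedI)
    have "sqrt (2 * C\<^sup>2 + 2 * (\<Sum>q. ?g q * ?f q)) \<le> sqrt (((8/5) * C)\<^sup>2)"
    proof (rule real_sqrt_le_mono)
      show "2 * C\<^sup>2 + 2 * (\<Sum>q. ?g q * ?f q) \<le> ((8/5) * C)\<^sup>2"
      proof -
        have "((8/5) * C)\<^sup>2 = (64/25) * C\<^sup>2" by (simp add: power_mult_distrib power2_eq_square)
        then show ?thesis using ip zero_le_power2[of C] by linarith
      qed
    qed
    then show "sqrt (2 * C\<^sup>2 + 2 * (\<Sum>q. ?g q * ?f q)) \<le> (8/5) * C" using C(2) by simp
  qed (use C(2) in simp)
  finally have "rho a (\<lambda>j. b 0 j + ?b' j) \<le> (8/5) * C" .
  moreover have "rho a (\<lambda>j. (1/2) * (b 0 j + ?b' j)) = \<bar>1/2\<bar> * rho a (\<lambda>j. b 0 j + ?b' j)"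
    by (rule rho_scale[OF c00_add[OF bc b'c]])
  ultimately have "rho a (\<lambda>j. (1/2) * (b 0 j + ?b' j)) \<le> (4/5) * C" by linarith
  then show ?thesis using r by blast
qed

end

text \<open>The total weight \<open>\<sigma>\<close> is a parameter so that averages can be
  assembled by scaling and concatenating adjacent index ranges; \<open>\<sigma> = 1\<close> gives
  convex combinations.\<close>

definition pos_comb :: "(nat \<Rightarrow> nat \<Rightarrow> real) \<Rightarrow> nat \<Rightarrow> nat \<Rightarrow> real \<Rightarrow> (nat \<Rightarrow> real) \<Rightarrow> bool" where
  "pos_comb b p q \<sigma> u \<longleftrightarrow> (\<exists>\<alpha>. (\<forall>i. 0 \<le> \<alpha> i) \<and> (\<Sum>i\<in>{p..<q}. \<alpha> i) = \<sigma> \<and>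
     u = (\<lambda>j. \<Sum>i\<in>{p..<q}. \<alpha> i * b i j))"

lemma pos_comb_single: "pos_comb b p (Suc p) 1 (b p)"
  unfolding pos_comb_def by (rule exI[of _ "\<lambda>_. 1"]) auto

lemma pos_comb_scale: "pos_comb b p q \<sigma> u \<Longrightarrow> 0 \<le> s \<Longrightarrow> pos_comb b p q (s * \<sigma>) (\<lambda>j. s * u j)"
  unfolding pos_comb_def
proof (elim exE conjE)
  fix \<alpha> assume s: "0 \<le> s" and \<alpha>: "\<forall>i. 0 \<le> \<alpha> i" "(\<Sum>i\<in>{p..<q}. \<alpha> i) = \<sigma>" "u = (\<lambda>j. \<Sum>i\<in>{p..<q}. \<alpha> i * b i j)"
  show "\<exists>\<alpha>'. (\<forall>i. 0 \<le> \<alpha>' i) \<and> (\<Sum>i\<in>{p..<q}. \<alpha>' i) = s * \<sigma> \<and> (\<lambda>j. s * u j) = (\<lambda>j. \<Sum>i\<in>{p..<q}. \<alpha>' i * b i j)"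
    by (rule exI[of _ "\<lambda>i. s * \<alpha> i"]) (use s \<alpha>(1) in \<open>simp add: \<alpha>(2)[symmetric] \<alpha>(3) sum_distrib_left mult.assoc\<close>)
qed

lemma pos_comb_add:
  assumes "pos_comb b p q \<sigma> u" "pos_comb b q r \<tau> v" "p \<le> q" "q \<le> r"
  shows "pos_comb b p r (\<sigma> + \<tau>) (\<lambda>j. u j + v j)"
proof -
  obtain \<alpha> where \<alpha>: "\<And>i. 0 \<le> \<alpha> i" "(\<Sum>i\<in>{p..<q}. \<alpha> i) = \<sigma>" "u = (\<lambda>j. \<Sum>i\<in>{p..<q}. \<alpha> i * b i j)"
    using assms(1) unfolding pos_comb_def by blast
  obtain \<beta> where \<beta>: "\<And>i. 0 \<le> \<beta> i" "(\<Sum>i\<in>{q..<r}. \<beta> i) = \<tau>" "v = (\<lambda>j. \<Sum>i\<in>{q..<r}. \<beta> i * b i j)"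
    using assms(2) unfolding pos_comb_def by blast
  define \<gamma> where "\<gamma> i = (if i < q then \<alpha> i else \<beta> i)" for i
  have split: "(\<Sum>i\<in>{p..<r}. \<gamma> i * f i) = (\<Sum>i\<in>{p..<q}. \<alpha> i * f i) + (\<Sum>i\<in>{q..<r}. \<beta> i * f i)" for f
  proof -
    have "(\<Sum>i\<in>{p..<r}. \<gamma> i * f i) = (\<Sum>i\<in>{p..<q}. \<gamma> i * f i) + (\<Sum>i\<in>{q..<r}. \<gamma> i * f i)"
      by (rule sum.atLeastLessThan_concat[OF assms(3,4), symmetric])
    also have "(\<Sum>i\<in>{p..<q}. \<gamma> i * f i) = (\<Sum>i\<in>{p..<q}. \<alpha> i * f i)"
      by (rule sum.cong) (auto simp: \<gamma>_def)
    also have "(\<Sum>i\<in>{q..<r}. \<gamma> i * f i) = (\<Sum>i\<in>{q..<r}. \<beta> i * f i)"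
      by (rule sum.cong) (auto simp: \<gamma>_def)
    finally show ?thesis .
  qed
  have "\<forall>i. 0 \<le> \<gamma> i" using \<alpha>(1) \<beta>(1) by (simp add: \<gamma>_def)
  moreover have "(\<Sum>i\<in>{p..<r}. \<gamma> i) = \<sigma> + \<tau>" using split[of "\<lambda>_. 1"] \<alpha>(2) \<beta>(2) by simp
  moreover have "(\<lambda>j. u j + v j) = (\<lambda>j. \<Sum>i\<in>{p..<r}. \<gamma> i * b i j)" using split \<alpha>(3) \<beta>(3) by simp
  ultimately show ?thesis unfolding pos_comb_def by blast
qed

lemma pos_comb_weighted_sum:
  assumes "\<And>i. \<nu> i \<le> \<nu> (Suc i)" "\<And>i. pos_comb b (\<nu> i) (\<nu> (Suc i)) 1 (u i)" "\<And>i. 0 \<le> s i"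
  shows "pos_comb b (\<nu> 0) (\<nu> K) (\<Sum>i<K. s i) (\<lambda>j. \<Sum>i<K. s i * u i j)"
proof (induction K)
  case 0
  show ?case unfolding pos_comb_def by (rule exI[of _ "\<lambda>_. 0"]) auto
next
  case (Suc K)
  have "\<nu> 0 \<le> \<nu> K" using assms(1) by (metis le0 lift_Suc_mono_le)
  then have "pos_comb b (\<nu> 0) (\<nu> (Suc K)) ((\<Sum>i<K. s i) + s K * 1) (\<lambda>j. (\<Sum>i<K. s i * u i j) + s K * u K j)"
    by (intro pos_comb_add[OF Suc.IH] pos_comb_scale assms)
  then show ?case by simp
qed

text \<open>\<open>nu\<close> is recovered from the levels only for zero-sum coefficients, because
  the levels omit the limit vector shared by all members of the family.\<close>

locale sm_array = vanishing_array +
  fixes nu :: "(nat \<Rightarrow> real) \<Rightarrow> real"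
  assumes nu_tendsto: "u \<in> c00 \<Longrightarrow> (\<Sum>j | u j \<noteq> 0. u j) = 0 \<Longrightarrow>
    ((\<lambda>e. N (\<lambda>c. \<Sum>a<k. lev a u e c)) \<longlongrightarrow> nu u) W"
begin

lemma nu_le_sum_rho:
  assumes "u \<in> c00" "(\<Sum>j | u j \<noteq> 0. u j) = 0"
  shows "nu u \<le> (\<Sum>a<k. rho a u)"
proof (rule tendsto_le[OF W_nonbot _ nu_tendsto[OF assms]])
  show "((\<lambda>e. \<Sum>a<k. N (lev a u e)) \<longlongrightarrow> (\<Sum>a<k. rho a u)) W"
    by (intro tendsto_sum rho_tendsto assms)
  show "\<forall>\<^sub>F e in W. N (\<lambda>c. \<Sum>a<k. lev a u e c) \<le> (\<Sum>a<k. N (lev a u e))"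
    by (intro always_eventually allI N_sum lev_c00 assms) auto
qed

text \<open>Combinations are demanded beyond every \<open>p\<close>, so that they can be lined up as
  a new block sequence to which the contraction applies again. The bound \<open>C\<close> may differ
  from level to level.\<close>

definition small_combs :: "(nat \<Rightarrow> nat \<Rightarrow> real) \<Rightarrow> (nat \<Rightarrow> real) \<Rightarrow> bool" where
  "small_combs b C \<longleftrightarrow> (\<forall>p. \<exists>q\<ge>p. \<exists>u. pos_comb b p q 1 u \<and> (\<forall>a<k. rho a u \<le> C a))"

lemma pos_comb_block:
  assumes "block_supp l b" "pos_comb b p q \<sigma> u"
  shows "u \<in> c00" "u j \<noteq> 0 \<Longrightarrow> l p \<le> j \<and> j < l q"
proof -
  obtain \<alpha> where u: "u = (\<lambda>j. \<Sum>i\<in>{p..<q}. \<alpha> i * b i j)" using assms(2) unfolding pos_comb_def by blast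
  show "u \<in> c00" unfolding u by (intro c00_sum c00_scale block_supp_c00[OF assms(1)]) auto
  assume nz: "u j \<noteq> 0"
  then obtain i where i: "i \<in> {p..<q}" "\<alpha> i * b i j \<noteq> 0"
    unfolding u by (meson sum.not_neutral_contains_not_neutral)
  then have "b i j \<noteq> 0" by auto
  then have "l i \<le> j" "j < l (Suc i)" using assms(1) unfolding block_supp_def by blast+
  moreover have "l p \<le> l i" "l (Suc i) \<le> l q" using assms(1) i unfolding block_supp_def mono_def by auto
  ultimately show "l p \<le> j \<and> j < l q" by linarith
qed

text \<open>Contracts level \<open>a0\<close> alone: its bound drops by
  \<open>rho_contraction\<close>, and the other levels keep theirs because the new vector is a
  convex combination of the old ones.\<close>

lemma small_combs_step:
  assumes b: "block_supp l b" and sc: "small_combs b C" and a0: "a0 < k" "C a0 > 0"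
  shows "small_combs b (C(a0 := (4/5) * C a0))"
  unfolding small_combs_def
proof
  fix p
  have "\<forall>p. \<exists>q u. p \<le> q \<and> pos_comb b p q 1 u \<and> (\<forall>a<k. rho a u \<le> C a)"
    using sc unfolding small_combs_def by blast
  then obtain nxt v where nv: "\<And>p. p \<le> nxt p" "\<And>p. pos_comb b p (nxt p) 1 (v p)"
      "\<And>p a. a < k \<Longrightarrow> rho a (v p) \<le> C a" by metis
  \<comment> \<open>Iterating \<open>nxt\<close> places successive combinations on adjacent index
    ranges.\<close>
  define \<nu> where "\<nu> i = (nxt ^^ i) p" for i
  define u where "u i = v (\<nu> i)" for i
  have \<nu>: "\<nu> i \<le> \<nu> (Suc i)" "pos_comb b (\<nu> i) (\<nu> (Suc i)) 1 (u i)" for i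
    using nv by (simp_all add: \<nu>_def u_def)
  have uc: "u i \<in> c00" for i by (rule pos_comb_block(1)[OF b \<nu>(2)])
  have bs: "block_supp (\<lambda>i. l (\<nu> i)) u"
    unfolding block_supp_def
  proof (intro conjI allI impI)
    have "mono \<nu>" using \<nu>(1) by (simp add: mono_iff_le_Suc)
    then show "mono (\<lambda>i. l (\<nu> i))" using b unfolding block_supp_def mono_def by auto
    fix i j assume "u i j \<noteq> 0"
    then show "l (\<nu> i) \<le> j" "j < l (\<nu> (Suc i))" using pos_comb_block(2)[OF b \<nu>(2)] by blast+
  qed
  have ru: "rho a (u i) \<le> C a" if "a < k" for a i unfolding u_def by (rule nv(3)[OF that])
  obtain r where r: "r > 0" and
    rr: "rho a0 (\<lambda>j. (1/2) * (u 0 j + (1 / real r) * (\<Sum>i<r. u (Suc i) j))) \<le> (4/5) * C a0"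
    using rho_contraction[OF bs a0(1) ru[OF a0(1)] a0(2)] by blast
  \<comment> \<open>The weights of \<open>rho_contraction\<close>: one half on the first vector, the
    other half spread evenly over the next \<open>r\<close>.\<close>
  define s where "s i = (if i = 0 then 1/2 else 1 / (2 * real r))" for i :: nat
  define w where "w = (\<lambda>j. \<Sum>i<Suc r. s i * u i j)"
  have s0: "0 \<le> s i" for i by (simp add: s_def)
  have s1: "(\<Sum>i<Suc r. s i) = 1"
    unfolding sum.lessThan_Suc_shift using r by (simp add: s_def)
  have w_eq: "w = (\<lambda>j. (1/2) * (u 0 j + (1 / real r) * (\<Sum>i<r. u (Suc i) j)))"
    unfolding w_def sum.lessThan_Suc_shift by (simp add: s_def sum_divide_distrib[symmetric] add_divide_distrib mult.commute)
  have "pos_comb b (\<nu> 0) (\<nu> (Suc r)) (\<Sum>i<Suc r. s i) w"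
    unfolding w_def by (rule pos_comb_weighted_sum[of \<nu>, OF \<nu> s0])
  then have "pos_comb b p (\<nu> (Suc r)) 1 w" unfolding s1 by (simp add: \<nu>_def)
  moreover have "p \<le> \<nu> (Suc r)"
  proof -
    have "\<nu> 0 \<le> \<nu> (Suc r)" using \<nu>(1) by (metis le0 lift_Suc_mono_le)
    then show ?thesis by (simp add: \<nu>_def)
  qed
  moreover have "rho a w \<le> (C(a0 := (4/5) * C a0)) a" if "a < k" for a
  proof (cases "a = a0")
    case True then show ?thesis using rr unfolding w_eq by simp
  next
    case False
    have "rho a w \<le> (\<Sum>i<Suc r. rho a (\<lambda>j. s i * u i j))"
      unfolding w_def by (rule rho_sum) (auto intro: c00_scale uc)
    also have "\<dots> = (\<Sum>i<Suc r. s i * rho a (u i))"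
      using s0 by (intro sum.cong) (simp_all only: rho_scale[OF uc] abs_of_nonneg)
    also have "\<dots> \<le> (\<Sum>i<Suc r. s i * C a)" by (intro sum_mono mult_left_mono ru that s0)
    also have "\<dots> = C a" unfolding sum_distrib_right[symmetric] s1 by simp
    finally show ?thesis using False by simp
  qed
  ultimately show "\<exists>q\<ge>p. \<exists>u. pos_comb b p q 1 u \<and> (\<forall>a<k. rho a u \<le> (C(a0 := (4/5) * C a0)) a)"
    by blast
qed

text \<open>The assumption \<open>low\<close> is what equivalence with the
  \<open>\<ell>\<^sub>1\<close> basis says about convex combinations. These inherit the zero sum, so
  \<open>nu\<close> is bounded by the sum of the \<open>k\<close> level seminorms.\<close>

lemma ell1_blocks_impossible:
  assumes b: "block_supp l b" and zs: "\<And>i. (\<Sum>j | b i j \<noteq> 0. b i j) = 0"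
    and bd: "\<And>i a. a < k \<Longrightarrow> rho a (b i) \<le> C0"
    and c: "c > 0" and low: "\<And>p q u. pos_comb b p q 1 u \<Longrightarrow> c \<le> nu u"
  shows False
proof -
  \<comment> \<open>The contraction step needs a strictly positive bound.\<close>
  define C1 where "C1 = max C0 1"
  have C1: "C1 > 0" by (simp add: C1_def)
  have base: "small_combs b (\<lambda>_. C1)"
    unfolding small_combs_def
  proof
    fix p
    have "\<forall>a<k. rho a (b p) \<le> C1" using bd by (auto simp: C1_def le_max_iff_disj)
    then show "\<exists>q\<ge>p. \<exists>u. pos_comb b p q 1 u \<and> (\<forall>a<k. rho a u \<le> C1)"
      using pos_comb_single[of b p] by (intro exI[of _ "Suc p"]) auto
  qed
  \<comment> \<open>One round in progress: the levels below \<open>a'\<close> have been contracted,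
    the others not yet.\<close>
  have level: "small_combs b (\<lambda>a. if a < a' then (4/5) * C else C)" if "small_combs b (\<lambda>_. C)" "C > 0" "a' \<le> k" for C a'
    using that(3)
  proof (induction a')
    case 0 then show ?case using that(1) by simp
  next
    case (Suc a')
    let ?C = "\<lambda>a. if a < a' then (4/5) * C else C"
    have "small_combs b (?C(a' := (4/5) * ?C a'))"
      using Suc that(2) by (intro small_combs_step[OF b]) auto
    moreover have "?C(a' := (4/5) * ?C a') = (\<lambda>a. if a < Suc a' then (4/5) * C else C)"
      by (auto simp: fun_eq_iff)
    ultimately show ?case by simp
  qed
  have round: "small_combs b (\<lambda>_. (4/5) * C)" if "small_combs b (\<lambda>_. C)" "C > 0" for C
    using level[OF that order_refl] unfolding small_combs_def by simp
  have iter: "small_combs b (\<lambda>_. (4/5) ^ t * C1)" for t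
  proof (induction t)
    case 0 then show ?case using base by simp
  next
    case (Suc t)
    then show ?case using round[of "(4/5) ^ t * C1"] C1 by (simp add: mult.assoc)
  qed
  have "(\<lambda>t. real k * ((4/5) ^ t * C1)) \<longlonglongrightarrow> real k * (0 * C1)"
    by (intro tendsto_mult tendsto_const LIMSEQ_power_zero) simp
  then have "\<forall>\<^sub>F t in sequentially. real k * ((4/5) ^ t * C1) < c"
    by (rule order_tendstoD) (simp add: c)
  then obtain t where t: "real k * ((4/5) ^ t * C1) < c" by (meson eventually_sequentially order_refl)
  obtain q u where u: "pos_comb b 0 q 1 u" "\<forall>a<k. rho a u \<le> (4/5) ^ t * C1"
    using iter[of t] unfolding small_combs_def by blast
  obtain \<alpha> where \<alpha>: "u = (\<lambda>j. \<Sum>i\<in>{0..<q}. \<alpha> i * b i j)" using u(1) unfolding pos_comb_def by blast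
  have uc: "u \<in> c00" by (rule pos_comb_block(1)[OF b u(1)])
  have "(\<Sum>j | u j \<noteq> 0. u j) = (\<Sum>j<l q. u j)"
    using pos_comb_block(2)[OF b u(1)] by (intro sum.mono_neutral_left) auto
  also have "\<dots> = (\<Sum>i\<in>{0..<q}. \<alpha> i * (\<Sum>j<l q. b i j))"
    unfolding \<alpha> sum_distrib_left by (rule sum.swap)
  also have "\<dots> = 0"
  proof (rule sum.neutral, rule ballI)
    fix i assume "i \<in> {0..<q}"
    then show "\<alpha> i * (\<Sum>j<l q. b i j) = 0" using zs[of i] block_supp_total[OF b, of i q] by simp
  qed
  finally have "nu u \<le> (\<Sum>a<k. rho a u)" by (rule nu_le_sum_rho[OF uc])
  also have "\<dots> \<le> (\<Sum>a<k. (4/5) ^ t * C1)" using u(2) by (intro sum_mono) auto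
  finally show False using low[OF u(1)] t by simp
qed

text \<open>Replaces all \<open>k * r\<close> pieces by exactly disjoint ones. \<open>E a i\<close>
  cuts \<open>w a i\<close> out of the whole sum, so the norm of the sum controls any single piece
  by restriction, and all pieces of one level by \<open>N_blocks_ge\<close>.\<close>

lemma eventually_disjoint_levels:
  assumes b: "block_supp l b" and eps: "\<epsilon> > 0"
  shows "\<forall>\<^sub>F e in W. \<exists>E w. (\<forall>a<k. block_seq r (E a)) \<and>
    (\<forall>a<k. \<forall>i<r. w a i \<in> c00 \<and> restr (E a i) (\<lambda>x. \<Sum>a<k. \<Sum>i<r. w a i x) = w a i \<and>
       N (\<lambda>c. lev a (b i) e c - w a i c) \<le> \<epsilon>) \<and>
    N (\<lambda>x. (\<Sum>a<k. lev a (\<lambda>j. \<Sum>i<r. b i j) e x) - (\<Sum>a<k. \<Sum>i<r. w a i x)) \<le> real k * real r * \<epsilon>"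
  using eventually_group_blocks[OF b eps, of r]
proof eventually_elim
  case (elim e)
  have bc: "b i \<in> c00" for i by (rule block_supp_c00[OF b])
  have lm: "mono l" using b by (simp add: block_supp_def)
  from elim obtain D w where D: "mono D" and w: "\<And>a i. a < k \<Longrightarrow> i < r \<Longrightarrow> w a i \<in> c00"
    and supp: "\<And>a i c. a < k \<Longrightarrow> i < r \<Longrightarrow> w a i c \<noteq> 0 \<Longrightarrow> D (a * l r + l i) \<le> c \<and> c < D (a * l r + l (Suc i))"
    and diff: "\<And>a i. a < k \<Longrightarrow> i < r \<Longrightarrow> N (\<lambda>c. lev a (b i) e c - w a i c) \<le> \<epsilon>"
    by blast
  define S where "S = (\<lambda>x. \<Sum>a<k. \<Sum>i<r. w a i x)"
  define E where "E a i = {D (a * l r + l i)..<D (a * l r + l (Suc i))}" for a i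
  have after: "D (a * l r + l (Suc i)) \<le> D (a' * l r + l i')"
    if lt: "a < a' \<or> a = a' \<and> i < i'" and "i < r" for a a' i i'
  proof (rule monoD[OF D])
    consider "a < a'" | "a = a'" "i < i'" using lt by blast
    then show "a * l r + l (Suc i) \<le> a' * l r + l i'"
    proof cases
      case 1
      have "l (Suc i) \<le> l r" using that(2) by (intro monoD[OF lm]) auto
      then have "a * l r + l (Suc i) \<le> Suc a * l r" by simp
      also have "\<dots> \<le> a' * l r" using 1 by (intro mult_le_mono1) auto
      finally show ?thesis by linarith
    next
      case 2
      then show ?thesis using monoD[OF lm, of "Suc i" i'] by simp
    qed
  qed
  have Sa: "restr (E a i) S = w a i" if ai: "a < k" "i < r" for a i
  proof
    fix x
    have zero: "w a' i' x = 0" if x: "x \<in> E a i" and a'i': "a' < k" "i' < r" "(a', i') \<noteq> (a, i)" for a' i'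
    proof (rule ccontr)
      assume "w a' i' x \<noteq> 0"
      then have x': "D (a' * l r + l i') \<le> x" "x < D (a' * l r + l (Suc i'))" using supp a'i' by blast+
      have x2: "D (a * l r + l i) \<le> x" "x < D (a * l r + l (Suc i))" using x by (auto simp: E_def)
      have "(a < a' \<or> a = a' \<and> i < i') \<or> (a' < a \<or> a' = a \<and> i' < i)" using a'i'(3) by auto
      then show False using after[of a a' i i'] after[of a' a i' i] ai a'i' x' x2 by linarith
    qed
    show "restr (E a i) S x = w a i x"
    proof (cases "x \<in> E a i")
      case True
      have "S x = (\<Sum>a'<k. \<Sum>i'<r. if a' = a \<and> i' = i then w a i x else 0)"
        unfolding S_def using zero[OF True] by (intro sum.cong refl) auto
      also have "\<dots> = (\<Sum>a'<k. if a' = a then w a i x else 0)"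
        using ai by (intro sum.cong refl) auto
      also have "\<dots> = w a i x" using ai by simp
      finally show ?thesis using True by (simp add: restr_def)
    next
      case False
      then show ?thesis using supp[OF ai, of x] by (auto simp: restr_def E_def)
    qed
  qed
  have blk: "block_seq r (E a)" for a
    unfolding block_seq_def set_less_def
  proof (intro conjI allI impI ballI)
    fix p p' x y assume "p < p' \<and> p' < r" "x \<in> E a p" "y \<in> E a p'"
    then show "x < y" using after[of a a p p'] by (auto simp: E_def)
  qed (simp add: E_def)
  have "N (\<lambda>x. (\<Sum>a<k. lev a (\<lambda>j. \<Sum>i<r. b i j) e x) - S x) = N (\<lambda>x. \<Sum>a<k. \<Sum>i<r. lev a (b i) e x - w a i x)"
    unfolding S_def using lev_sum[of "{..<r}" b _ e] bc by (simp add: sum_subtractf)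
  also have "\<dots> \<le> (\<Sum>a<k. N (\<lambda>x. \<Sum>i<r. lev a (b i) e x - w a i x))"
    by (intro N_sum c00_sum c00_diff lev_c00 bc w) auto
  also have "\<dots> \<le> (\<Sum>a<k. \<Sum>i<r. N (\<lambda>x. lev a (b i) e x - w a i x))"
    by (intro sum_mono N_sum c00_diff lev_c00 bc w) auto
  also have "\<dots> \<le> (\<Sum>a<k. \<Sum>i<r. \<epsilon>)" by (intro sum_mono diff) auto
  finally have "N (\<lambda>x. (\<Sum>a<k. lev a (\<lambda>j. \<Sum>i<r. b i j) e x) - S x) \<le> real k * real r * \<epsilon>" by simp
  then show ?case using blk w Sa diff unfolding S_def by (intro exI[of _ E] exI[of _ w]) auto
qed

text \<open>A block is spread over \<open>k\<close> levels, so its norm is first split into pieces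
  by the triangle inequality. After exchanging the sums, the pieces of each level form one
  admissible family bounded by \<open>m q\<close> times the norm of the whole sum; there are
  \<open>k\<close> levels.\<close>

lemma lower_estimate:
  assumes b: "block_supp l b" and zs: "\<And>i. (\<Sum>j | b i j \<noteq> 0. b i j) = 0"
    and low: "\<And>i. c \<le> nu (b i)"
  shows "real (n q) * c \<le> real k * real (m q) * nu (\<lambda>j. \<Sum>i<n q. b i j)"
proof (rule le_of_le_add_eps)
  fix \<epsilon> :: real assume eps: "\<epsilon> > 0"
  let ?r = "n q"
  have bc: "b i \<in> c00" for i by (rule block_supp_c00[OF b])
  let ?s = "\<lambda>j. \<Sum>i<?r. b i j"
  have sc: "?s \<in> c00" by (intro c00_sum bc) auto
  have zsi: "(\<Sum>j<l ?r. b i j) = 0" if "i < ?r" for i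
    using zs[of i] block_supp_total[OF b that] by simp
  have s_out: "?s j = 0" if "\<not> j < l ?r" for j
    using block_supp_zero_beyond[OF b, of _ ?r j] that by (intro sum.neutral) auto
  have "(\<Sum>j | ?s j \<noteq> 0. ?s j) = (\<Sum>j<l ?r. ?s j)"
    using s_out by (intro sum.mono_neutral_left) auto
  also have "\<dots> = (\<Sum>i<?r. \<Sum>j<l ?r. b i j)" by (rule sum.swap)
  also have "\<dots> = 0" using zsi by (intro sum.neutral) auto
  finally have zss: "(\<Sum>j | ?s j \<noteq> 0. ?s j) = 0" .
  have "\<forall>\<^sub>F e in W. \<forall>i\<in>{..<?r}. c - \<epsilon> < N (\<lambda>x. \<Sum>a<k. lev a (b i) e x)"
  proof (rule eventually_ball_finite, simp, rule ballI)
    fix i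
    show "\<forall>\<^sub>F e in W. c - \<epsilon> < N (\<lambda>x. \<Sum>a<k. lev a (b i) e x)"
      using nu_tendsto[OF bc zs] low[of i] eps by (intro order_tendstoD) auto
  qed
  moreover have "\<forall>\<^sub>F e in W. N (\<lambda>x. \<Sum>a<k. lev a ?s e x) < nu ?s + \<epsilon>"
    using nu_tendsto[OF sc zss] eps by (intro order_tendstoD) auto
  moreover note eventually_disjoint_levels[OF b eps, of ?r]
  ultimately have "\<forall>\<^sub>F e in W. real ?r * c
     \<le> real k * real (m q) * nu ?s + \<epsilon> * (real ?r * (1 + real k) + real k * real (m q) * (1 + real k * real ?r))"
  proof eventually_elim
    case (elim e)
    from elim(3) obtain E w where E: "\<And>a. a < k \<Longrightarrow> block_seq ?r (E a)"
      and w: "\<And>a i. a < k \<Longrightarrow> i < ?r \<Longrightarrow> w a i \<in> c00"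
      and Sa: "\<And>a i. a < k \<Longrightarrow> i < ?r \<Longrightarrow> restr (E a i) (\<lambda>x. \<Sum>a<k. \<Sum>i<?r. w a i x) = w a i"
      and diff: "\<And>a i. a < k \<Longrightarrow> i < ?r \<Longrightarrow> N (\<lambda>c. lev a (b i) e c - w a i c) \<le> \<epsilon>"
      and dS: "N (\<lambda>x. (\<Sum>a<k. lev a ?s e x) - (\<Sum>a<k. \<Sum>i<?r. w a i x)) \<le> real k * real ?r * \<epsilon>"
      by blast
    define S where "S = (\<lambda>x. \<Sum>a<k. \<Sum>i<?r. w a i x)"
    have Sc: "S \<in> c00" unfolding S_def by (intro c00_sum w) auto
    have lev_le: "(\<Sum>i<?r. N (w a i)) \<le> real (m q) * N S" if a: "a < k" for a
      using N_blocks_ge[OF Sc E[OF a]] Sa[OF a] by (simp add: S_def)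
    have N_w: "c - \<epsilon> - real k * \<epsilon> \<le> N (\<lambda>x. \<Sum>a<k. w a i x)" if i: "i < ?r" for i
    proof -
      have c1: "(\<lambda>x. \<Sum>a<k. lev a (b i) e x) \<in> c00" by (intro c00_sum lev_c00 bc) auto
      have c2: "(\<lambda>x. \<Sum>a<k. w a i x) \<in> c00" by (intro c00_sum w i) auto
      have "N (\<lambda>x. (\<Sum>a<k. lev a (b i) e x) - (\<Sum>a<k. w a i x)) \<le> (\<Sum>a<k. N (\<lambda>x. lev a (b i) e x - w a i x))"
        unfolding sum_subtractf[symmetric] by (intro N_sum) (auto intro!: c00_diff lev_c00 bc w i)
      also have "\<dots> \<le> (\<Sum>a<k. \<epsilon>)" by (intro sum_mono diff i) auto
      finally have "N (\<lambda>x. (\<Sum>a<k. lev a (b i) e x) - (\<Sum>a<k. w a i x)) \<le> real k * \<epsilon>" by simp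
      moreover have "c - \<epsilon> < N (\<lambda>x. \<Sum>a<k. lev a (b i) e x)" using elim(1) i by blast
      ultimately show ?thesis using N_diff_le[OF c1 c2] by linarith
    qed
    have N_S: "N S \<le> nu ?s + \<epsilon> + real k * real ?r * \<epsilon>"
    proof -
      have c1: "(\<lambda>x. \<Sum>a<k. lev a ?s e x) \<in> c00" by (intro c00_sum lev_c00 sc) auto
      show ?thesis using N_diff_abs[OF c1 Sc] dS elim(2) unfolding S_def by linarith
    qed
    have "real ?r * (c - \<epsilon> - real k * \<epsilon>) = (\<Sum>i<?r. c - \<epsilon> - real k * \<epsilon>)" by simp
    also have "\<dots> \<le> (\<Sum>i<?r. N (\<lambda>x. \<Sum>a<k. w a i x))" by (intro sum_mono N_w) auto
    also have "\<dots> \<le> (\<Sum>i<?r. \<Sum>a<k. N (w a i))" by (intro sum_mono N_sum w) auto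
    also have "\<dots> = (\<Sum>a<k. \<Sum>i<?r. N (w a i))" by (rule sum.swap)
    also have "\<dots> \<le> (\<Sum>a<k. real (m q) * N S)" by (intro sum_mono lev_le) auto
    also have "\<dots> = real k * real (m q) * N S" by simp
    also have "\<dots> \<le> real k * real (m q) * (nu ?s + \<epsilon> + real k * real ?r * \<epsilon>)"
      by (intro mult_left_mono N_S) auto
    finally show ?case by (simp add: algebra_simps)
  qed
  then show "real ?r * c \<le> real k * real (m q) * nu ?s
    + \<epsilon> * (real ?r * (1 + real k) + real k * real (m q) * (1 + real k * real ?r))"
    unfolding eventually_const[OF W_nonbot] .
qed

end

section \<open>The array of a spreading model\<close>

locale sm_source = implicit_space +
  fixes J :: "(nat \<Rightarrow> real) \<Rightarrow> 'a::real_normed_vector" and k :: nat and x :: "nat set \<Rightarrow> 'a"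
    and M :: "nat set" and nu :: "(nat \<Rightarrow> real) \<Rightarrow> real" and U :: "nat filter"
  assumes J_lin: "linear_on_c00 J" and J_norm: "a \<in> c00 \<Longrightarrow> norm (J a) = N a"
    and J_dense: "closure (J ` c00) = UNIV" and k_pos: "k \<ge> 1"
    and gen: "generates_sm k x M nu" and nu_semi: "seminorm_c00 nu"
    and U_ultra: "is_ultra U" and U_le: "U \<le> inf sequentially (principal M)"
begin

definition valid :: "nat list \<Rightarrow> bool" where
  "valid t \<longleftrightarrow> sorted_wrt (<) t \<and> set t \<subseteq> M \<and> length t = k"

text \<open>Finitely supported stand-ins for the given vectors, with an error that vanishes as the
  first element grows. Lists make it easy to strip last elements; the zero default on invalid lists
  keeps the norm bound uniform over all lists.\<close>

definition xc :: "nat list \<Rightarrow> nat \<Rightarrow> real" where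
  "xc t = (if valid t then SOME w. w \<in> c00 \<and> norm (x (set t) - J w) \<le> 1 / (1 + real (hd t)) else (\<lambda>_. 0))"

lemma xc_valid:
  assumes "valid t" shows "xc t \<in> c00 \<and> norm (x (set t) - J (xc t)) \<le> 1 / (1 + real (hd t))"
proof -
  have "x (set t) \<in> closure (J ` c00)" using J_dense by simp
  then obtain y where "y \<in> J ` c00" "dist y (x (set t)) < 1 / (1 + real (hd t))"
    unfolding closure_approachable by (metis add_pos_nonneg of_nat_0_le_iff zero_less_divide_1_iff zero_less_one)
  then have "\<exists>w. w \<in> c00 \<and> norm (x (set t) - J w) \<le> 1 / (1 + real (hd t))"
    by (auto simp: dist_norm norm_minus_commute intro: less_imp_le)
  from someI_ex[OF this] show ?thesis using assms by (simp add: xc_def)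
qed

lemma xc_c00: "xc t \<in> c00"
  using xc_valid[of t] by (cases "valid t") (auto simp: xc_def c00_zero)

lemma elt_valid: "sorted_wrt (<) t \<Longrightarrow> elt (set t) i = t ! i"
  unfolding elt_def strict_sorted_iff
  by (simp add: sorted_list_of_set.idem_if_sorted_distinct)

lemma gen_bound:
  "\<exists>\<delta>::nat \<Rightarrow> real. \<delta> \<longlonglongrightarrow> 0 \<and> (\<forall>l r s a. 1 \<le> r \<longrightarrow> r \<le> l \<longrightarrow> plegma k M r s \<longrightarrow>
      enumerate M (l - 1) \<le> elt (s 0) 0 \<longrightarrow> (\<forall>j<r. \<bar>a j\<bar> \<le> 1) \<longrightarrow>
      \<bar>norm (\<Sum>j<r. a j *\<^sub>R x (s j)) - nu (\<lambda>j. if j < r then a j else 0)\<bar> \<le> \<delta> l)"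
proof -
  obtain \<delta> where d: "\<delta> \<longlonglongrightarrow> 0" and g: "\<forall>l\<ge>1. \<forall>r. 1 \<le> r \<and> r \<le> l \<longrightarrow>
         (\<forall>s. plegma k M r s \<and> elt (s 0) 0 \<ge> enumerate M (l - 1) \<longrightarrow>
           (\<forall>a::nat \<Rightarrow> real. (\<forall>j<r. \<bar>a j\<bar> \<le> 1) \<longrightarrow>
              \<bar>norm (\<Sum>j<r. a j *\<^sub>R x (s j)) - nu (\<lambda>j. if j < r then a j else 0)\<bar> \<le> \<delta> l))"
    using gen unfolding generates_sm_def by (elim exE conjE)
  show ?thesis
  proof (intro exI[of _ \<delta>] conjI d allI impI)
    fix l r s and a :: "nat \<Rightarrow> real"
    assume h: "1 \<le> r" "r \<le> l" "plegma k M r s" "enumerate M (l - 1) \<le> elt (s 0) 0" "\<forall>j<r. \<bar>a j\<bar> \<le> 1"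
    have "1 \<le> l" using h(1,2) by linarith
    then show "\<bar>norm (\<Sum>j<r. a j *\<^sub>R x (s j)) - nu (\<lambda>j. if j < r then a j else 0)\<bar> \<le> \<delta> l"
      by (rule g[THEN spec, THEN mp, THEN spec, THEN mp, THEN spec, THEN mp, THEN spec, THEN mp,
            OF _ conjI[OF h(1,2)] conjI[OF h(3,4)] h(5)])
  qed
qed

text \<open>A single set is a plegma family of length one, and every nonempty subset of
  \<open>M\<close> starts at or after the first element of \<open>M\<close>; so the case
  \<open>l = 1\<close> of the generating condition bounds all vectors at once.\<close>

lemma valid_norm_bounded: "\<exists>K. \<forall>t. valid t \<longrightarrow> norm (x (set t)) \<le> K"
proof -
  obtain \<delta> where \<delta>: "\<forall>l r s a. 1 \<le> r \<longrightarrow> r \<le> l \<longrightarrow> plegma k M r s \<longrightarrow>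
      enumerate M (l - 1) \<le> elt (s 0) 0 \<longrightarrow> (\<forall>j<r. \<bar>a j\<bar> \<le> 1) \<longrightarrow>
      \<bar>norm (\<Sum>j<r. a j *\<^sub>R x (s j)) - nu (\<lambda>j. if j < r then a j else 0)\<bar> \<le> \<delta> l"
    using gen_bound by blast
  have "norm (x (set t)) \<le> nu (\<lambda>j. if j < 1 then 1 else 0) + \<delta> 1" if t: "valid t" for t
  proof -
    have srt: "sorted_wrt (<) t" "set t \<subseteq> M" "length t = k" using t by (auto simp: valid_def)
    have "card (set t) = k" using srt by (metis distinct_card strict_sorted_iff)
    then have "plegma k M 1 (\<lambda>_. set t)"
      unfolding plegma_def k_subset_def elt_valid[OF srt(1)]
      using srt sorted_wrt_nth_less[OF srt(1)] by auto
    moreover have "enumerate M (1 - 1) \<le> elt (set t) 0"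
    proof -
      have "0 < length t" using srt(3) k_pos by linarith
      then have "t ! 0 \<in> set t" by (rule nth_mem)
      then have "t ! 0 \<in> M" using srt(2) by blast
      then show ?thesis unfolding elt_valid[OF srt(1)] by (simp add: enumerate_0 Least_le)
    qed
    ultimately show ?thesis using \<delta>[rule_format, of 1 1 "\<lambda>_. set t" "\<lambda>_. 1"] by (simp add: abs_le_iff)
  qed
  then show ?thesis by blast
qed

definition xbound :: real where
  "xbound = (SOME K. \<forall>t. N (xc t) \<le> K)"

lemma xc_bound: "N (xc t) \<le> xbound"
proof -
  obtain K where K: "\<And>t. valid t \<Longrightarrow> norm (x (set t)) \<le> K" using valid_norm_bounded by blast
  have "N (xc t) \<le> max 0 (K + 1)" for t
  proof (cases "valid t")
    case True
    have "norm (J (xc t)) \<le> norm (x (set t)) + norm (x (set t) - J (xc t))"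
      by (metis norm_minus_commute norm_triangle_sub)
    moreover have "1 / (1 + real (hd t)) \<le> 1" by simp
    ultimately show ?thesis using K[OF True] xc_valid[OF True] J_norm[OF xc_c00, of t] by linarith
  next
    case False then show ?thesis by (simp add: xc_def N_zero)
  qed
  then have "\<exists>K. \<forall>t. N (xc t) \<le> K" by blast
  from someI_ex[OF this] show ?thesis unfolding xbound_def by blast
qed

text \<open>\<open>yy d t\<close> is the iterated coordinatewise limit over the \<open>d\<close> missing last elements of \<open>t\<close>.\<close>

primrec yy :: "nat \<Rightarrow> nat list \<Rightarrow> nat \<Rightarrow> real" where
  "yy 0 t c = xc t c"
| "yy (Suc d) t c = Lim U (\<lambda>v. yy d (t @ [v]) c)"

lemma U_nonbot: "U \<noteq> bot" using U_ultra by (simp add: is_ultra_def)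

lemma yy_bound: "\<bar>yy d t c\<bar> \<le> xbound"
proof (induction d arbitrary: t)
  case 0
  show ?case using abs_le_N[OF xc_c00, of t c] xc_bound[of t] by simp
next
  case (Suc d)
  have "((\<lambda>v. yy d (t @ [v]) c) \<longlongrightarrow> yy (Suc d) t c) U"
    unfolding yy.simps by (rule is_ultra_tendsto_Lim[OF U_ultra]) (rule Suc.IH)
  moreover have "\<forall>\<^sub>F v in U. \<bar>yy d (t @ [v]) c\<bar> \<le> xbound" using Suc.IH by simp
  ultimately show ?case by (rule tendsto_abs_le[OF U_nonbot])
qed

lemma yy_tendsto: "((\<lambda>v. yy d (t @ [v]) c) \<longlongrightarrow> yy (Suc d) t c) U"
  unfolding yy.simps by (rule is_ultra_tendsto_Lim[OF U_ultra]) (rule yy_bound)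

text \<open>On a finite set coordinatewise convergence is norm convergence, so the bound survives
  each limit. Bounds over all finite sets are what \<open>tails_vanish\<close> asks for.\<close>

lemma yy_N: assumes E: "finite E" shows "N (restr E (yy d t)) \<le> xbound"
proof (induction d arbitrary: t)
  case 0
  have "yy 0 t = xc t" by (simp add: fun_eq_iff)
  then show ?case using N_restr[OF xc_c00, of E t] xc_bound[of t] by simp
next
  case (Suc d)
  have rc: "restr E y \<in> c00" for y by (rule c00_restr_finite[OF E])
  have le: "N (restr E (yy (Suc d) t)) \<le> xbound + (\<Sum>c\<in>E. \<bar>yy (Suc d) t c - yy d (t @ [v]) c\<bar> * N (unit_vec c))" for v
  proof -
    have "N (restr E (yy (Suc d) t)) \<le> N (restr E (yy d (t @ [v]))) + N (\<lambda>c. restr E (yy (Suc d) t) c - restr E (yy d (t @ [v])) c)"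
      by (rule N_diff_le[OF rc rc])
    also have "(\<lambda>c. restr E (yy (Suc d) t) c - restr E (yy d (t @ [v])) c) = restr E (\<lambda>c. yy (Suc d) t c - yy d (t @ [v]) c)"
      by (auto simp: restr_def fun_eq_iff simp del: yy.simps)
    finally show ?thesis using Suc.IH[of "t @ [v]"] N_restr_coord[OF E, of "\<lambda>c. yy (Suc d) t c - yy d (t @ [v]) c"] by linarith
  qed
  have "((\<lambda>v. xbound + (\<Sum>c\<in>E. \<bar>yy (Suc d) t c - yy d (t @ [v]) c\<bar> * N (unit_vec c)))
    \<longlongrightarrow> xbound + (\<Sum>c\<in>E. \<bar>yy (Suc d) t c - yy (Suc d) t c\<bar> * N (unit_vec c))) U"
    by (intro tendsto_add tendsto_const tendsto_sum tendsto_mult tendsto_rabs tendsto_diff yy_tendsto)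
  then have "N (restr E (yy (Suc d) t)) \<le> xbound + (\<Sum>c\<in>E. \<bar>yy (Suc d) t c - yy (Suc d) t c\<bar> * N (unit_vec c))"
    by (rule tendsto_lowerbound) (use le U_nonbot in \<open>simp_all del: yy.simps\<close>)
  then show ?case by (simp del: yy.simps)
qed

text \<open>Similar to a martingale difference: what the last element of \<open>t\<close> adds to
  the iterated limit. For \<open>t\<close> of length \<open>a + 1\<close> this is the level
  \<open>a\<close> piece before truncation.\<close>

definition hh :: "nat list \<Rightarrow> nat \<Rightarrow> real" where
  "hh t = (\<lambda>c. yy (k - length t) t c - yy (Suc (k - length t)) (butlast t) c)"

lemma hh_N: assumes "finite E" shows "N (restr E (hh t)) \<le> 2 * xbound"
proof -
  have "restr E (hh t) = (\<lambda>c. restr E (yy (k - length t) t) c + (-1) * restr E (yy (Suc (k - length t)) (butlast t)) c)"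
    by (auto simp: restr_def hh_def fun_eq_iff)
  then have "N (restr E (hh t)) \<le> N (restr E (yy (k - length t) t)) + N (\<lambda>c. (-1) * restr E (yy (Suc (k - length t)) (butlast t)) c)"
    by (simp only: N_add[OF c00_restr_finite[OF assms] c00_scale[OF c00_restr_finite[OF assms]]])
  then show ?thesis
    using N_scale[OF c00_restr_finite[OF assms], of "-1" "yy (Suc (k - length t)) (butlast t)"]
      yy_N[OF assms, of "k - length t" t] yy_N[OF assms, of "Suc (k - length t)" "butlast t"] by linarith
qed

text \<open>\<open>hh t\<close> may have infinite support. Bounded completeness supplies a place
  beyond which it is negligible, with an error that vanishes as the last element grows.\<close>

definition cut :: "nat list \<Rightarrow> nat" where
  "cut t = (SOME D. \<forall>E. finite E \<longrightarrow> E \<subseteq> {D..} \<longrightarrow> N (restr E (hh t)) \<le> 1 / (1 + real (last t)))"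

lemma cut: "finite E \<Longrightarrow> E \<subseteq> {cut t..} \<Longrightarrow> N (restr E (hh t)) \<le> 1 / (1 + real (last t))"
proof -
  have "\<exists>D. \<forall>E. finite E \<longrightarrow> E \<subseteq> {D..} \<longrightarrow> N (restr E (hh t)) \<le> 1 / (1 + real (last t))"
    by (rule tails_vanish[of "hh t" "2 * xbound"]) (auto intro: hh_N add_pos_nonneg)
  from someI_ex[OF this] show "finite E \<Longrightarrow> E \<subseteq> {cut t..} \<Longrightarrow> N (restr E (hh t)) \<le> 1 / (1 + real (last t))"
    unfolding cut_def by blast
qed

text \<open>The truncated level pieces. Levels from \<open>k\<close> on are set to zero because the
  array laws are demanded for all indices.\<close>

definition ZZ :: "nat \<times> nat \<Rightarrow> env \<Rightarrow> nat \<Rightarrow> real" where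
  "ZZ p e = (if fst p < k then let t = map (\<lambda>a. e (a, snd p)) [0..<Suc (fst p)] in restr {..<cut t} (hh t)
     else (\<lambda>_. 0))"

sublocale vanishing_array n m N U k ZZ "2 * xbound"
proof
  show "is_ultra U" by (rule U_ultra)
  show "ZZ p e \<in> c00" for p e
    by (simp add: ZZ_def Let_def c00_restr_finite c00_zero)
  have B: "0 \<le> xbound" using yy_bound[of 0 "[]" 0] by linarith
  show "N (ZZ p e) \<le> 2 * xbound" for p e
    using B by (simp add: ZZ_def Let_def N_zero hh_N)
  show "var_inv (ZZ (a, j)) (a', j')" if "j' \<noteq> j \<or> a < a'" for j' j a a'
    unfolding var_inv_def
  proof (intro allI)
    fix e :: env and v
    have "map (\<lambda>i. (e((a', j') := v)) (i, j)) [0..<Suc a] = map (\<lambda>i. e (i, j)) [0..<Suc a]"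
      using that by (intro map_cong refl) auto
    then show "ZZ (a, j) (e((a', j') := v)) = ZZ (a, j) e"
      unfolding ZZ_def fst_conv snd_conv by (simp only:)
  qed
  show "((\<lambda>v. ZZ (a, j) (e((a, j) := v)) c) \<longlongrightarrow> 0) U" for a j e c
  proof (cases "a < k")
    case False then show ?thesis by (simp add: ZZ_def)
  next
    case True
    define t where "t = map (\<lambda>i. e (i, j)) [0..<a]"
    have lt: "length t = a" by (simp add: t_def)
    have upd: "map (\<lambda>i. (e((a, j) := v)) (i, j)) [0..<Suc a] = t @ [v]" for v
      by (simp add: t_def)
    have "k - length (t @ [v]) = k - Suc a" "Suc (k - Suc a) = k - a" for v :: nat using True lt by auto
    then have hh: "hh (t @ [v]) c = yy (k - Suc a) (t @ [v]) c - yy (k - a) t c" for v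
      unfolding hh_def by (simp only: butlast_snoc)
    have "((\<lambda>v. yy (k - Suc a) (t @ [v]) c - yy (k - a) t c) \<longlongrightarrow> yy (k - a) t c - yy (k - a) t c) U"
      using yy_tendsto[of "k - Suc a" t c] \<open>Suc (k - Suc a) = k - a\<close> by (intro tendsto_diff tendsto_const) simp
    then have "((\<lambda>v. hh (t @ [v]) c) \<longlongrightarrow> 0) U" by (simp only: hh diff_self)
    then show ?thesis
    proof (rule tendsto_0_le[where K = 1], intro always_eventually allI)
      fix v
      have "ZZ (a, j) (e((a, j) := v)) = restr {..<cut (t @ [v])} (hh (t @ [v]))"
        unfolding ZZ_def fst_conv snd_conv upd Let_def using True by (simp only: if_True)
      then show "norm (ZZ (a, j) (e((a, j) := v)) c) \<le> norm (hh (t @ [v]) c) * 1"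
        by (simp add: restr_def)
    qed
  qed
qed

definition col :: "env \<Rightarrow> nat \<Rightarrow> nat list" where
  "col e j = map (\<lambda>a. e (a, j)) [0..<k]"

text \<open>The differences \<open>hh\<close> telescope from \<open>yy k []\<close>, where no
  element is known, to \<open>yy 0\<close>, where all are; \<open>yy k []\<close> does not depend on
  the column.\<close>

lemma xc_telescope: "xc (col e j) c - yy k [] c = (\<Sum>a<k. hh (map (\<lambda>i. e (i, j)) [0..<Suc a]) c)"
proof -
  define g where "g a = yy (k - a) (take a (col e j)) c" for a
  have lc: "length (col e j) = k" by (simp add: col_def)
  have "hh (map (\<lambda>i. e (i, j)) [0..<Suc a]) c = g (Suc a) - g a" if a: "a < k" for a
  proof -
    have "map (\<lambda>i. e (i, j)) [0..<Suc a] = take (Suc a) (col e j)"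
      unfolding col_def take_map using a by (simp add: take_upt del: upt_Suc)
    moreover have "butlast (take (Suc a) (col e j)) = take a (col e j)"
      using a lc by (simp add: butlast_take)
    moreover have "length (take (Suc a) (col e j)) = Suc a" "Suc (k - Suc a) = k - a" using a lc by auto
    ultimately show ?thesis unfolding hh_def g_def by (simp only:)
  qed
  then have "(\<Sum>a<k. hh (map (\<lambda>i. e (i, j)) [0..<Suc a]) c) = (\<Sum>a<k. g (Suc a) - g a)" by simp
  also have "\<dots> = g k - g 0" by (rule sum_lessThan_telescope)
  also have "\<dots> = xc (col e j) c - yy k [] c" using lc by (simp add: g_def)
  finally show ?thesis by simp
qed

lemma levels_approx:
  assumes R: "\<And>j. R \<le> j \<Longrightarrow> u j = 0" and zs: "(\<Sum>j<R. u j) = 0"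
  shows "N (\<lambda>c. (\<Sum>j<R. u j * xc (col e j) c) - (\<Sum>a<k. lev a u e c))
    \<le> (\<Sum>j<R. \<Sum>a<k. \<bar>u j\<bar> * (1 / (1 + real (e (a, j)))))"
proof -
  let ?t = "\<lambda>a j. map (\<lambda>i. e (i, j)) [0..<Suc a]"
  let ?V = "\<lambda>c. (\<Sum>j<R. u j * xc (col e j) c) - (\<Sum>a<k. lev a u e c)"
  have u: "u \<in> c00" using R by (rule c00I)
  have Vc: "?V \<in> c00" by (intro c00_diff c00_sum c00_scale xc_c00 lev_c00 u) auto
  \<comment> \<open>The tails of \<open>hh\<close> may be infinite. Since the total error is
    finitely supported, they can be restricted to \<open>{..<D}\<close>, where \<open>cut\<close>
    applies.\<close>
  obtain D where D: "\<And>c. D \<le> c \<Longrightarrow> ?V c = 0" using c00_bound[OF Vc] by blast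
  let ?h = "\<lambda>a j. restr ({..<D} \<inter> {cut (?t a j)..}) (hh (?t a j))"
  have lev: "lev a u e = (\<lambda>c. \<Sum>j<R. u j * ZZ (a, j) e c)" for a
    using R by (intro lev_eq) (auto simp: not_less)
  have eq: "?V c = (\<Sum>j<R. \<Sum>a<k. u j * (hh (?t a j) c - ZZ (a, j) e c))" for c
  proof -
    \<comment> \<open>The common vector \<open>yy k []\<close> is subtracted in every column; its
      total coefficient is zero by \<open>zs\<close>.\<close>
    have "(\<Sum>j<R. u j * xc (col e j) c) = (\<Sum>j<R. u j * (xc (col e j) c - yy k [] c)) + (\<Sum>j<R. u j) * yy k [] c"
      by (simp add: right_diff_distrib sum_subtractf sum_distrib_right)
    then have "(\<Sum>j<R. u j * xc (col e j) c) = (\<Sum>j<R. \<Sum>a<k. u j * hh (?t a j) c)"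
      unfolding zs xc_telescope by (simp add: sum_distrib_left del: upt_Suc)
    moreover have "(\<Sum>a<k. lev a u e c) = (\<Sum>j<R. \<Sum>a<k. u j * ZZ (a, j) e c)"
      unfolding lev by (rule sum.swap)
    ultimately show ?thesis by (simp add: right_diff_distrib sum_subtractf del: upt_Suc)
  qed
  have "?V = (\<lambda>c. \<Sum>j<R. \<Sum>a<k. u j * ?h a j c)"
  proof
    fix c
    show "?V c = (\<Sum>j<R. \<Sum>a<k. u j * ?h a j c)"
    proof (cases "c < D")
      case True
      have "hh (?t a j) c - ZZ (a, j) e c = ?h a j c" if "a < k" for a j
        unfolding ZZ_def fst_conv snd_conv Let_def using that True by (simp add: restr_def del: upt_Suc)
      then show ?thesis unfolding eq by (simp del: upt_Suc)
    next
      case False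
      then show ?thesis using D[of c] by (simp add: restr_def del: upt_Suc)
    qed
  qed
  then have "N ?V = N (\<lambda>c. \<Sum>j<R. \<Sum>a<k. u j * ?h a j c)"
    by (rule arg_cong)
  also have "\<dots> \<le> (\<Sum>j<R. N (\<lambda>c. \<Sum>a<k. u j * ?h a j c))"
    by (intro N_sum c00_sum c00_scale c00_restr_finite) auto
  also have "\<dots> \<le> (\<Sum>j<R. \<Sum>a<k. \<bar>u j\<bar> * N (?h a j))"
    by (intro sum_mono N_lin_comb c00_restr_finite) auto
  also have "\<dots> \<le> (\<Sum>j<R. \<Sum>a<k. \<bar>u j\<bar> * (1 / (1 + real (e (a, j)))))"
  proof (intro sum_mono mult_left_mono)
    fix a j
    show "N (?h a j) \<le> 1 / (1 + real (e (a, j)))"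
      using cut[of "{..<D} \<inter> {cut (?t a j)..}" "?t a j"] by simp
  qed auto
  finally show ?thesis .
qed

end

lemma linear_on_c00_sum:
  fixes T :: "(nat \<Rightarrow> real) \<Rightarrow> 'c::real_vector"
  assumes T: "linear_on_c00 T" and "finite I" "\<And>i. i \<in> I \<Longrightarrow> f i \<in> c00"
  shows "T (\<lambda>c. \<Sum>i\<in>I. r i * f i c) = (\<Sum>i\<in>I. r i *\<^sub>R T (f i))"
proof -
  have add: "a \<in> c00 \<Longrightarrow> b \<in> c00 \<Longrightarrow> T (\<lambda>i. a i + b i) = T a + T b" for a b
    using T unfolding linear_on_c00_def by blast
  have scale: "a \<in> c00 \<Longrightarrow> T (\<lambda>i. s * a i) = s *\<^sub>R T a" for a s
    using T unfolding linear_on_c00_def by blast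
  show ?thesis using assms(2,3)
  proof (induction I rule: finite_induct)
    case empty
    show ?case using scale[OF c00_zero, of 0] by simp
  next
    case (insert i I)
    then show ?case
      using add[of "\<lambda>c. r i * f i c" "\<lambda>c. \<Sum>i\<in>I. r i * f i c"] scale[of "f i" "r i"]
        c00_scale[of "f i" "r i"] c00_sum[of I "\<lambda>i c. r i * f i c"] by (simp add: c00_scale)
  qed
qed

context sm_source begin

text \<open>Increase along the lexicographic order gives both increasing columns and the plegma
  inequalities, including the step from the last member to the next element of the first.\<close>

lemma increasing_plegma:
  assumes R: "R \<ge> 1" and inc0: "\<forall>i<k * R. e (i div R, i mod R) \<in> M \<and> L \<le> e (i div R, i mod R)
    \<and> (\<forall>i'<i. e (i' div R, i' mod R) < e (i div R, i mod R))"
  shows "\<And>j. j < R \<Longrightarrow> valid (col e j)" "plegma k M R (\<lambda>j. set (col e j))"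
    "L \<le> elt (set (col e 0)) 0" "\<And>a j. a < k \<Longrightarrow> j < R \<Longrightarrow> L \<le> e (a, j)"
proof -
  have inc: "e (i div R, i mod R) \<in> M \<and> L \<le> e (i div R, i mod R)
    \<and> (\<forall>i'<i. e (i' div R, i' mod R) < e (i div R, i mod R))" if "i < k * R" for i
    using inc0 that by blast
  have idx: "a * R + j < k * R" "(a * R + j) div R = a" "(a * R + j) mod R = j" if "a < k" "j < R" for a j
  proof -
    have "a * R + j < Suc a * R" using that by simp
    also have "\<dots> \<le> k * R" using that by (intro mult_le_mono) auto
    finally show "a * R + j < k * R" .
  qed (use that in auto)
  have M: "e (a, j) \<in> M" and L: "L \<le> e (a, j)" if "a < k" "j < R" for a j
    using inc[OF idx(1)[OF that]] idx(2,3)[OF that] by simp_all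
  show "\<And>a j. a < k \<Longrightarrow> j < R \<Longrightarrow> L \<le> e (a, j)" by (rule L)
  have lt: "e (a, j) < e (a', j')" if "a < k" "j < R" "a' < k" "j' < R" "a < a' \<or> a = a' \<and> j < j'" for a j a' j'
  proof -
    have "a * R + j < a' * R + j'"
    proof (cases "a = a'")
      case False
      then have "Suc a * R \<le> a' * R" using that(5) by (intro mult_le_mono) auto
      then show ?thesis using that(2) by simp
    qed (use that in simp)
    then show ?thesis using inc[OF idx(1)[OF that(3,4)]] idx(2,3)[OF that(3,4)] idx(2,3)[OF that(1,2)] by metis
  qed
  have nth: "col e j ! a = e (a, j)" if "a < k" for a j using that by (simp add: col_def)
  have len: "length (col e j) = k" for j by (simp add: col_def)
  have srt: "sorted_wrt (<) (col e j)" if "j < R" for j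
    unfolding sorted_wrt_iff_nth_less len
  proof (intro allI impI)
    fix a a' assume "a < a'" "a' < k"
    then show "col e j ! a < col e j ! a'" using lt[of a j a' j] nth that by simp
  qed
  have sub: "set (col e j) \<subseteq> M" if "j < R" for j
    using M that by (auto simp: col_def)
  show val: "\<And>j. j < R \<Longrightarrow> valid (col e j)" using srt sub len by (simp add: valid_def)
  have elt: "elt (set (col e j)) a = e (a, j)" if "j < R" "a < k" for a j
    using elt_valid[OF srt[OF that(1)]] nth[OF that(2)] by simp
  show "L \<le> elt (set (col e 0)) 0" using elt[of 0 0] L[of 0 0] R k_pos by simp
  show "plegma k M R (\<lambda>j. set (col e j))"
    unfolding plegma_def k_subset_def
  proof (intro conjI allI impI)
    fix j assume j: "j < R"
    show "set (col e j) \<subseteq> M" by (rule sub[OF j])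
    show "finite (set (col e j))" by simp
    have "distinct (col e j)" using srt[OF j] unfolding strict_sorted_iff by blast
    then show "card (set (col e j)) = k" using len distinct_card by metis
  next
    fix i j assume "i < k" "Suc j < R"
    then show "elt (set (col e j)) i < elt (set (col e (Suc j))) i" using lt[of i j i "Suc j"] by (simp add: elt)
  next
    fix i assume "Suc i < k"
    then show "elt (set (col e (R - 1))) i < elt (set (col e 0)) (Suc i)"
      using lt[of i "R - 1" "Suc i" 0] R by (simp add: elt)
  qed
qed

text \<open>Three errors: the one in the generating condition, the replacement of \<open>x\<close>
  by \<open>xc\<close>, and the truncation of the level pieces. The last two vanish as all elements
  of the family grow.\<close>

lemma source_nu_tendsto:
  assumes u: "u \<in> c00" and zs: "(\<Sum>j | u j \<noteq> 0. u j) = 0"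
  shows "((\<lambda>e. N (\<lambda>c. \<Sum>a<k. lev a u e c)) \<longlongrightarrow> nu u) W"
proof (rule tendstoI)
  fix \<epsilon> :: real assume eps: "\<epsilon> > 0"
  obtain R0 where R0: "\<And>j. R0 \<le> j \<Longrightarrow> u j = 0" using c00_bound[OF u] by blast
  \<comment> \<open>The successor guarantees a nonempty plegma family.\<close>
  define R where "R = Suc R0"
  have R: "R \<le> j \<Longrightarrow> u j = 0" and R1: "R \<ge> 1" for j using R0[of j] by (auto simp: R_def)
  have "(\<Sum>j | u j \<noteq> 0. u j) = (\<Sum>j<R. u j)"
  proof (rule sum.mono_neutral_left)
    show "{j. u j \<noteq> 0} \<subseteq> {..<R}" using R not_less by blast
  qed auto
  then have zsR: "(\<Sum>j<R. u j) = 0" using zs by simp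
  \<comment> \<open>Dominates every coefficient and their absolute sum; division by \<open>A\<close>
    brings the coefficients into \<open>[-1,1]\<close>, as the generating condition
    requires.\<close>
  define A where "A = 1 + (\<Sum>j<R. \<bar>u j\<bar>)"
  have A1: "A \<ge> 1" unfolding A_def by (simp add: sum_nonneg)
  have uA: "\<bar>u j\<bar> \<le> A" if "j < R" for j
    unfolding A_def using member_le_sum[of j "{..<R}" "\<lambda>j. \<bar>u j\<bar>"] that by simp
  obtain \<delta> where d0: "\<delta> \<longlonglongrightarrow> 0" and \<delta>: "\<forall>l r s a. 1 \<le> r \<longrightarrow> r \<le> l \<longrightarrow> plegma k M r s \<longrightarrow>
      enumerate M (l - 1) \<le> elt (s 0) 0 \<longrightarrow> (\<forall>j<r. \<bar>a j\<bar> \<le> 1) \<longrightarrow>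
      \<bar>norm (\<Sum>j<r. a j *\<^sub>R x (s j)) - nu (\<lambda>j. if j < r then a j else 0)\<bar> \<le> \<delta> l"
    using gen_bound by (elim exE conjE)
  have "\<forall>\<^sub>F l in sequentially. \<delta> l < \<epsilon> / (3 * A)"
    using d0 eps A1 by (intro order_tendstoD(2)[OF d0]) auto
  then have "\<forall>\<^sub>F l in sequentially. \<delta> l < \<epsilon> / (3 * A) \<and> R \<le> l"
    using eventually_ge_at_top[of R] by (rule eventually_conj)
  then obtain l where l: "\<delta> l < \<epsilon> / (3 * A)" "R \<le> l"
    using eventually_happens'[OF sequentially_bot] by blast
  \<comment> \<open>Makes the second and third error together less than
    \<open>\<epsilon> / 3\<close>; the first is less than \<open>\<epsilon> / 3\<close> by the
    choice of \<open>l\<close>. Taking \<open>L\<close> also at least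
    \<open>enumerate M (l - 1)\<close> makes that choice applicable.\<close>
  obtain L0 where L0: "3 * A * (1 + real k) / \<epsilon> < real L0" using reals_Archimedean2 by blast
  define L where "L = max L0 (enumerate M (l - 1))"
  have "real L0 \<le> real L" by (simp add: L_def)
  then have "3 * A * (1 + real k) / \<epsilon> < 1 + real L" using L0 by linarith
  then have LL: "A * (1 + real k) / (1 + real L) < \<epsilon> / 3" using eps by (simp add: field_simps)
  show "\<forall>\<^sub>F e in W. dist (N (\<lambda>c. \<Sum>a<k. lev a u e c)) (nu u) < \<epsilon>"
  proof (rule eventually_mono[OF plegma_filter_increasing[OF ultra U_le, of k R L]])
    fix e :: env
    assume inc0: "\<forall>i<k * R. e (i div R, i mod R) \<in> M \<and> L \<le> e (i div R, i mod R) \<and>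
        (\<forall>i'<i. e (i' div R, i' mod R) < e (i div R, i mod R))"
    note ip = increasing_plegma[OF R1 inc0]
    let ?X = "\<Sum>j<R. u j *\<^sub>R x (set (col e j))"
    have "\<bar>norm (\<Sum>j<R. (u j / A) *\<^sub>R x (set (col e j))) - nu (\<lambda>j. if j < R then u j / A else 0)\<bar> \<le> \<delta> l"
    proof (rule \<delta>[THEN spec, THEN spec, THEN spec, THEN spec, THEN mp, THEN mp, THEN mp, THEN mp, THEN mp, OF R1 l(2) ip(2)])
      show "enumerate M (l - 1) \<le> elt (set (col e 0)) 0" using ip(3) by (simp add: L_def)
      show "\<forall>j<R. \<bar>u j / A\<bar> \<le> 1" using uA A1 by (auto simp: abs_divide)
    qed
    moreover have "(\<lambda>j. if j < R then u j / A else 0) = (\<lambda>j. (1 / A) * u j)" using R by (auto simp: fun_eq_iff)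
    moreover have "nu (\<lambda>j. (1 / A) * u j) = (1 / A) * nu u"
    proof -
      have "nu (\<lambda>j. (1 / A) * u j) = \<bar>1 / A\<bar> * nu u"
        using nu_semi u unfolding seminorm_c00_def by blast
      moreover have "\<bar>1 / A\<bar> = 1 / A" using A1 by simp
      ultimately show ?thesis by (simp only:)
    qed
    moreover have "(\<Sum>j<R. (u j / A) *\<^sub>R x (set (col e j))) = (1 / A) *\<^sub>R ?X"
      by (simp add: scaleR_sum_right)
    ultimately have "\<bar>(1 / A) * norm ?X - (1 / A) * nu u\<bar> \<le> \<delta> l" using A1 by simp
    then have "(1 / A) * \<bar>norm ?X - nu u\<bar> \<le> \<delta> l"
      using A1 by (simp add: right_diff_distrib[symmetric] abs_mult diff_divide_distrib[symmetric] abs_divide)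
    then have "\<bar>norm ?X - nu u\<bar> \<le> A * \<delta> l" using A1 by (simp add: field_simps)
    also have "\<dots> < \<epsilon> / 3" using l(1) A1 by (simp add: field_simps)
    finally have e1: "\<bar>norm ?X - nu u\<bar> < \<epsilon> / 3" .
    let ?V = "\<lambda>c. \<Sum>j<R. u j * xc (col e j) c"
    have Vc: "?V \<in> c00" by (intro c00_sum c00_scale xc_c00) auto
    have sumA: "(\<Sum>j<R. \<bar>u j\<bar>) \<le> A" by (simp add: A_def)
    have inv: "1 / (1 + real (e (a, j))) \<le> 1 / (1 + real L)" if "a < k" "j < R" for a j
      using ip(4)[OF that] by (intro divide_left_mono) auto
    have "J ?V = (\<Sum>j<R. u j *\<^sub>R J (xc (col e j)))" by (rule linear_on_c00_sum[OF J_lin]) (auto intro: xc_c00)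
    then have "norm (?X - J ?V) = norm (\<Sum>j<R. u j *\<^sub>R (x (set (col e j)) - J (xc (col e j))))"
      by (simp add: sum_subtractf scaleR_diff_right)
    also have "\<dots> \<le> (\<Sum>j<R. \<bar>u j\<bar> * (1 / (1 + real L)))"
    proof (rule order_trans[OF norm_sum sum_mono])
      fix j assume "j \<in> {..<R}"
      then have j: "j < R" by simp
      have "hd (col e j) = e (0, j)" using k_pos by (simp add: col_def hd_map)
      then have "norm (x (set (col e j)) - J (xc (col e j))) \<le> 1 / (1 + real L)"
        using xc_valid[OF ip(1)[OF j]] inv[of 0 j] j k_pos by simp
      then show "norm (u j *\<^sub>R (x (set (col e j)) - J (xc (col e j)))) \<le> \<bar>u j\<bar> * (1 / (1 + real L))"
        unfolding norm_scaleR by (rule mult_left_mono) simp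
    qed
    also have "\<dots> = (\<Sum>j<R. \<bar>u j\<bar>) * (1 / (1 + real L))" by (rule sum_distrib_right[symmetric])
    also have "\<dots> \<le> A * (1 / (1 + real L))" using sumA by (intro mult_right_mono) auto
    finally have e2: "\<bar>norm ?X - N ?V\<bar> \<le> A * (1 / (1 + real L))"
      using norm_triangle_ineq3[of ?X "J ?V"] J_norm[OF Vc] by linarith
    have "N (\<lambda>c. ?V c - (\<Sum>a<k. lev a u e c)) \<le> (\<Sum>j<R. \<Sum>a<k. \<bar>u j\<bar> * (1 / (1 + real (e (a, j)))))"
      by (rule levels_approx[OF R zsR])
    also have "\<dots> \<le> (\<Sum>j<R. \<Sum>a<k. \<bar>u j\<bar> * (1 / (1 + real L)))"
      using inv by (intro sum_mono mult_left_mono) auto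
    also have "\<dots> = (\<Sum>j<R. \<bar>u j\<bar>) * (real k * (1 / (1 + real L)))"
      unfolding sum_distrib_right by (intro sum.cong refl) simp
    also have "\<dots> \<le> A * (real k * (1 / (1 + real L)))" using sumA by (intro mult_right_mono) auto
    finally have e3: "N (\<lambda>c. ?V c - (\<Sum>a<k. lev a u e c)) \<le> A * (real k * (1 / (1 + real L)))" .
    have lc: "(\<lambda>c. \<Sum>a<k. lev a u e c) \<in> c00" by (intro c00_sum lev_c00 u) auto
    have "A * (1 / (1 + real L)) + A * (real k * (1 / (1 + real L))) = A * (1 + real k) / (1 + real L)"
      by (simp add: distrib_left add_divide_distrib)
    then show "dist (N (\<lambda>c. \<Sum>a<k. lev a u e c)) (nu u) < \<epsilon>"
      unfolding dist_real_def using e1 e2 e3 N_diff_abs[OF Vc lc] LL eps by linarith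
  qed
qed

sublocale sm_array n m N U k ZZ "2 * xbound" nu
  by unfold_locales (rule source_nu_tendsto)

end

section \<open>Block sequences extracted from an embedding\<close>

context sm_array begin

text \<open>Level \<open>a\<close> is cut out of the whole sum by a restriction. This turns upper
  bounds on \<open>nu\<close> into starting bounds for the iteration over the levels.\<close>

lemma rho_le_nu:
  assumes u: "u \<in> c00" and zs: "(\<Sum>j | u j \<noteq> 0. u j) = 0" and a: "a < k"
  shows "rho a u \<le> nu u"
proof (rule le_of_le_add_eps)
  fix \<epsilon> :: real assume eps: "\<epsilon> > 0"
  obtain R where R: "\<And>j. R \<le> j \<Longrightarrow> u j = 0" using c00_bound[OF u] by blast
  \<comment> \<open>A single block followed by zero blocks, to be used with
    \<open>r = 1\<close>.\<close>
  define l where "l i = (if i = 0 then 0 else R)" for i :: nat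
  define b where "b i = (if i = 0 then u else (\<lambda>_. 0))" for i :: nat
  have bs: "block_supp l b"
    unfolding block_supp_def
  proof (intro conjI allI impI)
    show "mono l" by (auto simp: mono_def l_def)
    fix i j assume "b i j \<noteq> 0"
    then have "i = 0" "u j \<noteq> 0" by (auto simp: b_def split: if_splits)
    moreover have "j < R" if "u j \<noteq> 0" using R[of j] that by (meson not_le)
    ultimately show "l i \<le> j" "j < l (Suc i)" by (auto simp: l_def)
  qed
  have "\<forall>\<^sub>F e in W. N (lev a u e) \<le> N (\<lambda>x. \<Sum>a<k. lev a u e x) + \<epsilon> * (1 + real k)"
    using eventually_disjoint_levels[OF bs eps, of 1]
  proof eventually_elim
    case (elim e)
    then obtain E w where w1: "\<And>a i. a < k \<Longrightarrow> i < 1 \<Longrightarrow> w a i \<in> c00"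
      and S1: "\<And>a i. a < k \<Longrightarrow> i < 1 \<Longrightarrow> restr (E a i) (\<lambda>x. \<Sum>a<k. \<Sum>i<1. w a i x) = w a i"
      and diff1: "\<And>a i. a < k \<Longrightarrow> i < 1 \<Longrightarrow> N (\<lambda>c. lev a (b i) e c - w a i c) \<le> \<epsilon>"
      and dS1: "N (\<lambda>x. (\<Sum>a<k. lev a (\<lambda>j. \<Sum>i<1. b i j) e x) - (\<Sum>a<k. \<Sum>i<1. w a i x)) \<le> real k * real 1 * \<epsilon>"
      by blast
    let ?S = "\<lambda>x. \<Sum>a<k. w a 0 x"
    have w: "w a 0 \<in> c00" if "a < k" for a using w1[OF that zero_less_one] .
    have diff: "N (\<lambda>c. lev a u e c - w a 0 c) \<le> \<epsilon>" using diff1[OF a zero_less_one] by (simp add: b_def)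
    have dS: "N (\<lambda>x. (\<Sum>a<k. lev a u e x) - ?S x) \<le> real k * \<epsilon>" using dS1 by (simp add: b_def)
    have Sc: "?S \<in> c00" by (intro c00_sum w) auto
    have lc: "(\<lambda>x. \<Sum>a<k. lev a u e x) \<in> c00" by (intro c00_sum lev_c00 u) auto
    have "restr (E a 0) ?S = w a 0" using S1[OF a zero_less_one] by simp
    then have "N (w a 0) \<le> N ?S" using N_restr[OF Sc, of "E a 0"] by simp
    moreover have "N (lev a u e) \<le> N (w a 0) + \<epsilon>"
      using N_diff_le[OF lev_c00[OF u, of a e] w[OF a]] diff by linarith
    moreover have "N ?S \<le> N (\<lambda>x. \<Sum>a<k. lev a u e x) + real k * \<epsilon>"
      using N_diff_abs[OF lc Sc] dS by linarith
    ultimately have "N (lev a u e) \<le> N (\<lambda>x. \<Sum>a<k. lev a u e x) + (\<epsilon> + real k * \<epsilon>)" by linarith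
    then show ?case by (simp add: algebra_simps)
  qed
  then show "rho a u \<le> nu u + \<epsilon> * (1 + real k)"
    by (intro tendsto_le[OF W_nonbot tendsto_add[OF nu_tendsto[OF u zs] tendsto_const] rho_tendsto[OF u]])
qed

text \<open>Against the upper bound, \<open>lower_estimate\<close> keeps
  \<open>n q powr (1 - \<theta>) / m q\<close> bounded by \<open>k * C / c\<close>. Here
  \<open>\<theta>\<close> will be \<open>1 / p\<close> for \<open>p > 1\<close> and \<open>0\<close>
  for \<open>c_0\<close>.\<close>

lemma sublinear_blocks_impossible:
  assumes b: "block_supp l b" and zs: "\<And>i. (\<Sum>j | b i j \<noteq> 0. b i j) = 0"
    and c: "c > 0" and low: "\<And>i. c \<le> nu (b i)"
    and up: "\<And>K. K > 0 \<Longrightarrow> nu (\<lambda>j. \<Sum>i<K. b i j) \<le> C * real K powr \<theta>"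
    and lim: "filterlim (\<lambda>q. real (n q) powr (1 - \<theta>) / real (m q)) at_top sequentially"
  shows False
proof -
  have "\<forall>\<^sub>F q in sequentially. real k * C / c < real (n q) powr (1 - \<theta>) / real (m q)"
    using lim unfolding filterlim_at_top_dense by blast
  then obtain q where q: "real k * C / c < real (n q) powr (1 - \<theta>) / real (m q)"
    using eventually_happens'[OF sequentially_bot] by blast
  have np: "real (n q) > 0" and mp: "real (m q) > 0" using n_pos[of q] m_pos[of q] by auto
  have "real (n q) * c \<le> real k * real (m q) * nu (\<lambda>j. \<Sum>i<n q. b i j)"
    by (rule lower_estimate[OF b zs low])
  also have "\<dots> \<le> real k * real (m q) * (C * real (n q) powr \<theta>)"
    by (intro mult_left_mono up n_pos) auto
  finally have "real (n q) * c \<le> real k * real (m q) * (C * real (n q) powr \<theta>)" .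
  moreover have "real (n q) = real (n q) powr (1 - \<theta>) * real (n q) powr \<theta>"
    using np by (simp add: powr_add[symmetric])
  ultimately have "(real (n q) powr (1 - \<theta>) * c) * real (n q) powr \<theta> \<le> (real k * real (m q) * C) * real (n q) powr \<theta>"
    by (simp only: mult.assoc mult.commute mult.left_commute)
  then have "real (n q) powr (1 - \<theta>) * c \<le> real k * real (m q) * C"
    using np by (simp add: mult_le_cancel_right)
  moreover have "real k * C * real (m q) < real (n q) powr (1 - \<theta>) * c" using q c mp by (simp add: field_simps)
  ultimately show False by (simp add: mult.commute mult.left_commute)
qed

end

text \<open>\<open>D\<close> homogeneous equations in more than \<open>D\<close> unknowns, by
  Gaussian elimination: each induction step removes one coordinate by means of a pivot
  vector.\<close>

lemma finite_kernel_vector: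
  fixes v :: "nat \<Rightarrow> nat \<Rightarrow> real"
  assumes "finite I" "card I > D"
  shows "\<exists>\<gamma>. (\<exists>i\<in>I. \<gamma> i \<noteq> 0) \<and> (\<forall>c<D. (\<Sum>i\<in>I. \<gamma> i * v i c) = 0)"
  using assms
proof (induction D arbitrary: I v)
  case 0
  then obtain i where "i \<in> I" by (metis all_not_in_conv card.empty less_irrefl)
  then show ?case by (intro exI[of _ "\<lambda>_. 1"]) auto
next
  case (Suc D)
  show ?case
  proof (cases "\<forall>i\<in>I. v i D = 0")
    case True
    obtain \<gamma> where "\<exists>i\<in>I. \<gamma> i \<noteq> 0" "\<forall>c<D. (\<Sum>i\<in>I. \<gamma> i * v i c) = 0"
      using Suc.IH[of I v] Suc.prems by auto
    then show ?thesis using True by (intro exI[of _ \<gamma>]) (auto simp: less_Suc_eq)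
  next
    case False
    then obtain i0 where i0: "i0 \<in> I" "v i0 D \<noteq> 0" by blast
    let ?I = "I - {i0}"
    define v' where "v' i c = v i c - v i D / v i0 D * v i0 c" for i c
    have "finite ?I" "card ?I > D" using Suc.prems i0 by auto
    from Suc.IH[OF this, of v'] obtain \<gamma> where g: "\<exists>i\<in>?I. \<gamma> i \<noteq> 0" "\<forall>c<D. (\<Sum>i\<in>?I. \<gamma> i * v' i c) = 0" by blast
    define s where "s = (\<Sum>i\<in>?I. \<gamma> i * (v i D / v i0 D))"
    define \<gamma>' where "\<gamma>' = \<gamma>(i0 := - s)"
    have "(\<Sum>i\<in>I. \<gamma>' i * v i c) = (\<Sum>i\<in>?I. \<gamma> i * v' i c)" for c
    proof -
      have "(\<Sum>i\<in>I. \<gamma>' i * v i c) = \<gamma>' i0 * v i0 c + (\<Sum>i\<in>?I. \<gamma>' i * v i c)"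
        by (rule sum.remove[OF Suc.prems(1) i0(1)])
      also have "(\<Sum>i\<in>?I. \<gamma>' i * v i c) = (\<Sum>i\<in>?I. \<gamma> i * v i c)" by (rule sum.cong) (auto simp: \<gamma>'_def)
      also have "\<gamma>' i0 * v i0 c = - (\<Sum>i\<in>?I. \<gamma> i * (v i D / v i0 D * v i0 c))"
        by (simp add: \<gamma>'_def s_def sum_distrib_right mult.assoc)
      finally show ?thesis by (simp add: v'_def right_diff_distrib sum_subtractf)
    qed
    moreover have "v' i D = 0" for i using i0(2) by (simp add: v'_def)
    ultimately have "\<forall>c<Suc D. (\<Sum>i\<in>I. \<gamma>' i * v i c) = 0" using g(2) by (auto simp: less_Suc_eq)
    moreover have "\<exists>i\<in>I. \<gamma>' i \<noteq> 0" using g(1) by (auto simp: \<gamma>'_def)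
    ultimately show ?thesis by blast
  qed
qed

text \<open>The image must vanish on \<open>d\<close> columns and have sum zero. These are
  \<open>d + 1\<close> equations, so \<open>d + 2\<close> unknowns suffice; domination of
  coordinates by \<open>nrm\<close> allows the solution to be normalised.\<close>

lemma zero_sum_block_exists:
  fixes \<beta> :: "nat \<Rightarrow> nat \<Rightarrow> real"
  assumes \<beta>: "\<And>i. \<beta> i \<in> c00"
    and nrm1: "\<And>a i. a \<in> c00 \<Longrightarrow> \<bar>a i\<bar> \<le> nrm a"
    and nrm2: "\<And>a r. a \<in> c00 \<Longrightarrow> nrm (\<lambda>i. r * a i) = \<bar>r\<bar> * nrm a"
  shows "\<exists>g p' d'. p \<le> p' \<and> d \<le> d' \<and> (\<forall>i. g i \<noteq> 0 \<longrightarrow> p \<le> i \<and> i < p') \<and> nrm g = 1 \<and>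
    (\<forall>j. (\<Sum>i\<in>{p..<p'}. g i * \<beta> i j) \<noteq> 0 \<longrightarrow> d \<le> j \<and> j < d') \<and>
    (\<Sum>j<d'. \<Sum>i\<in>{p..<p'}. g i * \<beta> i j) = 0"
proof -
  let ?p' = "p + d + 2"
  let ?I = "{p..<?p'}"
  have "\<exists>D. \<forall>j\<ge>D. \<beta> i j = 0" for i using c00_bound[OF \<beta>[of i]] by metis
  then obtain \<Delta> where \<Delta>: "\<And>i j. \<Delta> i \<le> j \<Longrightarrow> \<beta> i j = 0" by metis
  define d' where "d' = d + (\<Sum>i\<in>?I. \<Delta> i)"
  have out: "\<beta> i j = 0" if "i \<in> ?I" "d' \<le> j" for i j
    using \<Delta>[of i j] member_le_sum[of i ?I \<Delta>] that by (simp add: d'_def)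
  \<comment> \<open>Index \<open>d\<close> encodes the equation for the sum, the smaller indices
    those for the columns already used.\<close>
  define v where "v i c = (if c < d then \<beta> i c else (\<Sum>j<d'. \<beta> i j))" for i c
  have "card ?I > Suc d" by simp
  from finite_kernel_vector[OF _ this, of v] obtain \<gamma> where
    nz: "\<exists>i\<in>?I. \<gamma> i \<noteq> 0" and ker: "\<forall>c<Suc d. (\<Sum>i\<in>?I. \<gamma> i * v i c) = 0" by auto
  define \<gamma>' where "\<gamma>' = restr ?I \<gamma>"
  have gc: "\<gamma>' \<in> c00" unfolding \<gamma>'_def by (rule c00_restr_finite) simp
  obtain i0 where "i0 \<in> ?I" "\<gamma> i0 \<noteq> 0" using nz by blast
  then have "0 < \<bar>\<gamma>' i0\<bar>" by (simp add: \<gamma>'_def restr_def)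
  then have pos: "nrm \<gamma>' > 0" using nrm1[OF gc, of i0] by linarith
  define g where "g = (\<lambda>i. (1 / nrm \<gamma>') * \<gamma>' i)"
  have g_supp: "\<forall>i. g i \<noteq> 0 \<longrightarrow> p \<le> i \<and> i < ?p'" by (auto simp: g_def \<gamma>'_def restr_def)
  have g_norm: "nrm g = 1" unfolding g_def nrm2[OF gc] using pos by simp
  have gsum: "(\<Sum>i\<in>?I. g i * f i) = (1 / nrm \<gamma>') * (\<Sum>i\<in>?I. \<gamma> i * f i)" for f
    unfolding sum_distrib_left by (rule sum.cong) (auto simp: g_def \<gamma>'_def restr_def)
  have low: "(\<Sum>i\<in>?I. g i * \<beta> i j) = 0" if "j < d" for j
  proof -
    have "(\<Sum>i\<in>?I. \<gamma> i * v i j) = 0" using ker that by simp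
    then have "(\<Sum>i\<in>?I. \<gamma> i * \<beta> i j) = 0" using that by (simp add: v_def)
    then show ?thesis unfolding gsum by simp
  qed
  have high: "(\<Sum>i\<in>?I. g i * \<beta> i j) = 0" if "d' \<le> j" for j
    using out that by (intro sum.neutral) auto
  have "(\<Sum>i\<in>?I. \<gamma> i * v i d) = 0" using ker by blast
  then have tot: "(\<Sum>i\<in>?I. g i * (\<Sum>j<d'. \<beta> i j)) = 0" unfolding gsum by (simp add: v_def)
  have "(\<Sum>j<d'. \<Sum>i\<in>?I. g i * \<beta> i j) = (\<Sum>i\<in>?I. g i * (\<Sum>j<d'. \<beta> i j))"
    unfolding sum_distrib_left by (rule sum.swap)
  then have zs: "(\<Sum>j<d'. \<Sum>i\<in>?I. g i * \<beta> i j) = 0" using tot by simp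
  have "\<forall>j. (\<Sum>i\<in>?I. g i * \<beta> i j) \<noteq> 0 \<longrightarrow> d \<le> j \<and> j < d'" using low high not_le by blast
  moreover have "p \<le> ?p'" "d \<le> d'" by (auto simp: d'_def)
  ultimately show ?thesis using g_supp g_norm zs by blast
qed

lemma sum_half_powers_le: "(\<Sum>i<D. (1/2::real) ^ i) \<le> 2"
proof -
  have "(\<Sum>i<D. (1/2::real) ^ i) \<le> (\<Sum>i. (1/2::real) ^ i)"
    by (rule sum_le_suminf) (auto intro: summable_geometric)
  also have "\<dots> = 2" by (simp add: suminf_geometric)
  finally show ?thesis .
qed

definition equivalent_blocks ::
  "((nat \<Rightarrow> real) \<Rightarrow> real) \<Rightarrow> ((nat \<Rightarrow> real) \<Rightarrow> real) \<Rightarrow> real \<Rightarrow> real \<Rightarrow> (nat \<Rightarrow> nat) \<Rightarrow>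
    (nat \<Rightarrow> nat \<Rightarrow> real) \<Rightarrow> (nat \<Rightarrow> nat) \<Rightarrow> (nat \<Rightarrow> nat \<Rightarrow> real) \<Rightarrow> bool" where
  "equivalent_blocks nu nrm c C \<iota> g l b \<longleftrightarrow>
    block_supp \<iota> g \<and> (\<forall>i. nrm (g i) = 1) \<and> block_supp l b \<and> (\<forall>i. (\<Sum>j | b i j \<noteq> 0. b i j) = 0) \<and>
    (\<forall>K \<alpha>. c * nrm (\<lambda>i. \<Sum>t<K. \<alpha> t * g t i) \<le> nu (\<lambda>j. \<Sum>t<K. \<alpha> t * b t j) \<and>
       nu (\<lambda>j. \<Sum>t<K. \<alpha> t * b t j) \<le> C * nrm (\<lambda>i. \<Sum>t<K. \<alpha> t * g t i))"

text \<open>The image of the \<open>i\<close>-th unit vector is moved into the span by at most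
  \<open>c / 4 * (1/2) ^ i\<close>. The errors add up to at most \<open>c / 2\<close> times the
  norm, whence the constants \<open>c / 2\<close> and \<open>C + c / 2\<close>.\<close>

lemma c00_embedding_blocks:
  fixes V T :: "(nat \<Rightarrow> real) \<Rightarrow> 'b::banach" and nu nrm :: "(nat \<Rightarrow> real) \<Rightarrow> real"
  assumes T: "generated_banach nu T" and V: "linear_on_c00 V" and c: "c > 0"
    and nrm1: "\<And>a i. a \<in> c00 \<Longrightarrow> \<bar>a i\<bar> \<le> nrm a"
    and nrm2: "\<And>a r. a \<in> c00 \<Longrightarrow> nrm (\<lambda>i. r * a i) = \<bar>r\<bar> * nrm a"
    and Vb: "\<And>a. a \<in> c00 \<Longrightarrow> c * nrm a \<le> norm (V a) \<and> norm (V a) \<le> C * nrm a"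
  shows "\<exists>\<iota> g l b. equivalent_blocks nu nrm (c / 2) (C + c / 2) \<iota> g l b"
proof -
  have Tl: "linear_on_c00 T" and Tn: "\<And>a. a \<in> c00 \<Longrightarrow> norm (T a) = nu a" and Td: "closure (T ` c00) = UNIV"
    using T by (auto simp: generated_banach_def)
  have "\<exists>w. w \<in> c00 \<and> norm (V (unit_vec i) - T w) \<le> c / 4 * (1/2) ^ i" for i
  proof -
    have "V (unit_vec i) \<in> closure (T ` c00)" using Td by simp
    moreover have "0 < c / 4 * (1/2) ^ i" using c by simp
    ultimately obtain y where "y \<in> T ` c00" "dist y (V (unit_vec i)) < c / 4 * (1/2) ^ i"
      unfolding closure_approachable by blast
    then show ?thesis by (auto simp: dist_norm norm_minus_commute intro: less_imp_le)
  qed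
  then obtain \<beta> where \<beta>: "\<And>i. \<beta> i \<in> c00" "\<And>i. norm (V (unit_vec i) - T (\<beta> i)) \<le> c / 4 * (1/2) ^ i" by metis
  have approx: "norm (V a - T (\<lambda>j. \<Sum>i<D. a i * \<beta> i j)) \<le> c / 2 * nrm a"
    if D: "\<And>i. D \<le> i \<Longrightarrow> a i = 0" for a D
  proof -
    have ac: "a \<in> c00" using D by (rule c00I)
    have "a = (\<lambda>c. \<Sum>i<D. a i * unit_vec i c)"
    proof
      fix c show "a c = (\<Sum>i<D. a i * unit_vec i c)"
        using D[of c] by (cases "c < D") (auto simp: unit_vec_def if_distrib[of "(*) _"] cong: if_cong)
    qed
    then have "V a = V (\<lambda>c. \<Sum>i<D. a i * unit_vec i c)" by (rule arg_cong)
    also have "\<dots> = (\<Sum>i<D. a i *\<^sub>R V (unit_vec i))"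
      by (rule linear_on_c00_sum[OF V]) (auto intro: c00_unit)
    finally have "V a = (\<Sum>i<D. a i *\<^sub>R V (unit_vec i))" .
    moreover have "T (\<lambda>j. \<Sum>i<D. a i * \<beta> i j) = (\<Sum>i<D. a i *\<^sub>R T (\<beta> i))"
      by (rule linear_on_c00_sum[OF Tl]) (auto intro: \<beta>)
    ultimately have "norm (V a - T (\<lambda>j. \<Sum>i<D. a i * \<beta> i j)) = norm (\<Sum>i<D. a i *\<^sub>R (V (unit_vec i) - T (\<beta> i)))"
      by (simp add: sum_subtractf scaleR_diff_right)
    also have "\<dots> \<le> (\<Sum>i<D. nrm a * (c / 4 * (1/2) ^ i))"
    proof (rule order_trans[OF norm_sum sum_mono])
      fix i
      have "norm (a i *\<^sub>R (V (unit_vec i) - T (\<beta> i))) = \<bar>a i\<bar> * norm (V (unit_vec i) - T (\<beta> i))" by simp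
      also have "\<dots> \<le> nrm a * (c / 4 * (1/2) ^ i)"
        using nrm1[OF ac, of i] \<beta>(2)[of i] by (intro mult_mono) auto
      finally show "norm (a i *\<^sub>R (V (unit_vec i) - T (\<beta> i))) \<le> nrm a * (c / 4 * (1/2) ^ i)" .
    qed
    also have "\<dots> = nrm a * (c / 4) * (\<Sum>i<D. (1/2) ^ i)" by (simp add: sum_distrib_left mult.assoc)
    also have "\<dots> \<le> nrm a * (c / 4) * 2"
      using nrm1[OF ac, of 0] c by (intro mult_left_mono sum_half_powers_le) auto
    finally show ?thesis by (simp add: mult.commute)
  qed
  define Q where "Q p d X \<longleftrightarrow> (case X of (g, p', d') \<Rightarrow> p \<le> p' \<and> d \<le> d' \<and>
    (\<forall>i. g i \<noteq> 0 \<longrightarrow> p \<le> i \<and> i < p') \<and> nrm g = 1 \<and>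
    (\<forall>j. (\<Sum>i\<in>{p..<p'}. g i * \<beta> i j) \<noteq> 0 \<longrightarrow> d \<le> j \<and> j < d') \<and>
    (\<Sum>j<d'. \<Sum>i\<in>{p..<p'}. g i * \<beta> i j) = 0)" for p d :: nat and X :: "(nat \<Rightarrow> real) \<times> nat \<times> nat"
  have "\<exists>X. Q p d X" for p d
    using zero_sum_block_exists[of \<beta> nrm p d, OF \<beta>(1) nrm1 nrm2] unfolding Q_def by auto
  then have "\<exists>F. \<forall>p d. Q p d (F p d)" by (intro choice allI) blast
  then obtain F where F: "\<forall>p d. Q p d (F p d)" ..
  define gg where "gg p d = fst (F p d)" for p d
  define pp where "pp p d = fst (snd (F p d))" for p d
  define dd where "dd p d = snd (snd (F p d))" for p d
  have Fq: "Q p d (gg p d, pp p d, dd p d)" for p d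
    using F unfolding gg_def pp_def dd_def by simp
  have step: "p \<le> pp p d" "d \<le> dd p d"
    "gg p d i \<noteq> 0 \<Longrightarrow> p \<le> i \<and> i < pp p d" "nrm (gg p d) = 1"
    "(\<Sum>i\<in>{p..<pp p d}. gg p d i * \<beta> i j) \<noteq> 0 \<Longrightarrow> d \<le> j \<and> j < dd p d"
    "(\<Sum>j<dd p d. \<Sum>i\<in>{p..<pp p d}. gg p d i * \<beta> i j) = 0" for p d i j
    using Fq[of p d] unfolding Q_def by auto
  define st where "st t = ((\<lambda>(p, d). (pp p d, dd p d)) ^^ t) (0, 0)" for t
  define \<iota> where "\<iota> t = fst (st t)" for t
  define l where "l t = snd (st t)" for t
  have st: "\<iota> (Suc t) = pp (\<iota> t) (l t)" "l (Suc t) = dd (\<iota> t) (l t)" for t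
    by (simp_all add: \<iota>_def l_def st_def split_beta)
  define g where "g t = gg (\<iota> t) (l t)" for t
  define b where "b t = (\<lambda>j. \<Sum>i\<in>{\<iota> t..<\<iota> (Suc t)}. g t i * \<beta> i j)" for t
  have bs1: "block_supp \<iota> g"
    unfolding block_supp_def mono_iff_le_Suc using step(1,3) by (simp add: st g_def)
  have bs2: "block_supp l b"
    unfolding block_supp_def mono_iff_le_Suc
  proof (intro conjI allI impI)
    show "l t \<le> l (Suc t)" for t unfolding st by (rule step(2))
    fix t j assume "b t j \<noteq> 0"
    then have "(\<Sum>i\<in>{\<iota> t..<pp (\<iota> t) (l t)}. gg (\<iota> t) (l t) i * \<beta> i j) \<noteq> 0"
      by (simp only: b_def g_def st not_False_eq_True)
    from step(5)[OF this] show "l t \<le> j" "j < l (Suc t)" unfolding st by blast+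
  qed
  have zs: "(\<Sum>j | b t j \<noteq> 0. b t j) = 0" for t
  proof -
    have "(\<Sum>j | b t j \<noteq> 0. b t j) = (\<Sum>j<l (Suc t). b t j)"
      using bs2 unfolding block_supp_def by (intro sum.mono_neutral_left) auto
    also have "\<dots> = 0" using step(6)[of "\<iota> t" "l t"] by (simp add: st g_def b_def)
    finally show ?thesis .
  qed
  have est: "c / 2 * nrm (\<lambda>i. \<Sum>t<K. \<alpha> t * g t i) \<le> nu (\<lambda>j. \<Sum>t<K. \<alpha> t * b t j) \<and>
       nu (\<lambda>j. \<Sum>t<K. \<alpha> t * b t j) \<le> (C + c / 2) * nrm (\<lambda>i. \<Sum>t<K. \<alpha> t * g t i)" for K \<alpha>
  proof -
    let ?a = "\<lambda>i. \<Sum>t<K. \<alpha> t * g t i"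
    have im: "mono \<iota>" using bs1 by (simp add: block_supp_def)
    have gout: "g t i = 0" if "t < K" "\<iota> K \<le> i" for t i
      using block_supp_zero_beyond[OF bs1 that] .
    have D: "?a i = 0" if "\<iota> K \<le> i" for i using gout that by (intro sum.neutral) auto
    have ac: "?a \<in> c00" using D by (rule c00I)
    have bt: "b t j = (\<Sum>i<\<iota> K. g t i * \<beta> i j)" if "t < K" for t j
    proof -
      have "\<iota> (Suc t) \<le> \<iota> K" using that by (intro monoD[OF im]) auto
      moreover have "g t i * \<beta> i j = 0" if "i \<in> {..<\<iota> K} - {\<iota> t..<\<iota> (Suc t)}" for i
      proof -
        have "\<not> (\<iota> t \<le> i \<and> i < \<iota> (Suc t))" using that by auto
        then have "g t i = 0" using bs1 unfolding block_supp_def by blast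
        then show ?thesis by simp
      qed
      ultimately show ?thesis unfolding b_def by (intro sum.mono_neutral_left) auto
    qed
    have eq: "(\<lambda>j. \<Sum>t<K. \<alpha> t * b t j) = (\<lambda>j. \<Sum>i<\<iota> K. ?a i * \<beta> i j)"
    proof
      fix j
      have "(\<Sum>t<K. \<alpha> t * b t j) = (\<Sum>t<K. \<Sum>i<\<iota> K. \<alpha> t * g t i * \<beta> i j)"
        using bt by (simp add: sum_distrib_left mult.assoc)
      also have "\<dots> = (\<Sum>i<\<iota> K. \<Sum>t<K. \<alpha> t * g t i * \<beta> i j)" by (rule sum.swap)
      finally show "(\<Sum>t<K. \<alpha> t * b t j) = (\<Sum>i<\<iota> K. ?a i * \<beta> i j)" by (simp add: sum_distrib_right)
    qed
    have "(\<lambda>j. \<Sum>t<K. \<alpha> t * b t j) \<in> c00" by (intro c00_sum c00_scale block_supp_c00[OF bs2]) auto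
    then have "nu (\<lambda>j. \<Sum>t<K. \<alpha> t * b t j) = norm (T (\<lambda>j. \<Sum>i<\<iota> K. ?a i * \<beta> i j))"
      using Tn by (simp only: eq)
    moreover have "norm (V ?a - T (\<lambda>j. \<Sum>i<\<iota> K. ?a i * \<beta> i j)) \<le> c / 2 * nrm ?a"
      using D by (rule approx)
    moreover have "\<bar>norm (V ?a) - norm (T (\<lambda>j. \<Sum>i<\<iota> K. ?a i * \<beta> i j))\<bar> \<le> norm (V ?a - T (\<lambda>j. \<Sum>i<\<iota> K. ?a i * \<beta> i j))"
      by (rule norm_triangle_ineq3)
    moreover have "c * nrm ?a \<le> norm (V ?a)" "norm (V ?a) \<le> C * nrm ?a" using Vb[OF ac] by auto
    moreover have "(C + c / 2) * nrm ?a = C * nrm ?a + c / 2 * nrm ?a" "c * nrm ?a = c / 2 * nrm ?a + c / 2 * nrm ?a"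
      by (simp_all add: algebra_simps)
    ultimately show ?thesis by linarith
  qed
  have n1: "\<forall>t. nrm (g t) = 1" using step(4) by (simp add: g_def)
  have "equivalent_blocks nu nrm (c / 2) (C + c / 2) \<iota> g l b"
    unfolding equivalent_blocks_def using bs1 n1 bs2 zs est by blast
  then show ?thesis by blast
qed

section \<open>The classical sequence norms on blocks with disjoint supports\<close>

lemma c00_sub_lp: "c00 \<subseteq> lp_space p"
proof
  fix a :: "nat \<Rightarrow> real" assume "a \<in> c00"
  then show "a \<in> lp_space p" unfolding lp_space_def mem_Collect_eq
    by (intro summable_finite[of "{i. a i \<noteq> 0}"]) (auto simp: c00_def)
qed

lemma c00_sub_c0: "c00 \<subseteq> c0_space"
proof
  fix a :: "nat \<Rightarrow> real" assume "a \<in> c00"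
  then obtain D where D: "\<And>i. D \<le> i \<Longrightarrow> a i = 0" using c00_bound by blast
  then have "\<forall>\<^sub>F i in sequentially. a i = 0" using eventually_sequentially by blast
  then show "a \<in> c0_space" unfolding c0_space_def mem_Collect_eq by (rule tendsto_eventually)
qed

lemma lp_sum_c00:
  fixes a :: "nat \<Rightarrow> real"
  assumes "\<And>i. D \<le> i \<Longrightarrow> a i = 0" shows "(\<Sum>i. \<bar>a i\<bar> powr p) = (\<Sum>i<D. \<bar>a i\<bar> powr p)"
  using assms by (intro suminf_finite) auto

lemma abs_le_lp_norm:
  assumes "a \<in> c00" "p \<ge> 1" shows "\<bar>a i\<bar> \<le> lp_norm p a"
proof -
  have "summable (\<lambda>i. \<bar>a i\<bar> powr p)" using c00_sub_lp assms(1) by (auto simp: lp_space_def)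
  then have "(\<Sum>i\<in>{i}. \<bar>a i\<bar> powr p) \<le> (\<Sum>i. \<bar>a i\<bar> powr p)" by (intro sum_le_suminf) auto
  then have "(\<bar>a i\<bar> powr p) powr (1 / p) \<le> lp_norm p a"
    unfolding lp_norm_def using assms(2) by (intro powr_mono2) auto
  then show ?thesis using assms(2) by (simp add: powr_powr)
qed

lemma lp_norm_scale:
  assumes "a \<in> c00" "p \<ge> 1" shows "lp_norm p (\<lambda>i. r * a i) = \<bar>r\<bar> * lp_norm p a"
proof -
  have s: "summable (\<lambda>i. \<bar>a i\<bar> powr p)" using c00_sub_lp assms(1) by (auto simp: lp_space_def)
  have "(\<Sum>i. \<bar>r * a i\<bar> powr p) = \<bar>r\<bar> powr p * (\<Sum>i. \<bar>a i\<bar> powr p)"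
    using suminf_mult[OF s, of "\<bar>r\<bar> powr p"] by (simp add: abs_mult powr_mult)
  then show ?thesis
    unfolding lp_norm_def using assms(2) by (simp add: powr_mult powr_powr)
qed

lemma lp_norm_blocks:
  assumes g: "block_supp \<iota> g" and one: "\<And>i. lp_norm p (g i) = 1" and p: "p \<ge> 1"
  shows "lp_norm p (\<lambda>i. \<Sum>t<K. \<alpha> t * g t i) = (\<Sum>t<K. \<bar>\<alpha> t\<bar> powr p) powr (1 / p)"
proof -
  have gout: "g t i = 0" if "t < K" "\<iota> K \<le> i" for t i
    using block_supp_zero_beyond[OF g that] .
  have gsum: "(\<Sum>i<\<iota> K. \<bar>g t i\<bar> powr p) = 1" if "t < K" for t
  proof -
    let ?S = "\<Sum>i<\<iota> K. \<bar>g t i\<bar> powr p"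
    have "(\<Sum>i. \<bar>g t i\<bar> powr p) = ?S" using gout[OF that] by (rule lp_sum_c00)
    then have "?S powr (1 / p) = 1" using one[of t] by (simp add: lp_norm_def)
    then have "(?S powr (1 / p)) powr p = 1" by simp
    moreover have "?S \<ge> 0" by (intro sum_nonneg) auto
    ultimately show ?thesis using p by (simp add: powr_powr)
  qed
  have pt: "\<bar>\<Sum>t<K. \<alpha> t * g t i\<bar> powr p = (\<Sum>t<K. \<bar>\<alpha> t\<bar> powr p * \<bar>g t i\<bar> powr p)" for i
  proof (induction K)
    case (Suc K)
    show ?case
    proof (cases "g K i = 0")
      case True then show ?thesis using Suc by simp
    next
      case False
      then have z: "g t i = 0" if "t < K" for t using block_supp_disjoint[OF g that, of i] by blast
      have "(\<Sum>t<K. \<alpha> t * g t i) = 0" "(\<Sum>t<K. \<bar>\<alpha> t\<bar> powr p * \<bar>g t i\<bar> powr p) = 0"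
        using z by (auto intro!: sum.neutral)
      then show ?thesis by (simp add: abs_mult powr_mult)
    qed
  qed simp
  have "(\<Sum>i. \<bar>\<Sum>t<K. \<alpha> t * g t i\<bar> powr p) = (\<Sum>i<\<iota> K. \<bar>\<Sum>t<K. \<alpha> t * g t i\<bar> powr p)"
    using gout by (intro lp_sum_c00 sum.neutral) auto
  also have "\<dots> = (\<Sum>t<K. \<Sum>i<\<iota> K. \<bar>\<alpha> t\<bar> powr p * \<bar>g t i\<bar> powr p)"
    unfolding pt by (rule sum.swap)
  also have "\<dots> = (\<Sum>t<K. \<bar>\<alpha> t\<bar> powr p)" using gsum by (simp add: sum_distrib_left[symmetric])
  finally show ?thesis by (simp add: lp_norm_def)
qed

lemma abs_le_c0_norm: "a \<in> c00 \<Longrightarrow> \<bar>a i\<bar> \<le> c0_norm a"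
  unfolding c0_norm_def by (rule cSup_upper[OF _ c00_abs_bdd_above]) auto

lemma c0_norm_least: "(\<And>i. \<bar>a i\<bar> \<le> K) \<Longrightarrow> c0_norm a \<le> K"
  unfolding c0_norm_def by (rule cSup_least) auto

lemma c0_norm_scale:
  assumes "a \<in> c00" shows "c0_norm (\<lambda>i. r * a i) = \<bar>r\<bar> * c0_norm a"
proof (rule antisym)
  show "c0_norm (\<lambda>i. r * a i) \<le> \<bar>r\<bar> * c0_norm a"
    by (rule c0_norm_least) (simp add: abs_mult mult_left_mono abs_le_c0_norm[OF assms])
  show "\<bar>r\<bar> * c0_norm a \<le> c0_norm (\<lambda>i. r * a i)"
  proof (cases "r = 0")
    case True
    then show ?thesis using abs_le_c0_norm[OF c00_scale[OF assms, of r], of 0] by simp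
  next
    case False
    have "c0_norm a \<le> c0_norm (\<lambda>i. r * a i) / \<bar>r\<bar>"
    proof (rule c0_norm_least)
      fix i
      have "\<bar>r\<bar> * \<bar>a i\<bar> \<le> c0_norm (\<lambda>i. r * a i)"
        using abs_le_c0_norm[OF c00_scale[OF assms, of r], of i] by (simp add: abs_mult)
      then show "\<bar>a i\<bar> \<le> c0_norm (\<lambda>i. r * a i) / \<bar>r\<bar>" using False by (simp add: field_simps)
    qed
    then show ?thesis using False by (simp add: field_simps)
  qed
qed

text \<open>At each coordinate at most one block is nonzero. The factor 1 matches the general
  combination with all coefficients equal to 1.\<close>

lemma c0_norm_blocks:
  assumes g: "block_supp \<iota> g" and one: "\<And>i. c0_norm (g i) = 1"
  shows "c0_norm (\<lambda>i. \<Sum>t<K. 1 * g t i) \<le> 1"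
proof (rule c0_norm_least)
  fix i
  have le: "\<bar>g t i\<bar> \<le> 1" for t using abs_le_c0_norm[OF block_supp_c00[OF g, of t], of i] one by simp
  show "\<bar>\<Sum>t<K. 1 * g t i\<bar> \<le> 1"
  proof (induction K)
    case (Suc K)
    show ?case
    proof (cases "g K i = 0")
      case False
      then have "(\<Sum>t<K. 1 * g t i) = 0" using block_supp_disjoint[OF g, of _ K i] by (intro sum.neutral) auto
      then show ?thesis using le[of K] by simp
    qed (use Suc in simp)
  qed simp
qed

text \<open>\<open>J\<close> is linear and carries \<open>N\<close> to a norm, so \<open>N\<close>
  inherits homogeneity and the triangle inequality on \<open>c00\<close>.\<close>

lemma implicit_space_of_completion:
  fixes J :: "(nat \<Rightarrow> real) \<Rightarrow> 'a::banach"
  assumes "\<forall>j. n j > 0" and "\<forall>j. m j > 0"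
    and "summable (\<lambda>j. 1 / real (m j))" and "(\<Sum>j. 1 / real (m j)) \<le> 1 / 10"
    and lim: "\<forall>a::real. a > 0 \<longrightarrow> filterlim (\<lambda>j. real (n j) powr a / real (m j)) at_top sequentially"
    and "implicit_norm n m N" and J: "completion_map N J"
  shows "implicit_space n m N"
proof
  have Jl: "linear_on_c00 J" and Jn: "\<And>a. a \<in> c00 \<Longrightarrow> norm (J a) = N a"
    using J by (auto simp: completion_map_def)
  have "filterlim (\<lambda>j. real (n j) powr 1 / real (m j)) at_top sequentially" using lim zero_less_one by blast
  moreover have "real (n j) powr 1 = real (n j)" for j using assms(1) by simp
  ultimately show "filterlim (\<lambda>j. real (n j) / real (m j)) at_top sequentially" by simp
  fix a b :: "nat \<Rightarrow> real" and r :: real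
  show "N (\<lambda>i. r * a i) = \<bar>r\<bar> * N a" if "a \<in> c00"
  proof -
    have "J (\<lambda>i. r * a i) = r *\<^sub>R J a" using Jl that unfolding linear_on_c00_def by blast
    then show ?thesis using Jn[OF that] Jn[OF c00_scale[OF that, of r]] by simp
  qed
  show "N (\<lambda>i. a i + b i) \<le> N a + N b" if "a \<in> c00" "b \<in> c00"
  proof -
    have "J (\<lambda>i. a i + b i) = J a + J b" using Jl that unfolding linear_on_c00_def by blast
    then show ?thesis
      using Jn[OF that(1)] Jn[OF that(2)] Jn[OF c00_add[OF that]] norm_triangle_ineq[of "J a" "J b"] by simp
  qed
qed (use assms in auto)

lemma infinite_filter_nonbot: "infinite M \<Longrightarrow> inf sequentially (principal M) \<noteq> bot"
  unfolding trivial_limit_def eventually_inf_principal eventually_sequentially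
  by (meson infinite_nat_iff_unbounded_le)

text \<open>Presents one block as a combination, so that the equivalence estimates also bound each
  \<open>nu (b i)\<close>.\<close>

lemma single_block_sum:
  fixes b :: "nat \<Rightarrow> nat \<Rightarrow> real"
  shows "(\<lambda>j. \<Sum>t<Suc i. (if t = i then 1 else 0) * b t j) = b i"
  by (auto simp: fun_eq_iff intro!: sum.neutral)

theorem mainTheorem17:
  fixes n m :: "nat \<Rightarrow> nat"
    and N :: "(nat \<Rightarrow> real) \<Rightarrow> real"
    and J :: "(nat \<Rightarrow> real) \<Rightarrow> 'a::banach"
    and k :: nat
    and x :: "nat set \<Rightarrow> 'a"
    and nu :: "(nat \<Rightarrow> real) \<Rightarrow> real"
    and T :: "(nat \<Rightarrow> real) \<Rightarrow> 'b::banach"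
  assumes "strict_mono n" and "strict_mono m"
    and "\<forall>j. n j > 0" and "\<forall>j. m j > 0"
    and "summable (\<lambda>j. 1 / real (m j))" and "(\<Sum>j. 1 / real (m j)) \<le> 1 / 10"
    and "\<forall>a::real. a > 0 \<longrightarrow> filterlim (\<lambda>j. real (n j) powr a / real (m j)) at_top sequentially"
    and "\<forall>j. real (n j) / real (n (Suc j)) < 1 / real (m j)"
    and "implicit_norm n m N"
    and "completion_map N J"
    and "k \<ge> 1"
    and "spreading_model k x nu"
    and "generated_banach nu T"
  shows "(\<forall>p::real. 1 \<le> p \<longrightarrow> \<not> embeds_iso (lp_space p) (lp_norm p) (UNIV :: 'b set))
         \<and> \<not> embeds_iso c0_space c0_norm (UNIV :: 'b set)"
proof -
  note lim = assms(7)
  obtain M where gen: "generates_sm k x M nu" and semi: "seminorm_c00 nu"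
    using assms(12) unfolding spreading_model_def by blast
  have "infinite M" using gen unfolding generates_sm_def by (rule conjunct1)
  then obtain U where U: "is_ultra U" "U \<le> inf sequentially (principal M)"
    using ultrafilter_exists[OF infinite_filter_nonbot] by blast
  interpret implicit_space n m N
    by (rule implicit_space_of_completion) (use assms in auto)
  interpret sm_source n m N J k x M nu U
    by unfold_locales (use assms(10,11) gen semi U in \<open>auto simp: completion_map_def\<close>)
  have linV: "linear_on_c00 V"
    if "c00 \<subseteq> S" "\<forall>a\<in>S. \<forall>b\<in>S. V (\<lambda>i. a i + b i) = V a + V b"
      "\<forall>a\<in>S. \<forall>r::real. V (\<lambda>i. r * a i) = r *\<^sub>R V a" for S and V :: "(nat \<Rightarrow> real) \<Rightarrow> 'b"
    using that unfolding linear_on_c00_def by blast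
  have "\<not> embeds_iso (lp_space p) (lp_norm p) (UNIV :: 'b set)" if p: "1 \<le> p" for p
  proof
    assume "embeds_iso (lp_space p) (lp_norm p) (UNIV :: 'b set)"
    then obtain V :: "(nat \<Rightarrow> real) \<Rightarrow> 'b" and c C where c: "c > 0" "C > 0"
      and V: "\<forall>a\<in>lp_space p. \<forall>b\<in>lp_space p. V (\<lambda>i. a i + b i) = V a + V b"
        "\<forall>a\<in>lp_space p. \<forall>r::real. V (\<lambda>i. r * a i) = r *\<^sub>R V a"
      and Vb: "\<forall>a\<in>lp_space p. c * lp_norm p a \<le> norm (V a) \<and> norm (V a) \<le> C * lp_norm p a"
      unfolding embeds_iso_def by (elim exE conjE)
    have Vl: "linear_on_c00 V" by (rule linV[OF c00_sub_lp V])
    have Vb': "c * lp_norm p a \<le> norm (V a) \<and> norm (V a) \<le> C * lp_norm p a" if "a \<in> c00" for a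
      using Vb c00_sub_lp that by blast
    have "\<exists>\<iota> g l b. equivalent_blocks nu (lp_norm p) (c / 2) (C + c / 2) \<iota> g l b"
      by (rule c00_embedding_blocks[OF assms(13) Vl c(1)]) (simp_all add: abs_le_lp_norm lp_norm_scale p Vb')
    then obtain \<iota> g l b where g: "block_supp \<iota> g" "\<forall>i. lp_norm p (g i) = 1" and b: "block_supp l b"
      and zs0: "\<forall>i. (\<Sum>j | b i j \<noteq> 0. b i j) = 0"
      and est0: "\<forall>K \<alpha>. c / 2 * lp_norm p (\<lambda>i. \<Sum>t<K. \<alpha> t * g t i) \<le> nu (\<lambda>j. \<Sum>t<K. \<alpha> t * b t j) \<and>
       nu (\<lambda>j. \<Sum>t<K. \<alpha> t * b t j) \<le> (C + c / 2) * lp_norm p (\<lambda>i. \<Sum>t<K. \<alpha> t * g t i)"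
      unfolding equivalent_blocks_def by (elim exE conjE)
    have zs: "(\<Sum>j | b i j \<noteq> 0. b i j) = 0" for i using zs0 by blast
    have nrm: "lp_norm p (\<lambda>i. \<Sum>t<K. \<alpha> t * g t i) = (\<Sum>t<K. \<bar>\<alpha> t\<bar> powr p) powr (1 / p)" for K \<alpha>
      using g p by (intro lp_norm_blocks) auto
    have est: "c / 2 * (\<Sum>t<K. \<bar>\<alpha> t\<bar> powr p) powr (1 / p) \<le> nu (\<lambda>j. \<Sum>t<K. \<alpha> t * b t j)"
      "nu (\<lambda>j. \<Sum>t<K. \<alpha> t * b t j) \<le> (C + c / 2) * (\<Sum>t<K. \<bar>\<alpha> t\<bar> powr p) powr (1 / p)" for K \<alpha>
      using est0 unfolding nrm by blast+
    have one: "(\<Sum>t<Suc i. \<bar>if t = i then 1 else 0\<bar> powr p) powr (1 / p) = 1" for i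
    proof -
      have "(\<Sum>t<Suc i. \<bar>if t = i then 1 else (0::real)\<bar> powr p) = (\<Sum>t<Suc i. if t = i then 1 else 0)"
        by (rule sum.cong) auto
      then show ?thesis by simp
    qed
    have bi: "c / 2 \<le> nu (b i)" "nu (b i) \<le> C + c / 2" for i
      using est[where K = "Suc i" and \<alpha> = "\<lambda>t. if t = i then 1 else 0"] unfolding one single_block_sum by auto
    \<comment> \<open>For \<open>p > 1\<close> the exponent \<open>1 - 1 / p\<close> is positive, as
      the growth condition requires. At \<open>p = 1\<close> it would be 0, and only the convex
      combinations remain.\<close>
    show False
    proof (cases "p = 1")
      case True
      show False
      proof (rule ell1_blocks_impossible[OF b zs])
        show "rho a (b i) \<le> C + c / 2" if "a < k" for a i
          using rho_le_nu[OF block_supp_c00[OF b] zs that] bi(2) order_trans by blast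
        show "0 < c / 2" using c by simp
        fix s q u assume "pos_comb b s q 1 u"
        then obtain \<alpha> where \<alpha>: "\<forall>i. 0 \<le> \<alpha> i" "(\<Sum>i\<in>{s..<q}. \<alpha> i) = 1" "u = (\<lambda>j. \<Sum>i\<in>{s..<q}. \<alpha> i * b i j)"
          unfolding pos_comb_def by blast
        \<comment> \<open>Extended by zero below \<open>s\<close>, because the equivalence estimates
          concern sums that start at index 0.\<close>
        define \<alpha>' where "\<alpha>' i = (if s \<le> i then \<alpha> i else 0)" for i
        have sub: "(\<Sum>i\<in>{s..<q}. \<alpha> i * f i) = (\<Sum>i<q. \<alpha>' i * f i)" for f :: "nat \<Rightarrow> real"
        proof -
          have "(\<Sum>i\<in>{s..<q}. \<alpha> i * f i) = (\<Sum>i\<in>{s..<q}. \<alpha>' i * f i)" by (rule sum.cong) (auto simp: \<alpha>'_def)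
          also have "\<dots> = (\<Sum>i<q. \<alpha>' i * f i)" by (rule sum.mono_neutral_left) (auto simp: \<alpha>'_def)
          finally show ?thesis .
        qed
        have "(\<Sum>i<q. \<bar>\<alpha>' i\<bar> powr p) = (\<Sum>i<q. \<alpha>' i * 1)"
          using \<alpha>(1) True by (intro sum.cong) (auto simp: \<alpha>'_def)
        also have "\<dots> = 1" using sub[of "\<lambda>_. 1"] \<alpha>(2) by simp
        finally have "(\<Sum>i<q. \<bar>\<alpha>' i\<bar> powr p) powr (1 / p) = 1" by simp
        moreover have "u = (\<lambda>j. \<Sum>i<q. \<alpha>' i * b i j)" unfolding \<alpha>(3) sub ..
        ultimately show "c / 2 \<le> nu u" using est(1)[where K = q and \<alpha> = \<alpha>'] by simp
      qed
    next
      case False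
      then have p1: "p > 1" using p by simp
      show False
      proof (rule sublinear_blocks_impossible[OF b zs _ bi(1), where \<theta> = "1 / p" and C = "C + c / 2"])
        show "0 < c / 2" using c by simp
        fix K :: nat
        show "nu (\<lambda>j. \<Sum>i<K. b i j) \<le> (C + c / 2) * real K powr (1 / p)"
          using est(2)[where K = K and \<alpha> = "\<lambda>_. 1"] by simp
        show "filterlim (\<lambda>q. real (n q) powr (1 - 1 / p) / real (m q)) at_top sequentially"
          using lim p1 by simp
      qed
    qed
  qed
  moreover have "\<not> embeds_iso c0_space c0_norm (UNIV :: 'b set)"
  proof
    assume "embeds_iso c0_space c0_norm (UNIV :: 'b set)"
    then obtain V :: "(nat \<Rightarrow> real) \<Rightarrow> 'b" and c C where c: "c > 0" "C > 0"
      and V: "\<forall>a\<in>c0_space. \<forall>b\<in>c0_space. V (\<lambda>i. a i + b i) = V a + V b"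
        "\<forall>a\<in>c0_space. \<forall>r::real. V (\<lambda>i. r * a i) = r *\<^sub>R V a"
      and Vb: "\<forall>a\<in>c0_space. c * c0_norm a \<le> norm (V a) \<and> norm (V a) \<le> C * c0_norm a"
      unfolding embeds_iso_def by (elim exE conjE)
    have Vl: "linear_on_c00 V" by (rule linV[OF c00_sub_c0 V])
    have Vb': "c * c0_norm a \<le> norm (V a) \<and> norm (V a) \<le> C * c0_norm a" if "a \<in> c00" for a
      using Vb c00_sub_c0 that by blast
    have "\<exists>\<iota> g l b. equivalent_blocks nu c0_norm (c / 2) (C + c / 2) \<iota> g l b"
      by (rule c00_embedding_blocks[OF assms(13) Vl c(1)]) (simp_all add: abs_le_c0_norm c0_norm_scale Vb')
    then obtain \<iota> g l b where g: "block_supp \<iota> g" "\<forall>i. c0_norm (g i) = 1" and b: "block_supp l b"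
      and zs0: "\<forall>i. (\<Sum>j | b i j \<noteq> 0. b i j) = 0"
      and est0: "\<forall>K \<alpha>. c / 2 * c0_norm (\<lambda>i. \<Sum>t<K. \<alpha> t * g t i) \<le> nu (\<lambda>j. \<Sum>t<K. \<alpha> t * b t j) \<and>
       nu (\<lambda>j. \<Sum>t<K. \<alpha> t * b t j) \<le> (C + c / 2) * c0_norm (\<lambda>i. \<Sum>t<K. \<alpha> t * g t i)"
      unfolding equivalent_blocks_def by (elim exE conjE)
    have zs: "(\<Sum>j | b i j \<noteq> 0. b i j) = 0" for i using zs0 by blast
    have bi: "c / 2 \<le> nu (b i)" for i
    proof -
      have "c / 2 * c0_norm (\<lambda>ia. \<Sum>t<Suc i. (if t = i then 1 else 0) * g t ia) \<le> nu (\<lambda>j. \<Sum>t<Suc i. (if t = i then 1 else 0) * b t j)"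
        by (rule est0[THEN spec, THEN spec, THEN conjunct1])
      then show ?thesis unfolding single_block_sum using g(2) by simp
    qed
    have g1: "c0_norm (g i) = 1" for i using g(2) by blast
    show False
    proof (rule sublinear_blocks_impossible[OF b zs _ bi, where \<theta> = 0 and C = "C + c / 2"])
      show "0 < c / 2" using c by simp
      show "filterlim (\<lambda>q. real (n q) powr (1 - 0) / real (m q)) at_top sequentially"
        using lim[THEN spec, of 1] by simp
      fix K :: nat assume K: "K > 0"
      have "nu (\<lambda>j. \<Sum>i<K. 1 * b i j) \<le> (C + c / 2) * c0_norm (\<lambda>i. \<Sum>t<K. 1 * g t i)"
        by (rule est0[THEN spec, THEN spec, THEN conjunct2])
      also have "\<dots> \<le> (C + c / 2) * 1"
        using c by (intro mult_left_mono c0_norm_blocks[OF g(1) g1]) auto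
      finally show "nu (\<lambda>j. \<Sum>i<K. b i j) \<le> (C + c / 2) * real K powr 0" using K by simp
    qed
  qed
  ultimately show ?thesis by blast
qed

end
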